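(* Let $X$ be a compact Kähler manifold with Kähler form $\omega$ whose Kähler metric is real analytic. Then for all $(1,1)$-forms $\alpha,\beta,\gamma\in A^{1,1}(X)$, $$[\gamma,[\alpha,\beta]]+[\beta,[\gamma,\alpha]]+[\alpha,[\beta,\gamma]]=0,$$ where $[\ ,\ ]:A^{p,1}\times A^{q,1}\to A^{p+q,1}$ is the bracket defined in the context.
   Context: $A^{p,q}$ denotes smooth $(p,q)$-forms on $X$, and $A^{p,0}(\Theta)$ smooth $(p,0)$-forms with values in the holomorphic tangent bundle. The interior product is $(v\otimes\xi)\lrcorner\,\eta=\xi\wedge\iota_v\eta$ ($v$ a $(1,0)$-vector field, $\xi$ a $(p,0)$-form); $\lrcorner\,\omega$ gives an isomorphism $A^{p,0}(\Theta)\to A^{p,1}$. Bracket: for $\alpha\in A^{p,1}$, $\beta\in A^{q,1}$ let $\theta\in A^{p,0}(\Theta)$, $\phi\in A^{q,0}(\Theta)$ be determined by $\theta\lrcorner\,\omega=\alpha$, $\phi\lrcorner\,\omega=\beta$. At a given point $P$ choose local holomorphic coordinates with $\omega=\frac i2\sum dz_i\wedge d\bar z_i+O(|z|^2)$, and write $\theta=\sum_I\theta_I\otimes dz_I$, $\phi=\sum_K\phi_K\otimes dz_K$ with $\theta_I=\sum_j\theta_{Ij}\,\partial/\partial z_j$, $\phi_K=\sum_j\phi_{Kj}\,\partial/\partial z_j$. Then at $P$ $$[\theta,\phi]=\sum_{I,K}\Big(\sum_{j,l}\big(\theta_{Ij}\tfrac{\partial\phi_{Kl}}{\partial z_j}-\phi_{Kj}\tfrac{\partial\theta_{Il}}{\partial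 z_j}\big)\tfrac{\partial}{\partial z_l}\Big)\otimes dz_I\wedge dz_K,$$ and $[\alpha,\beta]:=[\theta,\phi]\lrcorner\,\omega\in A^{p+q,1}$. This is independent of the choice of such coordinates. For $p=q=1$, with $\alpha=\frac i2\sum a_{ij}\,dz_i\wedge d\bar z_j$ and $\beta=\frac i2\sum b_{ij}\,dz_i\wedge d\bar z_j$, it reads $[\alpha,\beta]=\frac i2\sum\big(a_{ij}\frac{\partial b_{kl}}{\partial z_j}+b_{ij}\frac{\partial a_{kl}}{\partial z_j}\big)d\bar z_l\wedge dz_i\wedge dz_k$ at $P$. *)

theory Defs
  imports "HOL-Analysis.Analysis" "HOL-Library.Landau_Symbols" "HOL-Combinatorics.Permutations"
begin

section \<open>Smooth, real analytic and holomorphic maps\<close>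

text \<open>All three notions are only used on open sets.\<close>

primrec Ck_on :: "nat \<Rightarrow> 'a::real_normed_vector set \<Rightarrow> ('a \<Rightarrow> 'b::real_normed_vector) \<Rightarrow> bool" where
  "Ck_on 0 S f \<longleftrightarrow> continuous_on S f"
| "Ck_on (Suc k) S f \<longleftrightarrow> (\<forall>x\<in>S. f differentiable (at x)) \<and>
     (\<forall>v. Ck_on k S (\<lambda>x. frechet_derivative f (at x) v))"

definition smooth_on :: "'a::real_normed_vector set \<Rightarrow> ('a \<Rightarrow> 'b::real_normed_vector) \<Rightarrow> bool" where
  "smooth_on S f \<longleftrightarrow> (\<forall>k. Ck_on k S f)"

text \<open>Local expansion in a power series in the real coordinates; the sum runs over the multi-indices
  \<open>m\<close>, which are functions on the standard basis extended by zero.\<close>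

definition real_analytic_on :: "'a::euclidean_space set \<Rightarrow> ('a \<Rightarrow> 'b::banach) \<Rightarrow> bool" where
  "real_analytic_on S f \<longleftrightarrow> (\<forall>a\<in>S. \<exists>r>0. \<exists>c :: ('a \<Rightarrow> nat) \<Rightarrow> 'b. \<forall>x\<in>ball a r.
     ((\<lambda>m. (\<Prod>b\<in>Basis. ((x - a) \<bullet> b) ^ m b) *\<^sub>R c m) has_sum f x) {m. \<forall>b. b \<notin> Basis \<longrightarrow> m b = 0})"

definition holomorphic_map_on :: "(complex^'n) set \<Rightarrow> (complex^'n \<Rightarrow> complex^'m) \<Rightarrow> bool" where
  "holomorphic_map_on S f \<longleftrightarrow> (\<forall>z\<in>S. \<exists>D. (f has_derivative D) (at z) \<and> (\<forall>t v. D (t *s v) = t *s D v))"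

text \<open>The Wirtinger derivative \<open>\<partial>f/\<partial>z\<^sub>j = (\<partial>f/\<partial>x\<^sub>j - \<i> \<partial>f/\<partial>y\<^sub>j) / 2\<close>.\<close>

definition del :: "'n \<Rightarrow> (complex^'n::finite \<Rightarrow> complex) \<Rightarrow> complex^'n \<Rightarrow> complex" where
  "del j f z = (frechet_derivative f (at z) (axis j 1) - \<i> * frechet_derivative f (at z) (axis j \<i>)) / 2"

section \<open>Complex manifolds\<close>

text \<open>A complex manifold is a topological space with an atlas of charts \<open>(U, \<phi>)\<close>. The index type
  \<open>'n\<close> of the coordinates carries a linear order only in order to speak about increasing
  multi-indices.\<close>

type_synonym ('a, 'n) chart = "'a set \<times> ('a \<Rightarrow> complex^'n)"

definition is_chart :: "'a topology \<Rightarrow> ('a, 'n::finite) chart \<Rightarrow> bool" where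
  "is_chart X c \<longleftrightarrow> openin X (fst c) \<and> open (snd c ` fst c) \<and>
     homeomorphic_map (subtopology X (fst c)) (top_of_set (snd c ` fst c)) (snd c)"

definition transition :: "('a, 'n) chart \<Rightarrow> ('a, 'n) chart \<Rightarrow> complex^'n \<Rightarrow> complex^'n" where
  "transition c d z = snd d (inv_into (fst c) (snd c) z)"

definition compatible :: "('a, 'n::finite) chart \<Rightarrow> ('a, 'n) chart \<Rightarrow> bool" where
  "compatible c d \<longleftrightarrow>
     holomorphic_map_on (snd c ` (fst c \<inter> fst d)) (transition c d) \<and>
     holomorphic_map_on (snd d ` (fst c \<inter> fst d)) (transition d c)"

definition complex_atlas :: "'a topology \<Rightarrow> ('a, 'n::finite) chart set \<Rightarrow> bool" where
  "complex_atlas X A \<longleftrightarrow> (\<forall>c\<in>A. is_chart X c) \<and> (\<Union>c\<in>A. fst c) = topspace X \<and>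
     (\<forall>c\<in>A. \<forall>d\<in>A. compatible c d)"

text \<open>The maximal atlas: all systems of local holomorphic coordinates.\<close>

definition charts :: "'a topology \<Rightarrow> ('a, 'n::finite) chart set \<Rightarrow> ('a, 'n) chart set" where
  "charts X A = {c. is_chart X c \<and> (\<forall>d\<in>A. compatible c d)}"

definition jac :: "('a, 'n::finite) chart \<Rightarrow> ('a, 'n) chart \<Rightarrow> complex^'n \<Rightarrow> complex^'n \<Rightarrow> complex^'n" where
  "jac c d z = frechet_derivative (transition c d) (at z)"

section \<open>Exterior algebra at a point\<close>

text \<open>A complex-valued \<open>k\<close>-form at a point of \<open>\<complex>\<^sup>n\<close> is an alternating real-multilinear function of
  \<open>k\<close> real tangent vectors, which are elements of \<open>\<complex>\<^sup>n\<close>. It is a function on lists of vectors that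
  vanishes on lists of length other than \<open>k\<close>. Elements of \<open>\<complex>\<^sup>n\<close> also serve as the coordinates
  \<open>v\<^sub>j\<close> of a \<open>(1,0)\<close>-vector \<open>\<Sum>\<^sub>j v\<^sub>j \<partial>/\<partial>z\<^sub>j\<close>.\<close>

type_synonym 'n ext = "(complex^'n) list \<Rightarrow> complex"
type_synonym 'n vext = "(complex^'n) list \<Rightarrow> complex^'n"

text \<open>Wedge product of a \<open>p\<close>-form and a \<open>q\<close>-form, in the convention
  \<open>(dx \<and> dy)(v, w) = dx(v) dy(w) - dx(w) dy(v)\<close>.\<close>

definition wedge :: "nat \<Rightarrow> nat \<Rightarrow> 'n ext \<Rightarrow> 'n ext \<Rightarrow> 'n ext" where
  "wedge p q \<xi> \<eta> vs = (if length vs = p + q then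
     (\<Sum>\<sigma> | \<sigma> permutes {..<p + q}. of_int (sign \<sigma>) *
        \<xi> (map (\<lambda>i. vs ! \<sigma> i) [0..<p]) * \<eta> (map (\<lambda>i. vs ! \<sigma> i) [p..<p + q])) / (fact p * fact q)
     else 0)"

primrec dz :: "'n::finite list \<Rightarrow> 'n ext" where
  "dz [] = (\<lambda>vs. if vs = [] then 1 else 0)"
| "dz (i # I) = wedge 1 (length I) (\<lambda>vs. hd vs $ i) (dz I)"

primrec dzbar :: "'n::finite list \<Rightarrow> 'n ext" where
  "dzbar [] = (\<lambda>vs. if vs = [] then 1 else 0)"
| "dzbar (i # I) = wedge 1 (length I) (\<lambda>vs. cnj (hd vs $ i)) (dzbar I)"

definition increasing :: "nat \<Rightarrow> 'n::linorder list set" where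
  "increasing p = {I. length I = p \<and> sorted_wrt (<) I}"

definition frame :: "'n list \<Rightarrow> (complex^'n::finite) list" where
  "frame I = map (\<lambda>i. axis i 1) I"

text \<open>Contraction with the \<open>(1,0)\<close>-vector \<open>v\<close>, which is the complexified tangent vector
  \<open>(v - \<i> J v) / 2\<close>; it sends \<open>dz\<^sub>j\<close> to \<open>v\<^sub>j\<close> and \<open>dz\<^sub>j-bar\<close> to \<open>0\<close>.\<close>

definition contract :: "complex^'n \<Rightarrow> 'n ext \<Rightarrow> 'n ext" where
  "contract v \<eta> ws = (\<eta> (v # ws) - \<i> * \<eta> ((\<i> *s v) # ws)) / 2"

text \<open>\<open>\<theta> \<lrcorner> \<eta> = \<Sum>\<^sub>I dz\<^sub>I \<and> \<iota> \<theta>\<^sub>I \<eta>\<close> for \<open>\<theta> = \<Sum>\<^sub>I \<theta>\<^sub>I \<otimes> dz\<^sub>I\<close> of degree \<open>p\<close> and a form \<open>\<eta>\<close> of degree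
  \<open>k + 1\<close>; the coefficient \<open>\<theta>\<^sub>I\<close> is the value of \<open>\<theta>\<close> on the frame vectors indexed by \<open>I\<close>.\<close>

definition interior_prod :: "nat \<Rightarrow> nat \<Rightarrow> 'n::{finite,linorder} vext \<Rightarrow> 'n ext \<Rightarrow> 'n ext" where
  "interior_prod p k \<theta> \<eta> vs =
     (\<Sum>I\<in>increasing p. wedge p k (dz I) (contract (\<theta> (frame I)) \<eta>) vs)"

section \<open>Differential forms\<close>

text \<open>A form on the manifold is a family, indexed by the charts \<open>c\<close> of the maximal atlas, of forms on
  the coordinate domains in \<open>\<complex>\<^sup>n\<close> that are related by pullback along the transition maps. It is
  extended by zero off the coordinate domains and off the maximal atlas, so that equality of forms
  is equality of functions. Smoothness of all evaluations on constant vectors is smoothness of the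
  coefficients.\<close>

type_synonym ('a, 'n) form = "('a, 'n) chart \<Rightarrow> complex^'n \<Rightarrow> 'n ext"
type_synonym ('a, 'n) vform = "('a, 'n) chart \<Rightarrow> complex^'n \<Rightarrow> 'n vext"

definition forms :: "'a topology \<Rightarrow> ('a, 'n::{finite,linorder}) chart set \<Rightarrow> nat \<Rightarrow> nat \<Rightarrow> ('a, 'n) form set"
  where "forms X A p q = {\<eta>.
     (\<forall>c\<in>charts X A. \<forall>z \<in> snd c ` fst c. \<exists>a. \<forall>vs.
        \<eta> c z vs = (\<Sum>I\<in>increasing p. \<Sum>J\<in>increasing q. a I J * wedge p q (dz I) (dzbar J) vs)) \<and>
     (\<forall>c\<in>charts X A. \<forall>vs. smooth_on (snd c ` fst c) (\<lambda>z. \<eta> c z vs)) \<and>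
     (\<forall>c\<in>charts X A. \<forall>d\<in>charts X A. \<forall>z \<in> snd c ` (fst c \<inter> fst d). \<forall>vs.
        \<eta> c z vs = \<eta> d (transition c d z) (map (jac c d z) vs)) \<and>
     (\<forall>c z vs. c \<notin> charts X A \<or> z \<notin> snd c ` fst c \<longrightarrow> \<eta> c z vs = 0)}"

text \<open>\<open>(p,0)\<close>-forms with values in the holomorphic tangent bundle.\<close>

definition vforms :: "'a topology \<Rightarrow> ('a, 'n::{finite,linorder}) chart set \<Rightarrow> nat \<Rightarrow> ('a, 'n) vform set"
  where "vforms X A p = {\<theta>.
     (\<forall>c\<in>charts X A. \<forall>z \<in> snd c ` fst c. \<exists>a. \<forall>vs.
        \<theta> c z vs = (\<Sum>I\<in>increasing p. dz I vs *s a I)) \<and>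
     (\<forall>c\<in>charts X A. \<forall>vs. smooth_on (snd c ` fst c) (\<lambda>z. \<theta> c z vs)) \<and>
     (\<forall>c\<in>charts X A. \<forall>d\<in>charts X A. \<forall>z \<in> snd c ` (fst c \<inter> fst d). \<forall>vs.
        jac c d z (\<theta> c z vs) = \<theta> d (transition c d z) (map (jac c d z) vs)) \<and>
     (\<forall>c z vs. c \<notin> charts X A \<or> z \<notin> snd c ` fst c \<longrightarrow> \<theta> c z vs = 0)}"

text \<open>Exterior derivative of a form on an open subset of \<open>\<complex>\<^sup>n\<close>, evaluated on constant vector fields.\<close>

definition ext_deriv :: "(complex^'n::finite \<Rightarrow> 'n ext) \<Rightarrow> complex^'n \<Rightarrow> 'n ext" where
  "ext_deriv \<eta> z vs = (\<Sum>i<length vs. (-1) ^ i *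
     frechet_derivative (\<lambda>y. \<eta> y (take i vs @ drop (Suc i) vs)) (at z) (vs ! i))"

section \<open>Kaehler forms\<close>

definition kaehler_metric :: "('a, 'n) form \<Rightarrow> ('a, 'n) chart \<Rightarrow> complex^'n \<Rightarrow> complex^'n \<Rightarrow> complex^'n \<Rightarrow> real"
  where "kaehler_metric \<omega> c z v w = Re (\<omega> c z [v, \<i> *s w])"

definition kaehler_form :: "'a topology \<Rightarrow> ('a, 'n::{finite,linorder}) chart set \<Rightarrow> ('a, 'n) form \<Rightarrow> bool"
  where "kaehler_form X A \<omega> \<longleftrightarrow> \<omega> \<in> forms X A 1 1 \<and>
     (\<forall>c\<in>charts X A. \<forall>z \<in> snd c ` fst c.
        (\<forall>v w. \<omega> c z [v, w] \<in> \<real>) \<and>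
        (\<forall>v. v \<noteq> 0 \<longrightarrow> kaehler_metric \<omega> c z v v > 0) \<and>
        (\<forall>u v w. ext_deriv (\<omega> c) z [u, v, w] = 0))"

definition real_analytic_metric :: "'a topology \<Rightarrow> ('a, 'n::{finite,linorder}) chart set \<Rightarrow> ('a, 'n) form \<Rightarrow> bool"
  where "real_analytic_metric X A \<omega> \<longleftrightarrow>
     (\<forall>c\<in>charts X A. \<forall>v w. real_analytic_on (snd c ` fst c) (\<lambda>z. kaehler_metric \<omega> c z v w))"

text \<open>Coordinates centred at \<open>P\<close> with \<open>\<omega> = \<i>/2 \<Sum>\<^sub>i dz\<^sub>i \<and> dz\<^sub>i-bar + O(|z|\<^sup>2)\<close>.\<close>

definition flat_form :: "'n::finite ext" where
  "flat_form vs = \<i> / 2 * (\<Sum>i\<in>UNIV. wedge 1 1 (dz [i]) (dzbar [i]) vs)"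

definition normal_chart ::
  "'a topology \<Rightarrow> ('a, 'n::{finite,linorder}) chart set \<Rightarrow> ('a, 'n) form \<Rightarrow> 'a \<Rightarrow> ('a, 'n) chart \<Rightarrow> bool"
  where "normal_chart X A \<omega> P c \<longleftrightarrow> c \<in> charts X A \<and> P \<in> fst c \<and> snd c P = 0 \<and>
     (\<forall>vs. (\<lambda>z. \<omega> c z vs - flat_form vs) \<in> O[nhds 0](\<lambda>z. of_real ((norm z)\<^sup>2)))"

section \<open>The bracket\<close>

text \<open>The coordinate expression of the bracket of \<open>A\<^sup>p\<^sup>,\<^sup>0(\<Theta>)\<close> and \<open>A\<^sup>q\<^sup>,\<^sup>0(\<Theta>)\<close> at \<open>z\<close>.\<close>

definition coord_bracket ::
  "nat \<Rightarrow> nat \<Rightarrow> ((complex, 'n) vec \<Rightarrow> 'n vext) \<Rightarrow> ((complex, 'n) vec \<Rightarrow> 'n vext) \<Rightarrow> (complex, 'n) vec \<Rightarrow>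
     'n::{finite,linorder} vext"
  where "coord_bracket p q \<theta> \<phi> z vs =
     (\<Sum>I\<in>increasing p. \<Sum>K\<in>increasing q. wedge p q (dz I) (dz K) vs *s
        (\<chi> l. \<Sum>j\<in>UNIV. \<theta> z (frame I) $ j * del j (\<lambda>y. \<phi> y (frame K) $ l) z
                     - \<phi> z (frame K) $ j * del j (\<lambda>y. \<theta> y (frame I) $ l) z))"

text \<open>At each point \<open>P\<close> the coordinate expression is taken in a normal chart \<open>c\<close> at \<open>P\<close>, and the result
  is transported to the chart \<open>d\<close> by the transition maps.\<close>

definition vbracket ::
  "'a topology \<Rightarrow> ('a, 'n::{finite,linorder}) chart set \<Rightarrow> ('a, 'n) form \<Rightarrow> nat \<Rightarrow> nat \<Rightarrow>
     ('a, 'n) vform \<Rightarrow> ('a, 'n) vform \<Rightarrow> ('a, 'n) vform"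
  where "vbracket X A \<omega> p q \<theta> \<phi> d w vs =
     (if d \<in> charts X A \<and> w \<in> snd d ` fst d then
        (let P = inv_into (fst d) (snd d) w; c = (SOME c. normal_chart X A \<omega> P c)
         in jac c d 0 (coord_bracket p q (\<theta> c) (\<phi> c) 0 (map (jac d c w) vs)))
      else 0)"

definition vinterior :: "nat \<Rightarrow> ('a, 'n) vform \<Rightarrow> ('a, 'n) form \<Rightarrow> ('a, 'n::{finite,linorder}) form" where
  "vinterior p \<theta> \<omega> c z = interior_prod p 1 (\<theta> c z) (\<omega> c z)"

text \<open>The inverse of the isomorphism \<open>\<theta> \<mapsto> \<theta> \<lrcorner> \<omega>\<close> from \<open>A\<^sup>p\<^sup>,\<^sup>0(\<Theta>)\<close> to \<open>A\<^sup>p\<^sup>,\<^sup>1\<close>.\<close>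

definition to_vform ::
  "'a topology \<Rightarrow> ('a, 'n::{finite,linorder}) chart set \<Rightarrow> ('a, 'n) form \<Rightarrow> nat \<Rightarrow> ('a, 'n) form \<Rightarrow> ('a, 'n) vform"
  where "to_vform X A \<omega> p = inv_into (vforms X A p) (\<lambda>\<theta>. vinterior p \<theta> \<omega>)"

definition bracket ::
  "'a topology \<Rightarrow> ('a, 'n::{finite,linorder}) chart set \<Rightarrow> ('a, 'n) form \<Rightarrow> nat \<Rightarrow> nat \<Rightarrow>
     ('a, 'n) form \<Rightarrow> ('a, 'n) form \<Rightarrow> ('a, 'n) form"
  where "bracket X A \<omega> p q \<alpha> \<beta> =
     vinterior (p + q) (vbracket X A \<omega> p q (to_vform X A \<omega> p \<alpha>) (to_vform X A \<omega> q \<beta>)) \<omega>"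

end

theory Submission
  imports Defs "HOL-Complex_Analysis.Cauchy_Integral_Formula"
begin

text \<open>
  The bracket is a Lie bracket in disguise. Let \<open>\<nabla>\<close> be the \<open>(1,0)\<close>-part of the Chern connection of the
  metric. Its Christoffel symbols vanish at the centre of a normal chart, so there the coordinate
  formula says \<open>[\<theta>,\<phi>](u,v) = B(u,v) - B(v,u)\<close> with
  \<open>B(u,v) = (\<nabla>\<^sub>x \<phi>)(v) - (\<nabla>\<^sub>y \<theta>)(u)\<close>, \<open>x = \<theta>(u)\<close>, \<open>y = \<phi>(v)\<close>; being covariant, this formula holds in
  every chart (\<open>vbracket_1_1\<close>). It shows that the bracket of two smooth sections is smooth, and it
  can be differentiated once more, which a formula valid only at the centre of a chart that depends
  on the point cannot.

  For the Jacobi identity at a point, take a normal chart there. The double bracket contains, first,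
  the terms of the Jacobi identity for vector fields, which cancel because the operators
  \<open>\<partial>/\<partial>z\<^sub>j\<close> commute, and secondly the first derivatives \<open>\<partial>\<^sub>x \<Gamma>(y,u)\<close> of the Christoffel symbols. At the
  centre \<open>\<partial>\<^sub>x \<Gamma>(y,u)\<close> is \<open>\<partial>\<^sub>x \<partial>\<^sub>y g(u,\<sqdot>)\<close> with an index raised, hence symmetric in \<open>x\<close> and \<open>y\<close>; this is
  the vanishing of the curvature of \<open>\<nabla>\<close> in type \<open>(2,0)\<close>. The six terms of this kind then cancel in
  pairs in the cyclic sum (\<open>jacobiator_cyclic\<close>). A cyclic permutation of three one-forms is even, so
  antisymmetrising over the three arguments introduces no further signs (\<open>vbracket_jacobi\<close>).

  Three facts connect this computation with the definition of the bracket. Normal charts exist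
  (\<open>exists_normal_chart\<close>): the change of coordinates \<open>z \<mapsto> w + M z - \<Gamma>(M z, M z) / 2\<close> with a unitary
  frame \<open>M\<close> kills the Christoffel symbols at the centre, because these are symmetric by
  \<open>d\<omega> = 0\<close>. The covariance of \<open>\<nabla>\<close> (\<open>christoffel_transition\<close>) differentiates the Jacobian of a transition
  map, which is possible since holomorphic maps are infinitely differentiable, by Cauchy's integral
  formula. Finally \<open>\<theta> \<mapsto> \<theta> \<lrcorner> \<omega>\<close> is onto the \<open>(1,1)\<close>-forms (\<open>vinterior_sharp\<close>) and injective in degree two
  (\<open>to_vform_2\<close>), so that passing from forms to vector-valued forms and back loses nothing.
\<close>

section \<open>Smooth maps\<close>

lemma Ck_on_Suc_imp: "Ck_on (Suc k) S f \<Longrightarrow> Ck_on k S f"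
proof (induction k arbitrary: f)
  case 0
  then show ?case
    by (auto intro!: continuous_at_imp_continuous_on differentiable_imp_continuous_within)
next
  case (Suc k)
  then show ?case by (metis Ck_on.simps(2))
qed

lemma Ck_on_cong:
  assumes "open S" "\<And>x. x \<in> S \<Longrightarrow> f x = g x" "Ck_on k S f"
  shows "Ck_on k S g"
  using assms(2,3)
proof (induction k arbitrary: f g)
  case 0
  then show ?case by (metis Ck_on.simps(1) continuous_on_cong)
next
  case (Suc k)
  have eq: "frechet_derivative f (at x) = frechet_derivative g (at x)" if "x \<in> S" for x
    using Suc.prems that assms(1) by (intro frechet_derivative_transform_within_open[of f x S g]) auto
  have "g differentiable (at x)" if "x \<in> S" for x
    using Suc.prems that assms(1)
    by (meson Ck_on.simps(2) differentiable_def has_derivative_transform_within_open)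
  moreover have "Ck_on k S (\<lambda>x. frechet_derivative g (at x) v)" for v
    by (rule Suc.IH[of "\<lambda>x. frechet_derivative f (at x) v"]) (use Suc.prems eq in auto)
  ultimately show ?case by simp
qed

lemma Ck_on_SucI:
  assumes "open S" "\<And>x. x \<in> S \<Longrightarrow> (f has_derivative f' x) (at x)" "\<And>v. Ck_on k S (\<lambda>x. f' x v)"
  shows "Ck_on (Suc k) S f"
proof -
  have eq: "f' x = frechet_derivative f (at x)" if "x \<in> S" for x
    by (rule frechet_derivative_at[OF assms(2)[OF that]])
  have "Ck_on k S (\<lambda>x. frechet_derivative f (at x) v)" for v
    using Ck_on_cong[OF assms(1) _ assms(3)[of v], of "\<lambda>x. frechet_derivative f (at x) v"] eq by simp
  then show ?thesis using assms(2) by (auto simp: differentiable_def)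
qed

lemma Ck_on_SucD:
  assumes "Ck_on (Suc k) S f"
  shows "x \<in> S \<Longrightarrow> (f has_derivative frechet_derivative f (at x)) (at x)"
    and "Ck_on k S (\<lambda>x. frechet_derivative f (at x) v)"
  using assms by (simp_all flip: frechet_derivative_works)

lemma Ck_on_const: "open S \<Longrightarrow> Ck_on k S (\<lambda>x. c)"
proof (induction k arbitrary: c)
  case (Suc k)
  show ?case by (rule Ck_on_SucI[OF Suc.prems has_derivative_const Suc.IH[OF Suc.prems]])
qed auto

lemma Ck_on_add:
  assumes "open S" "Ck_on k S f" "Ck_on k S g"
  shows "Ck_on k S (\<lambda>x. f x + g x)"
  using assms(2,3)
proof (induction k arbitrary: f g)
  case (Suc k)
  show ?case
    by (rule Ck_on_SucI[OF assms(1)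
          has_derivative_add[OF Ck_on_SucD(1)[OF Suc.prems(1)] Ck_on_SucD(1)[OF Suc.prems(2)]]])
       (auto intro!: Suc.IH Ck_on_SucD(2)[OF Suc.prems(1)] Ck_on_SucD(2)[OF Suc.prems(2)])
qed (auto intro: continuous_on_add)

lemma Ck_on_linear:
  assumes L: "bounded_linear L" and "open S" "Ck_on k S f"
  shows "Ck_on k S (\<lambda>x. L (f x))"
  using assms(3)
proof (induction k arbitrary: f)
  case (Suc k)
  show ?case
    by (rule Ck_on_SucI[OF assms(2) bounded_linear.has_derivative[OF L Ck_on_SucD(1)[OF Suc.prems]]])
       (auto intro!: Suc.IH Ck_on_SucD(2)[OF Suc.prems])
qed (use L in \<open>auto intro: bounded_linear.continuous_on\<close>)

lemma Ck_on_bilinear: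
  assumes B: "bounded_bilinear B" and "open S" "Ck_on k S f" "Ck_on k S g"
  shows "Ck_on k S (\<lambda>x. B (f x) (g x))"
  using assms(3,4)
proof (induction k arbitrary: f g)
  case (Suc k)
  show ?case
    by (rule Ck_on_SucI[OF assms(2) bounded_bilinear.FDERIV[OF B Ck_on_SucD(1)[OF Suc.prems(1)]
            Ck_on_SucD(1)[OF Suc.prems(2)]]])
       (auto intro!: Ck_on_add assms(2) Suc.IH Ck_on_Suc_imp[OF Suc.prems(1)] Ck_on_Suc_imp[OF Suc.prems(2)]
           Ck_on_SucD(2)[OF Suc.prems(1)] Ck_on_SucD(2)[OF Suc.prems(2)])
qed (use B in \<open>auto intro: bounded_bilinear.continuous_on\<close>)

lemma Ck_on_inverse:
  fixes f :: "'a::real_normed_vector \<Rightarrow> complex"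
  assumes "open S" "\<And>x. x \<in> S \<Longrightarrow> f x \<noteq> 0" "Ck_on k S f"
  shows "Ck_on k S (\<lambda>x. inverse (f x))"
  using assms(2,3)
proof (induction k arbitrary: f)
  case (Suc k)
  have inv: "Ck_on k S (\<lambda>x. inverse (f x))"
    by (rule Suc.IH[OF Suc.prems(1) Ck_on_Suc_imp[OF Suc.prems(2)]])
  show ?case
    by (rule Ck_on_SucI[OF assms(1)
            Deriv.has_derivative_inverse[OF Suc.prems(1) Ck_on_SucD(1)[OF Suc.prems(2)]]])
       (auto intro!: Ck_on_linear[OF bounded_linear_minus[OF bounded_linear_ident] assms(1)]
          Ck_on_bilinear[OF bounded_bilinear_mult assms(1)] inv Ck_on_SucD(2)[OF Suc.prems(2)])
qed (auto intro: continuous_on_inverse)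

lemma smooth_on_cong:
  "open S \<Longrightarrow> (\<And>x. x \<in> S \<Longrightarrow> f x = g x) \<Longrightarrow> smooth_on S f \<Longrightarrow> smooth_on S g"
  unfolding smooth_on_def using Ck_on_cong by metis

lemma smooth_on_const: "open S \<Longrightarrow> smooth_on S (\<lambda>x. c)"
  by (simp add: smooth_on_def Ck_on_const)

lemma smooth_on_add:
  "open S \<Longrightarrow> smooth_on S f \<Longrightarrow> smooth_on S g \<Longrightarrow> smooth_on S (\<lambda>x. f x + g x)"
  by (simp add: smooth_on_def Ck_on_add)

lemma smooth_on_linear:
  "bounded_linear L \<Longrightarrow> open S \<Longrightarrow> smooth_on S f \<Longrightarrow> smooth_on S (\<lambda>x. L (f x))"
  by (simp add: smooth_on_def Ck_on_linear)

lemma smooth_on_diff: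
  "open S \<Longrightarrow> smooth_on S f \<Longrightarrow> smooth_on S g \<Longrightarrow> smooth_on S (\<lambda>x. f x - g x)"
  using smooth_on_add[OF _ _ smooth_on_linear[OF bounded_linear_minus[OF bounded_linear_ident]], of S f g]
  by simp

lemma smooth_on_mult:
  fixes f g :: "'a::real_normed_vector \<Rightarrow> 'b::real_normed_algebra"
  shows "open S \<Longrightarrow> smooth_on S f \<Longrightarrow> smooth_on S g \<Longrightarrow> smooth_on S (\<lambda>x. f x * g x)"
  by (simp add: smooth_on_def Ck_on_bilinear[OF bounded_bilinear_mult])

lemma smooth_on_inverse:
  fixes f :: "'a::real_normed_vector \<Rightarrow> complex"
  shows "open S \<Longrightarrow> (\<And>x. x \<in> S \<Longrightarrow> f x \<noteq> 0) \<Longrightarrow> smooth_on S f \<Longrightarrow> smooth_on S (\<lambda>x. inverse (f x))"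
  by (simp add: smooth_on_def Ck_on_inverse)

lemma smooth_on_sum:
  assumes "open S" "\<And>i. i \<in> I \<Longrightarrow> smooth_on S (f i)"
  shows "smooth_on S (\<lambda>x. \<Sum>i\<in>I. f i x)"
  using assms(2)
  by (induction I rule: infinite_finite_induct) (auto intro!: smooth_on_add assms(1) simp: smooth_on_const[OF assms(1)])

lemma smooth_on_prod:
  fixes f :: "'i \<Rightarrow> 'a::real_normed_vector \<Rightarrow> 'b::{real_normed_algebra,comm_ring_1}"
  assumes "open S" "\<And>i. i \<in> I \<Longrightarrow> smooth_on S (f i)"
  shows "smooth_on S (\<lambda>x. \<Prod>i\<in>I. f i x)"
  using assms(2)
  by (induction I rule: infinite_finite_induct) (auto intro!: smooth_on_mult assms(1) simp: smooth_on_const[OF assms(1)])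

lemma smooth_on_imp_differentiable: "smooth_on S f \<Longrightarrow> x \<in> S \<Longrightarrow> f differentiable (at x)"
  unfolding smooth_on_def by (metis Ck_on.simps(2))

lemma smooth_on_frechet:
  "smooth_on S f \<Longrightarrow> smooth_on S (\<lambda>x. frechet_derivative f (at x) v)"
  unfolding smooth_on_def by (metis Ck_on.simps(2))

lemma bounded_linear_axis: "bounded_linear (\<lambda>t::complex. (axis i t :: complex^'n::finite))"
  by (auto intro!: linearI simp: linear_conv_bounded_linear[symmetric] vec_eq_iff axis_def)

lemma has_derivative_vecI:
  fixes f :: "'a::real_normed_vector \<Rightarrow> complex^'m::finite"
  assumes "\<And>l. ((\<lambda>x. f x $ l) has_derivative (\<lambda>h. f' h $ l)) (at z)"
  shows "(f has_derivative f') (at z)"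
proof -
  have ax: "(\<Sum>l\<in>UNIV. axis l (x $ l)) = (x :: complex^'m)" for x
    by (simp add: vec_eq_iff axis_def sum.delta')
  have "((\<lambda>z. \<Sum>l\<in>UNIV. axis l (f z $ l)) has_derivative
      (\<lambda>h. \<Sum>l\<in>UNIV. (axis l (f' h $ l) :: complex^'m))) (at z)"
    by (intro has_derivative_sum bounded_linear.has_derivative[OF bounded_linear_axis] assms)
  then show ?thesis by (simp add: ax)
qed

lemma smooth_on_vec_nth: "open S \<Longrightarrow> smooth_on S f \<Longrightarrow> smooth_on S (\<lambda>x. f x $ i)"
  by (rule smooth_on_linear[OF bounded_linear_vec_nth])

lemma smooth_on_vecI:
  fixes f :: "'a::real_normed_vector \<Rightarrow> complex^'n::finite"
  assumes "open S" "\<And>i. smooth_on S (\<lambda>x. f x $ i)"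
  shows "smooth_on S f"
proof -
  have "smooth_on S (\<lambda>x. \<Sum>i\<in>UNIV. (axis i (f x $ i) :: complex^'n))"
    by (intro smooth_on_sum smooth_on_linear[OF bounded_linear_axis] assms)
  moreover have "(\<Sum>i\<in>UNIV. (axis i (f x $ i) :: complex^'n)) = f x" for x
    by (simp add: vec_eq_iff axis_def sum.delta')
  ultimately show ?thesis by simp
qed

lemma smooth_on_scale:
  fixes f :: "'a::real_normed_vector \<Rightarrow> complex^'n::finite"
  assumes "open S" "smooth_on S a" "smooth_on S f"
  shows "smooth_on S (\<lambda>x. a x *s f x)"
  by (rule smooth_on_vecI) (auto intro!: smooth_on_mult smooth_on_vec_nth assms)

lemma smooth_on_det:
  fixes M :: "'a::real_normed_vector \<Rightarrow> complex^'n::finite^'n"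
  assumes "open S" "\<And>i j. smooth_on S (\<lambda>x. M x $ i $ j)"
  shows "smooth_on S (\<lambda>x. det (M x))"
  unfolding det_def by (intro smooth_on_sum smooth_on_mult smooth_on_prod smooth_on_const assms)

section \<open>Complex-linear maps\<close>

abbreviation clinear :: "(complex^'n::finite \<Rightarrow> complex^'m::finite) \<Rightarrow> bool" where
  "clinear f \<equiv> Vector_Spaces.linear (*s) (*s) f"

lemma clinearI:
  fixes f :: "complex^'n::finite \<Rightarrow> complex^'m::finite"
  assumes "\<And>x y. f (x + y) = f x + f y" "\<And>c x. f (c *s x) = c *s f x"
  shows "clinear f"
  using assms by (simp add: Vector_Spaces.linear_iff vec.vector_space_axioms)

lemma clinear_add: "clinear f \<Longrightarrow> f (x + y) = f x + f y"
  and clinear_scale: "clinear f \<Longrightarrow> f (c *s x) = c *s f x"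
  by (simp_all add: Vector_Spaces.linear_iff)

lemma clinear_zero: "clinear f \<Longrightarrow> f 0 = 0"
  using clinear_scale[of f 0 0] by simp

lemma clinear_minus: "clinear f \<Longrightarrow> f (- x) = - f x"
  using clinear_scale[of f "-1" x] by simp

lemma clinear_diff: "clinear f \<Longrightarrow> f (x - y) = f x - f y"
  using clinear_add[of f x "-y"] clinear_minus[of f y] by simp

lemma clinear_sum: "clinear f \<Longrightarrow> f (\<Sum>i\<in>I. g i) = (\<Sum>i\<in>I. f (g i))"
  by (induction I rule: infinite_finite_induct) (auto simp: clinear_zero clinear_add)

lemma vec_expand: "(x :: complex^'n::finite) = (\<Sum>i\<in>UNIV. x $ i *s axis i 1)"
  by (simp add: vec_eq_iff axis_def if_distrib sum.delta cong: if_cong)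

lemma clinear_expand: "clinear f \<Longrightarrow> f x = (\<Sum>i\<in>UNIV. x $ i *s f (axis i 1))"
  by (subst vec_expand[of x], subst clinear_sum) (simp_all add: clinear_scale)

lemma scaleR_eq_scale: "r *\<^sub>R (x :: complex^'n) = of_real r *s x"
  by (simp add: vec_eq_iff) (simp add: scaleR_conv_of_real)

lemma clinear_imp_bounded_linear: "clinear f \<Longrightarrow> bounded_linear f"
  by (auto intro!: linearI simp: linear_conv_bounded_linear[symmetric] clinear_add clinear_scale
      scaleR_eq_scale)

text \<open>A smooth system of linear equations with a unique solution has a smooth solution, by
  Cramer's rule.\<close>

lemma smooth_on_linear_solve:
  fixes L :: "'a::real_normed_vector \<Rightarrow> complex^'n::finite \<Rightarrow> complex^'n"
  assumes S: "open S" and b: "smooth_on S b" and eq: "\<And>z. z \<in> S \<Longrightarrow> L z (f z) = b z"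
    and lin: "\<And>z. z \<in> S \<Longrightarrow> clinear (L z)" and inj: "\<And>z x. z \<in> S \<Longrightarrow> L z x = 0 \<Longrightarrow> x = 0"
    and sm: "\<And>i. smooth_on S (\<lambda>z. L z (axis i 1))"
  shows "smooth_on S f"
proof -
  define M where "M z = (\<chi> i j. L z (axis j 1) $ i)" for z
  have M: "M z *v x = L z x" if "z \<in> S" for z x
    using clinear_expand[OF lin[OF that], of x]
    by (simp add: M_def matrix_vector_mult_def vec_eq_iff mult.commute)
  have det: "det (M z) \<noteq> 0" if "z \<in> S" for z
    using matrix_left_invertible_ker[of "M z"] M[OF that] inj[OF that]
    by (metis invertible_det_nz invertible_left_inverse)
  define F where "F z = (\<chi> k. inverse (det (M z)) * det (\<chi> i j. if j = k then b z $ i else M z $ i $ j))" for z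
  have F: "F z = f z" if "z \<in> S" for z
    using cramer[OF det[OF that], of "f z" "b z"] M[OF that] eq[OF that]
    by (simp add: F_def divide_inverse mult.commute)
  have Mij: "smooth_on S (\<lambda>x. M x $ i $ j)" for i j
    by (simp add: M_def smooth_on_vec_nth[OF S sm])
  have bij: "smooth_on S (\<lambda>x. if c then b x $ i else M x $ i $ j)" for i j c
    using Mij smooth_on_vec_nth[OF S b] by (cases c) auto
  have "smooth_on S F"
    by (rule smooth_on_vecI[OF S])
       (auto simp: F_def intro!: smooth_on_mult smooth_on_inverse smooth_on_det S det Mij bij)
  from smooth_on_cong[OF S F this] show ?thesis by blast
qed

section \<open>Symmetry of second derivatives\<close>

text \<open>Two applications of the mean value theorem, first along \<open>u\<close> and then along \<open>v\<close>. The left-hand side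
  is symmetric in \<open>u\<close> and \<open>v\<close>, whence Schwarz's theorem by letting \<open>h\<close> tend to zero.\<close>

lemma mixed_difference_mvt:
  fixes f :: "'a::real_normed_vector \<Rightarrow> real"
  assumes h: "h > 0" and f: "Ck_on 2 S f"
    and sub: "\<And>s t. s \<in> {0..h} \<Longrightarrow> t \<in> {0..h} \<Longrightarrow> z + s *\<^sub>R u + t *\<^sub>R v \<in> S"
  shows "\<exists>s t. 0 < s \<and> s < h \<and> 0 < t \<and> t < h \<and>
    f (z + h *\<^sub>R u + h *\<^sub>R v) - f (z + h *\<^sub>R u) - f (z + h *\<^sub>R v) + f z
      = h * h * frechet_derivative (\<lambda>x. frechet_derivative f (at x) u) (at (z + s *\<^sub>R u + t *\<^sub>R v)) v"
proof -
  let ?D = "\<lambda>x. frechet_derivative f (at x) u"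
  have C: "\<And>x. x \<in> S \<Longrightarrow> f differentiable (at x)" "\<And>x. x \<in> S \<Longrightarrow> ?D differentiable (at x)"
    using f by (auto simp: numeral_2_eq_2)
  have der1: "((\<lambda>s. g (p + s *\<^sub>R w)) has_real_derivative frechet_derivative g (at (p + s *\<^sub>R w)) w) (at s)"
    if "g differentiable (at (p + s *\<^sub>R w))" for g :: "'a \<Rightarrow> real" and p w s
  proof -
    have g: "(g has_derivative frechet_derivative g (at (p + s *\<^sub>R w))) (at (p + s *\<^sub>R w))"
      using that by (simp add: frechet_derivative_works)
    have "((\<lambda>s. p + s *\<^sub>R w) has_derivative (\<lambda>r. r *\<^sub>R w)) (at s)"
      by (auto intro!: derivative_eq_intros)
    from has_derivative_compose[OF this, of g] g
    have "((\<lambda>s. g (p + s *\<^sub>R w)) has_derivative (\<lambda>r. frechet_derivative g (at (p + s *\<^sub>R w)) (r *\<^sub>R w))) (at s)"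
      by blast
    then show ?thesis
      using linear_frechet_derivative[OF that]
      by (simp add: has_field_derivative_def linear_cmul mult.commute[of _ "frechet_derivative _ _ _"] )
  qed
  define \<phi> where "\<phi> s = f (z + h *\<^sub>R v + s *\<^sub>R u) - f (z + s *\<^sub>R u)" for s
  have "\<exists>s. 0 < s \<and> s < h \<and> \<phi> h - \<phi> 0 = (h - 0) * (?D (z + h *\<^sub>R v + s *\<^sub>R u) - ?D (z + s *\<^sub>R u))"
  proof (rule MVT2[OF h])
    fix s :: real assume s: "0 \<le> s" "s \<le> h"
    show "(\<phi> has_real_derivative ?D (z + h *\<^sub>R v + s *\<^sub>R u) - ?D (z + s *\<^sub>R u)) (at s)"
      unfolding \<phi>_def
      using sub[of s h] sub[of s 0] s h
      by (intro DERIV_diff der1 C) (auto simp: algebra_simps)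
  qed
  then obtain s where s: "0 < s" "s < h"
    and e1: "\<phi> h - \<phi> 0 = h * (?D (z + s *\<^sub>R u + h *\<^sub>R v) - ?D (z + s *\<^sub>R u))"
    by (auto simp: algebra_simps)
  define \<psi> where "\<psi> t = ?D (z + s *\<^sub>R u + t *\<^sub>R v)" for t
  have "\<exists>t. 0 < t \<and> t < h \<and> \<psi> h - \<psi> 0 = (h - 0) * frechet_derivative ?D (at (z + s *\<^sub>R u + t *\<^sub>R v)) v"
  proof (rule MVT2[OF h])
    fix t :: real assume t: "0 \<le> t" "t \<le> h"
    show "(\<psi> has_real_derivative frechet_derivative ?D (at (z + s *\<^sub>R u + t *\<^sub>R v)) v) (at t)"
      unfolding \<psi>_def using sub[of s t] s t by (intro der1 C) auto
  qed
  then obtain t where t: "0 < t" "t < h"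
    and e2: "\<psi> h - \<psi> 0 = h * frechet_derivative ?D (at (z + s *\<^sub>R u + t *\<^sub>R v)) v"
    by auto
  show ?thesis
    using s t e1 e2 by (intro exI[of _ s] exI[of _ t]) (simp add: \<phi>_def \<psi>_def algebra_simps)
qed

lemma frechet_derivative_symmetric_real:
  fixes f :: "'a::real_normed_vector \<Rightarrow> real"
  assumes S: "open S" "z \<in> S" and f: "Ck_on 2 S f"
  shows "frechet_derivative (\<lambda>x. frechet_derivative f (at x) u) (at z) v
       = frechet_derivative (\<lambda>x. frechet_derivative f (at x) v) (at z) u"
proof (rule ccontr)
  define A where "A x = frechet_derivative (\<lambda>x. frechet_derivative f (at x) u) (at x) v" for x
  define B where "B x = frechet_derivative (\<lambda>x. frechet_derivative f (at x) v) (at x) u" for x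
  assume "\<not> ?thesis"
  then have e: "dist (A z) (B z) / 2 > 0" by (simp add: A_def B_def)
  have cont: "continuous (at z) A" "continuous (at z) B"
    using f S unfolding A_def B_def
    by (auto simp: numeral_2_eq_2 continuous_on_eq_continuous_at[OF S(1)])
  obtain d1 where d1: "d1 > 0" "\<And>x. dist x z < d1 \<Longrightarrow> dist (A x) (A z) < dist (A z) (B z) / 2"
    using cont(1) e unfolding continuous_at_eps_delta by blast
  obtain d2 where d2: "d2 > 0" "\<And>x. dist x z < d2 \<Longrightarrow> dist (B x) (B z) < dist (A z) (B z) / 2"
    using cont(2) e unfolding continuous_at_eps_delta by blast
  obtain d3 where d3: "d3 > 0" "ball z d3 \<subseteq> S" using S open_contains_ball by blast
  define d where "d = min d1 (min d2 d3)"
  have d: "d > 0" using d1 d2 d3 by (simp add: d_def)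
  \<comment> \<open>The step \<open>h\<close> keeps the whole parallelogram within distance \<open>d\<close> of \<open>z\<close>.\<close>
  define N where "N = norm u + norm v + 1"
  define h where "h = d / (2 * N)"
  have pos: "N > 0" by (simp add: N_def add_nonneg_pos)
  have h: "h > 0" using d pos by (simp add: h_def)
  have near: "dist (z + s *\<^sub>R u + t *\<^sub>R v) z < d" if "s \<in> {0..h}" "t \<in> {0..h}" for s t
  proof -
    have "dist (z + s *\<^sub>R u + t *\<^sub>R v) z = norm (s *\<^sub>R u + t *\<^sub>R v)" by (simp add: dist_norm)
    also have "\<dots> \<le> norm (s *\<^sub>R u) + norm (t *\<^sub>R v)" by (rule norm_triangle_ineq)
    also have "\<dots> \<le> h * norm u + h * norm v"
      using that by (auto intro!: add_mono mult_right_mono)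
    also have "\<dots> \<le> h * N" using h by (simp add: N_def algebra_simps)
    also have "\<dots> = d / 2" using pos by (simp add: h_def)
    finally show ?thesis using d by simp
  qed
  have inS: "z + s *\<^sub>R u + t *\<^sub>R v \<in> S" if "s \<in> {0..h}" "t \<in> {0..h}" for s t
    using near[OF that] d3(2) by (auto simp: d_def dist_commute subset_iff)
  have inS': "z + s *\<^sub>R v + t *\<^sub>R u \<in> S" if "s \<in> {0..h}" "t \<in> {0..h}" for s t
    using inS[OF that(2,1)] by (simp add: add.commute add.left_commute)
  obtain s t where st: "0 < s" "s < h" "0 < t" "t < h" and 1:
    "f (z + h *\<^sub>R u + h *\<^sub>R v) - f (z + h *\<^sub>R u) - f (z + h *\<^sub>R v) + f z = h * h * A (z + s *\<^sub>R u + t *\<^sub>R v)"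
    using mixed_difference_mvt[OF h f inS] unfolding A_def by blast
  obtain s' t' where st': "0 < s'" "s' < h" "0 < t'" "t' < h" and 2:
    "f (z + h *\<^sub>R v + h *\<^sub>R u) - f (z + h *\<^sub>R v) - f (z + h *\<^sub>R u) + f z = h * h * B (z + s' *\<^sub>R v + t' *\<^sub>R u)"
    using mixed_difference_mvt[OF h f inS'] unfolding B_def by blast
  have "A (z + s *\<^sub>R u + t *\<^sub>R v) = B (z + s' *\<^sub>R v + t' *\<^sub>R u)"
  proof -
    have "h * h * A (z + s *\<^sub>R u + t *\<^sub>R v) = h * h * B (z + s' *\<^sub>R v + t' *\<^sub>R u)"
      unfolding 1[symmetric] 2[symmetric] by (simp add: algebra_simps)
    then show ?thesis using h by simp
  qed
  moreover have "dist (A (z + s *\<^sub>R u + t *\<^sub>R v)) (A z) < dist (A z) (B z) / 2"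
    using near[of s t] st by (intro d1) (auto simp: d_def)
  moreover have "dist (B (z + s' *\<^sub>R v + t' *\<^sub>R u)) (B z) < dist (A z) (B z) / 2"
    using near[of t' s'] st' by (intro d2) (auto simp: d_def add.commute add.left_commute)
  ultimately have "dist (A z) (B z) < dist (A z) (B z)" by (metis dist_triangle_half_r)
  then show False by simp
qed

lemma frechet_derivative_linear:
  assumes "bounded_linear L" "f differentiable (at x)"
  shows "frechet_derivative (\<lambda>x. L (f x)) (at x) v = L (frechet_derivative f (at x) v)"
  using frechet_derivative_at[OF bounded_linear.has_derivative[OF assms(1)
      assms(2)[unfolded frechet_derivative_works]]] by metis

lemma frechet_derivative_symmetric:
  fixes f :: "'a::real_normed_vector \<Rightarrow> 'b::euclidean_space"
  assumes S: "open S" "z \<in> S" and f: "smooth_on S f"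
  shows "frechet_derivative (\<lambda>x. frechet_derivative f (at x) u) (at z) v
       = frechet_derivative (\<lambda>x. frechet_derivative f (at x) v) (at z) u"
proof (rule euclidean_eqI)
  fix b :: 'b
  have L: "bounded_linear (\<lambda>y. y \<bullet> b)" by (rule bounded_linear_inner_left)
  have *: "frechet_derivative (\<lambda>x. frechet_derivative f (at x) u) (at z) v \<bullet> b
     = frechet_derivative (\<lambda>x. frechet_derivative (\<lambda>x. f x \<bullet> b) (at x) u) (at z) v" for u v
    unfolding frechet_derivative_linear[OF L smooth_on_imp_differentiable[OF smooth_on_frechet[OF f] S(2)], symmetric]
    by (rule fun_cong[OF frechet_derivative_transform_within_open[OF _ S]])
       (auto intro!: bounded_linear_imp_differentiable[THEN differentiable_compose] L
          smooth_on_imp_differentiable[OF smooth_on_linear[OF L S(1) smooth_on_frechet[OF f]] S(2)]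
          simp: frechet_derivative_linear[OF L smooth_on_imp_differentiable[OF f]])
  have "Ck_on 2 S (\<lambda>x. f x \<bullet> b)"
    using smooth_on_linear[OF L S(1) f] by (simp add: smooth_on_def)
  from frechet_derivative_symmetric_real[OF S this]
  show "frechet_derivative (\<lambda>x. frechet_derivative f (at x) u) (at z) v \<bullet> b
      = frechet_derivative (\<lambda>x. frechet_derivative f (at x) v) (at z) u \<bullet> b"
    by (simp add: *)
qed

section \<open>Wirtinger derivatives\<close>

text \<open>The derivative of \<open>f\<close> along the \<open>(1,0)\<close>-vector with coordinates \<open>x\<close>, that is \<open>\<Sum>\<^sub>j x\<^sub>j \<partial>f/\<partial>z\<^sub>j\<close>. Unlike the
  coordinate operators it needs no index sums, and it is complex-linear in \<open>x\<close>.\<close>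

definition wirt :: "(complex^'n::finite \<Rightarrow> complex^'m::finite) \<Rightarrow> complex^'n \<Rightarrow> complex^'n \<Rightarrow> complex^'m" where
  "wirt f z x = (1/2) *s (frechet_derivative f (at z) x - \<i> *s frechet_derivative f (at z) (\<i> *s x))"

lemma wirt_eq:
  assumes "(f has_derivative D) (at z)"
  shows "wirt f z x = (1/2) *s (D x - \<i> *s D (\<i> *s x))"
  using frechet_derivative_at[OF assms] by (simp add: wirt_def)

lemma wirt_cong_open:
  assumes "open S" "z \<in> S" "\<And>y. y \<in> S \<Longrightarrow> f y = g y" "f differentiable (at z)"
  shows "wirt f z x = wirt g z x"
  using frechet_derivative_transform_within_open[OF assms(4,1,2,3)] by (simp add: wirt_def)

lemma scale_complex_split: "c *s (x :: complex^'n) = Re c *\<^sub>R x + Im c *\<^sub>R (\<i> *s x)"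
  by (simp add: vec_eq_iff complex_eq_iff)

lemma linear_scale_complex:
  fixes x :: "complex^'n"
  assumes "linear D"
  shows "D (c *s x) = Re c *\<^sub>R D x + Im c *\<^sub>R D (\<i> *s x)"
  by (subst scale_complex_split) (simp add: linear_add[OF assms] linear_cmul[OF assms])

lemma clinear_complex_part:
  fixes D :: "complex^'n::finite \<Rightarrow> complex^'m::finite"
  assumes "linear D"
  shows "clinear (\<lambda>x. (1/2) *s (D x - \<i> *s D (\<i> *s x)))"
proof (rule clinearI)
  fix c and x :: "complex^'n"
  have 1: "D (c *s x) = Re c *\<^sub>R D x + Im c *\<^sub>R D (\<i> *s x)"
    by (rule linear_scale_complex[OF assms])
  have 2: "D (\<i> *s (c *s x)) = Re c *\<^sub>R D (\<i> *s x) - Im c *\<^sub>R D x"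
    using linear_scale_complex[OF assms, of "\<i> * c" x] by (simp add: vector_smult_assoc)
  show "(1/2) *s (D (c *s x) - \<i> *s D (\<i> *s (c *s x))) = c *s ((1/2) *s (D x - \<i> *s D (\<i> *s x)))"
    unfolding 1 2 by (simp add: vec_eq_iff complex_eq_iff field_simps)
qed (simp add: vec_eq_iff linear_add[OF assms] vector_add_ldistrib algebra_simps add_divide_distrib diff_divide_distrib)

lemma clinear_wirt: "f differentiable (at z) \<Longrightarrow> clinear (wirt f z)"
  unfolding wirt_def by (rule clinear_complex_part[OF linear_frechet_derivative])

lemma smooth_on_wirt:
  assumes "open S" "smooth_on S f"
  shows "smooth_on S (\<lambda>z. wirt f z x)"
  unfolding wirt_def
  by (intro smooth_on_scale smooth_on_diff smooth_on_const smooth_on_frechet assms)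

lemma wirt_add:
  assumes "f differentiable (at z)" "g differentiable (at z)"
  shows "wirt (\<lambda>y. f y + g y) z x = wirt f z x + wirt g z x"
  using has_derivative_add[OF assms[unfolded frechet_derivative_works]]
  by (subst wirt_eq) (auto simp: wirt_def vec_eq_iff algebra_simps add_divide_distrib diff_divide_distrib)

lemma wirt_diff:
  assumes "f differentiable (at z)" "g differentiable (at z)"
  shows "wirt (\<lambda>y. f y - g y) z x = wirt f z x - wirt g z x"
  using has_derivative_diff[OF assms[unfolded frechet_derivative_works]]
  by (subst wirt_eq) (auto simp: wirt_def vec_eq_iff algebra_simps add_divide_distrib diff_divide_distrib)

lemma wirt_const: "wirt (\<lambda>y. c) z x = 0"
  by (subst wirt_eq[OF has_derivative_const]) (simp add: vec_eq_iff)

lemma wirt_clinear: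
  assumes "clinear L" "f differentiable (at z)"
  shows "wirt (\<lambda>y. L (f y)) z x = L (wirt f z x)"
  using bounded_linear.has_derivative[OF clinear_imp_bounded_linear[OF assms(1)]
      assms(2)[unfolded frechet_derivative_works]]
  by (subst wirt_eq) (auto simp: wirt_def clinear_diff[OF assms(1)] clinear_scale[OF assms(1)])

lemma wirt_holomorphic:
  assumes "(f has_derivative D) (at z)" "\<And>t v. D (t *s v) = t *s D v"
  shows "wirt f z x = D x"
  by (subst wirt_eq[OF assms(1)]) (simp add: assms(2) vec_eq_iff)

lemma wirt_antiholomorphic:
  assumes "(f has_derivative D) (at z)" "\<And>t v. D (t *s v) = cnj t *s D v"
  shows "wirt f z x = 0"
  by (subst wirt_eq[OF assms(1)]) (simp add: assms(2) vec_eq_iff)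

lemma wirt_chain:
  assumes T: "(T has_derivative J) (at z)" "\<And>t v. J (t *s v) = t *s J v" and f: "f differentiable (at (T z))"
  shows "wirt (\<lambda>y. f (T y)) z x = wirt f (T z) (J x)"
  using has_derivative_compose[OF T(1) f[unfolded frechet_derivative_works]]
  by (subst wirt_eq) (auto simp: wirt_def T(2))

lemma wirt_nth:
  assumes "f differentiable (at z)"
  shows "wirt f z x $ l = (\<Sum>j\<in>UNIV. x $ j * del j (\<lambda>y. f y $ l) z)"
proof -
  have "\<i> *s axis j 1 = (axis j \<i> :: complex^'a)" for j
    by (simp add: vec_eq_iff axis_def)
  then have *: "wirt f z (axis j 1) $ l = del j (\<lambda>y. f y $ l) z" for j
    by (simp add: wirt_def del_def frechet_derivative_linear[OF bounded_linear_vec_nth assms])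
  show ?thesis
    by (subst clinear_expand[OF clinear_wirt[OF assms]]) (simp add: *)
qed

lemma wirt_commute:
  assumes S: "open S" "z \<in> S" and f: "smooth_on S f"
  shows "wirt (\<lambda>y. wirt f y u) z v = wirt (\<lambda>y. wirt f y v) z u"
proof -
  note d = smooth_on_imp_differentiable[OF smooth_on_frechet[OF f] S(2), unfolded frechet_derivative_works]
  have "bounded_linear (\<lambda>x::complex^'b. \<i> *s x)" "bounded_linear (\<lambda>x::complex^'b. (1/2) *s x)"
    by (auto intro!: clinear_imp_bounded_linear clinearI simp: vec_eq_iff algebra_simps add_divide_distrib)
  note L = this[THEN bounded_linear.has_derivative]
  have w: "wirt (\<lambda>y. wirt f y u) z v = (1/4) *s
    ((frechet_derivative (\<lambda>y. frechet_derivative f (at y) u) (at z) v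
      - frechet_derivative (\<lambda>y. frechet_derivative f (at y) (\<i> *s u)) (at z) (\<i> *s v))
    - \<i> *s (frechet_derivative (\<lambda>y. frechet_derivative f (at y) u) (at z) (\<i> *s v)
      + frechet_derivative (\<lambda>y. frechet_derivative f (at y) (\<i> *s u)) (at z) v))" for u v
    unfolding wirt_def[of f, abs_def]
    by (subst wirt_eq[OF L(2)[OF has_derivative_diff[OF d L(1)[OF d]]]])
       (simp add: vec_eq_iff complex_eq_iff algebra_simps)
  show ?thesis
    unfolding w
    by (simp add: frechet_derivative_symmetric[OF S f, of u] frechet_derivative_symmetric[OF S f, of "\<i> *s u"]
        add.commute)
qed

text \<open>Product rule for a family of linear maps applied to a moving vector.\<close>

lemma has_derivative_family:
  fixes A :: "'a::real_normed_vector \<Rightarrow> 'v::euclidean_space \<Rightarrow> 'w::real_normed_vector"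
  assumes S: "open S" "z \<in> S" and lin: "\<And>y. y \<in> S \<Longrightarrow> linear (A y)"
    and A: "\<And>x. ((\<lambda>y. A y x) has_derivative A' x) (at z)" and X: "(X has_derivative X') (at z)"
  shows "((\<lambda>y. A y (X y)) has_derivative (\<lambda>h. A' (X z) h + A z (X' h))) (at z)"
proof -
  have expand: "A y x = (\<Sum>b\<in>Basis. (x \<bullet> b) *\<^sub>R A y b)" if "y \<in> S" for y x
    by (subst euclidean_representation[of x, symmetric])
       (simp add: linear_sum[OF lin[OF that]] linear_cmul[OF lin[OF that]])
  have A': "A' x = (\<lambda>h. \<Sum>b\<in>Basis. (x \<bullet> b) *\<^sub>R A' b h)" for x
  proof (rule has_derivative_unique[OF A])
    show "((\<lambda>y. A y x) has_derivative (\<lambda>h. \<Sum>b\<in>Basis. (x \<bullet> b) *\<^sub>R A' b h)) (at z)"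
      by (rule has_derivative_transform_within_open[OF _ S expand[symmetric]])
         (auto intro!: derivative_eq_intros A)
  qed
  have "((\<lambda>y. \<Sum>b\<in>Basis. (X y \<bullet> b) *\<^sub>R A y b) has_derivative
         (\<lambda>h. \<Sum>b\<in>Basis. (X z \<bullet> b) *\<^sub>R A' b h + (X' h \<bullet> b) *\<^sub>R A z b)) (at z)"
    by (intro has_derivative_sum has_derivative_scaleR has_derivative_inner_left X A)
  then have "((\<lambda>y. A y (X y)) has_derivative
         (\<lambda>h. \<Sum>b\<in>Basis. (X z \<bullet> b) *\<^sub>R A' b h + (X' h \<bullet> b) *\<^sub>R A z b)) (at z)"
    by (rule has_derivative_transform_within_open[OF _ S expand[symmetric]])
  then show ?thesis
    by (simp add: sum.distrib A'[of "X z"] expand[OF S(2), of "X' _"])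
qed

lemma clinear_imp_linear: "clinear f \<Longrightarrow> linear f"
  by (simp add: bounded_linear.linear clinear_imp_bounded_linear)

lemma
  assumes S: "open S" "z \<in> S" and lin: "\<And>y. y \<in> S \<Longrightarrow> clinear (A y)"
    and A: "\<And>x. (\<lambda>y. A y x) differentiable (at z)" and X: "X differentiable (at z)"
  shows differentiable_family: "(\<lambda>y. A y (X y)) differentiable (at z)"
    and wirt_family: "wirt (\<lambda>y. A y (X y)) z x = wirt (\<lambda>y. A y (X z)) z x + A z (wirt X z x)"
proof -
  note d = has_derivative_family[OF S clinear_imp_linear[OF lin] A[unfolded frechet_derivative_works]
      X[unfolded frechet_derivative_works]]
  then show "(\<lambda>y. A y (X y)) differentiable (at z)" by (auto simp: differentiable_def)
  have L: "clinear (A z)" using S lin by auto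
  show "wirt (\<lambda>y. A y (X y)) z x = wirt (\<lambda>y. A y (X z)) z x + A z (wirt X z x)"
    by (subst wirt_eq[OF d])
       (simp_all add: wirt_def clinear_diff[OF L] clinear_scale[OF L] vec_eq_iff algebra_simps
         add_divide_distrib diff_divide_distrib)
qed

lemma smooth_on_family:
  assumes S: "open S" and lin: "\<And>y. y \<in> S \<Longrightarrow> clinear (A y)"
    and A: "\<And>x. smooth_on S (\<lambda>y. A y x)" and X: "smooth_on S X"
  shows "smooth_on S (\<lambda>y. A y (X y))"
proof -
  have eq: "(\<Sum>i\<in>UNIV. X y $ i *s A y (axis i 1)) = A y (X y)" if "y \<in> S" for y
    by (rule clinear_expand[OF lin[OF that], symmetric])
  have "smooth_on S (\<lambda>y. \<Sum>i\<in>UNIV. X y $ i *s A y (axis i 1))"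
    by (intro smooth_on_sum smooth_on_scale smooth_on_vec_nth A X S)
  from smooth_on_cong[OF S eq this] show ?thesis by blast
qed

section \<open>Derivatives of holomorphic maps\<close>

lemma norm_scale: "norm (t *s (u :: complex^'n::finite)) = norm t * norm u"
  by (simp add: norm_vec_def norm_mult L2_set_right_distrib)

lemma bounded_bilinear_scale: "bounded_bilinear (\<lambda>(t::complex) (u::complex^'n::finite). t *s u)"
  by (rule bounded_bilinear.intro) (auto simp: vec_eq_iff algebra_simps norm_scale intro!: exI[of _ 1])

text \<open>Cauchy's formula for \<open>t \<mapsto> g(z + t u)\<close> writes the directional derivative as an integral in which only
  \<open>g\<close> itself occurs. The radius \<open>r\<close> of the circle does not depend on \<open>z\<close>, so the formula can be
  differentiated under the integral sign.\<close>

lemma cauchy_directional_derivative: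
  fixes g :: "complex^'n::finite \<Rightarrow> complex" and z0 u :: "complex^'n"
  assumes S: "open S" "z0 \<in> S"
    and g: "\<And>z. z \<in> S \<Longrightarrow> (g has_derivative D z) (at z)"
    and D: "\<And>z t v. z \<in> S \<Longrightarrow> D z (t *s v) = t * D z v"
  shows "\<exists>e c k. e > 0 \<and> continuous_on {0..1::real} c \<and> continuous_on {0..1} k \<and>
    (\<forall>z\<in>ball z0 e. \<forall>s\<in>{0..1}. z + c s *s u \<in> S) \<and>
    (\<forall>z\<in>ball z0 e. D z u = integral {0..1} (\<lambda>s. g (z + c s *s u) * k s))"
proof -
  obtain d where d: "d > 0" "ball z0 d \<subseteq> S" using S open_contains_ball by blast
  define e where "e = d / 2"
  define r where "r = e / (norm u + 1)"
  have pos: "norm u + 1 > 0" by (simp add: add_nonneg_pos)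
  have e: "e > 0" and r: "r > 0" using d pos by (auto simp: e_def r_def)
  have ru: "r * norm u < e"
  proof -
    have "r * (norm u + 1) = e" using pos by (simp add: r_def)
    then show ?thesis using r by (simp add: distrib_left)
  qed
  have inS: "z + t *s u \<in> S" if "z \<in> ball z0 e" "norm t \<le> r" for z t
  proof -
    have "dist z0 (z + t *s u) \<le> dist z0 z + norm (t *s u)"
      using norm_triangle_ineq4[of "z0 - z" "t *s u"] by (simp add: dist_norm diff_diff_eq)
    also have "\<dots> < e + e"
      using that mult_right_mono[OF that(2), of "norm u"] ru by (simp add: norm_scale)
    finally show ?thesis using d by (auto simp: e_def)
  qed
  define c where "c = circlepath 0 r"
  \<comment> \<open>The kernel of Cauchy's formula for the first derivative.\<close>
  define k where "k s = 1 / (2 * of_real pi * \<i>) * (1 / c s ^ 2 * vector_derivative c (at s))" for s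
  have c: "norm (c s) = r" for s
    using r by (simp add: c_def circlepath norm_mult exp_eq_polar)
  have contc: "continuous_on {0..1} c" unfolding c_def circlepath by (intro continuous_intros)
  have c0: "c s \<noteq> 0" for s using c[of s] r by auto
  have vd: "vector_derivative c (at s) = 2 * of_real pi * \<i> * r * exp (2 * of_real pi * \<i> * s)" for s
    by (simp add: c_def vector_derivative_circlepath)
  have contk: "continuous_on {0..1} k"
    unfolding k_def vd by (intro continuous_intros contc) (simp add: c0)
  have int: "D z u = integral {0..1} (\<lambda>s. g (z + c s *s u) * k s)" if z: "z \<in> ball z0 e" for z
  proof -
    define \<phi> where "\<phi> t = g (z + t *s u)" for t
    have der: "(\<phi> has_field_derivative D (z + t *s u) u) (at t)" if "norm t \<le> r" for t
    proof -
      have S': "z + t *s u \<in> S" by (rule inS[OF z that])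
      have "bounded_linear (\<lambda>t::complex. t *s u)"
        by (auto intro!: linearI simp: linear_conv_bounded_linear[symmetric] vec_eq_iff algebra_simps)
      then have "((\<lambda>t. z + t *s u) has_derivative (\<lambda>h. 0 + h *s u)) (at t)"
        by (intro has_derivative_add has_derivative_const bounded_linear_imp_has_derivative)
      from has_derivative_compose[OF this, of g "D (z + t *s u)"] g[OF S']
      show ?thesis by (simp add: has_field_derivative_def \<phi>_def[abs_def] D[OF S'] mult.commute[of _ "D _ u"])
    qed
    have hol: "\<phi> holomorphic_on cball 0 r"
    proof (rule holomorphic_onI)
      fix t :: complex assume "t \<in> cball 0 r"
      then have "(\<phi> has_field_derivative D (z + t *s u) u) (at t within cball 0 r)"
        using has_field_derivative_at_within[OF der[of t]] by simp
      then show "\<phi> field_differentiable at t within cball 0 r"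
        by (auto simp: field_differentiable_def)
    qed
    have "(\<phi> has_field_derivative (1 / (2 * of_real pi * \<i>) * contour_integral c (\<lambda>w. \<phi> w / (w-0)^2))) (at 0)"
      unfolding c_def
      by (rule Cauchy_derivative_integral_circlepath)
         (use r hol in \<open>auto intro: holomorphic_on_imp_continuous_on holomorphic_on_subset\<close>)
    from DERIV_unique[OF this der[of 0]] r
    have "D z u = 1 / (2 * of_real pi * \<i>) * contour_integral c (\<lambda>w. \<phi> w / (w-0)^2)"
      by simp
    also have "\<dots> = 1 / (2 * of_real pi * \<i>) * integral {0..1} (\<lambda>s. \<phi> (c s) / (c s)^2 * vector_derivative c (at s))"
      by (simp add: contour_integral_integral)
    also have "\<dots> = integral {0..1} (\<lambda>s. 1 / (2 * of_real pi * \<i>) * (\<phi> (c s) / (c s)^2 * vector_derivative c (at s)))"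
      by (rule integral_mult_right[symmetric])
    finally show ?thesis by (simp add: \<phi>_def k_def mult.commute mult.left_commute)
  qed
  show ?thesis
    using e contc contk inS int c by (intro exI[of _ e] exI[of _ c] exI[of _ k]) auto
qed

text \<open>The integral formula makes the directional derivatives continuous; then all derivatives of the
  integrand are continuous, and Leibniz' rule applies to the same formula.\<close>

lemma holomorphic_directional_derivative:
  fixes g :: "complex^'n::finite \<Rightarrow> complex" and u :: "complex^'n"
  assumes S: "open S" "z0 \<in> S"
    and g: "\<And>z. z \<in> S \<Longrightarrow> (g has_derivative D z) (at z)"
    and D: "\<And>z t v. z \<in> S \<Longrightarrow> D z (t *s v) = t * D z v"
  shows "\<exists>E. ((\<lambda>z. D z u) has_derivative E) (at z0) \<and> (\<forall>t v. E (t *s v) = t * E v)"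
proof -
  have contg: "continuous_on S g"
    using g by (auto intro!: continuous_at_imp_continuous_on has_derivative_continuous)
  have contD: "continuous_on S (\<lambda>z. D z v)" for v
  proof (rule continuous_at_imp_continuous_on, rule ballI)
    fix z assume "z \<in> S"
    obtain e c k where e: "e > 0" "continuous_on {0..1::real} c" "continuous_on {0..1} k"
      "\<And>z' s. z' \<in> ball z e \<Longrightarrow> s \<in> {0..1} \<Longrightarrow> z' + c s *s v \<in> S"
      "\<And>z'. z' \<in> ball z e \<Longrightarrow> D z' v = integral {0..1} (\<lambda>s. g (z' + c s *s v) * k s)"
      using cauchy_directional_derivative[of S z g D v, OF S(1) \<open>z \<in> S\<close> g D] by blast
    have "continuous_on (ball z e \<times> cbox 0 1) (\<lambda>(z', s). g (z' + c s *s v) * k s)"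
      unfolding split_beta
      by (intro continuous_intros continuous_on_compose2[OF contg] continuous_on_compose2[OF e(3)]
            continuous_on_compose2[OF e(2)] bounded_bilinear.continuous_on[OF bounded_bilinear_scale])
         (use e(4) in auto)
    from integral_continuous_on_param[OF this]
    have "continuous_on (ball z e) (\<lambda>z. D z v)"
      by (rule continuous_on_eq) (simp add: e(5))
    then show "isCont (\<lambda>z. D z v) z"
      using e(1) by (simp add: continuous_on_eq_continuous_at)
  qed
  obtain e c k where e: "e > 0" "continuous_on {0..1::real} c" "continuous_on {0..1} k"
    "\<And>z s. z \<in> ball z0 e \<Longrightarrow> s \<in> {0..1} \<Longrightarrow> z + c s *s u \<in> S"
    "\<And>z. z \<in> ball z0 e \<Longrightarrow> D z u = integral {0..1} (\<lambda>s. g (z + c s *s u) * k s)"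
    using cauchy_directional_derivative[of S z0 g D u, OF S g D] by blast
  define fx where "fx z s = Blinfun (\<lambda>v. D (z + c s *s u) v * k s)" for z s
  have fx: "blinfun_apply (fx z s) = (\<lambda>v. D (z + c s *s u) v * k s)"
    if "z \<in> ball z0 e" "s \<in> {0..1}" for z s
    unfolding fx_def
    by (intro bounded_linear_Blinfun_apply bounded_linear_compose[OF bounded_linear_mult_left]
         has_derivative_bounded_linear[OF g] e(4) that)
  have cont: "continuous_on (ball z0 e \<times> cbox 0 1) (\<lambda>x. f (fst x + c (snd x) *s u) * k (snd x))"
    if "continuous_on S f" for f
    by (intro continuous_intros continuous_on_compose2[OF that] continuous_on_compose2[OF e(3)]
          continuous_on_compose2[OF e(2)] bounded_bilinear.continuous_on[OF bounded_bilinear_scale])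
       (use e(4) in auto)
  have contfx: "continuous_on (ball z0 e \<times> cbox 0 1) (\<lambda>(z, s). fx z s)"
    unfolding split_beta
    by (rule continuous_on_blinfun_componentwise, rule continuous_on_eq[OF cont[OF contD]])
       (auto simp: fx)
  have derg: "((\<lambda>z. g (z + c s *s u) * k s) has_derivative blinfun_apply (fx z s)) (at z within ball z0 e)"
    if z: "z \<in> ball z0 e" and s: "s \<in> cbox 0 1" for z s
  proof -
    have "((\<lambda>z. z + c s *s u) has_derivative (\<lambda>h. h)) (at z)"
      by (auto intro!: derivative_eq_intros)
    from has_derivative_compose[OF this, of g "D (z + c s *s u)"] g[OF e(4)[OF z]] s
    have "((\<lambda>z. g (z + c s *s u)) has_derivative (\<lambda>h. D (z + c s *s u) h)) (at z)" by simp
    then show ?thesis using fx[OF z] s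
      by (auto intro!: has_derivative_mult_left intro: has_derivative_at_withinI)
  qed
  have pair: "continuous_on (cbox 0 1) (Pair z)" "Pair z ` cbox 0 1 \<subseteq> ball z0 e \<times> cbox 0 1"
    if "z \<in> ball z0 e" for z :: "complex^'n"
    using that by (auto intro!: continuous_intros)
  have intg: "(\<lambda>s. g (z + c s *s u) * k s) integrable_on cbox 0 1" if "z \<in> ball z0 e" for z
    using continuous_on_compose2[OF cont[OF contg] pair[OF that]]
    by (intro integrable_continuous) simp
  have z0: "z0 \<in> ball z0 e" using e(1) by simp
  have intfx: "fx z0 integrable_on cbox 0 1"
    using continuous_on_compose2[OF contfx pair[OF z0]]
    by (intro integrable_continuous) simp
  have "((\<lambda>z. integral (cbox 0 1) (\<lambda>s. g (z + c s *s u) * k s)) has_derivative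
      blinfun_apply (integral (cbox 0 1) (fx z0))) (at z0 within ball z0 e)"
    by (rule leibniz_rule[OF derg intg contfx z0 convex_ball])
  then have der: "((\<lambda>z. D z u) has_derivative blinfun_apply (integral (cbox 0 1) (fx z0))) (at z0)"
    using z0 e(5) by (subst (asm) at_within_open[OF _ open_ball])
       (auto intro: has_derivative_transform_within_open[OF _ open_ball z0])
  have app: "blinfun_apply (integral (cbox 0 1) (fx z0)) v = integral {0..1} (\<lambda>s. D (z0 + c s *s u) v * k s)" for v
    using blinfun_apply_integral[OF intfx, of v] fx[OF z0]
    by (auto intro!: integral_cong)
  have "blinfun_apply (integral (cbox 0 1) (fx z0)) (t *s v) = t * blinfun_apply (integral (cbox 0 1) (fx z0)) v"
    for t :: complex and v :: "complex^'n"
  proof -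
    have "integral {0..1} (\<lambda>s. D (z0 + c s *s u) (t *s v) * k s) = integral {0..1} (\<lambda>s. t * (D (z0 + c s *s u) v * k s))"
      using e(4)[OF z0] by (intro integral_cong) (simp add: D)
    then show ?thesis unfolding app by simp
  qed
  with der show ?thesis by blast
qed

lemma holomorphic_map_onD:
  assumes "holomorphic_map_on S f" "z \<in> S"
  shows "(f has_derivative frechet_derivative f (at z)) (at z)"
    and "clinear (frechet_derivative f (at z))"
proof -
  obtain D where D: "(f has_derivative D) (at z)" "\<And>t v. D (t *s v) = t *s D v"
    using assms unfolding holomorphic_map_on_def by blast
  have eq: "D = frechet_derivative f (at z)" by (rule frechet_derivative_at[OF D(1)])
  show "(f has_derivative frechet_derivative f (at z)) (at z)" using D eq by simp
  show "clinear (frechet_derivative f (at z))"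
    using D has_derivative_linear[OF D(1)] unfolding eq[symmetric]
    by (intro clinearI) (auto simp: linear_add)
qed

lemma holomorphic_map_on_derivative:
  fixes f :: "complex^'n::finite \<Rightarrow> complex^'m::finite"
  assumes S: "open S" and f: "holomorphic_map_on S f"
  shows "holomorphic_map_on S (\<lambda>z. frechet_derivative f (at z) u)"
  unfolding holomorphic_map_on_def
proof
  fix z assume z: "z \<in> S"
  have "\<exists>E. ((\<lambda>z. frechet_derivative f (at z) u $ l) has_derivative E) (at z) \<and> (\<forall>t v. E (t *s v) = t * E v)" for l
    by (rule holomorphic_directional_derivative[OF S z, where g = "\<lambda>z. f z $ l"])
       (use holomorphic_map_onD[OF f] in
         \<open>auto intro!: bounded_linear.has_derivative[OF bounded_linear_vec_nth] simp: clinear_scale\<close>)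
  then obtain E where E: "\<And>l. ((\<lambda>z. frechet_derivative f (at z) u $ l) has_derivative E l) (at z)"
    "\<And>l t v. E l (t *s v) = t * E l v" by metis
  have "((\<lambda>z. frechet_derivative f (at z) u) has_derivative (\<lambda>v. \<chi> l. E l v)) (at z)"
    by (rule has_derivative_vecI) (simp add: E)
  then show "\<exists>D. ((\<lambda>z. frechet_derivative f (at z) u) has_derivative D) (at z) \<and> (\<forall>t v. D (t *s v) = t *s D v)"
    by (intro exI[of _ "\<lambda>v. \<chi> l. E l v"] conjI) (simp_all add: E vec_eq_iff)
qed

section \<open>Forms of low degree\<close>

lemma sum_permutes_2:
  "(\<Sum>\<sigma> | \<sigma> permutes {..<2::nat}. f \<sigma>) = f id + f (Transposition.transpose 0 1)"
proof -
  have f: "finite {1::nat}" "0 \<notin> {1::nat}" by auto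
  have s: "{..<2::nat} = {0, 1}" by auto
  show ?thesis
    unfolding s sum_over_permutations_insert[OF f] permutes_sing
    by (simp add: swap_id_eq)
qed

lemma sum_permutes_3:
  "(\<Sum>\<sigma> | \<sigma> permutes {..<3::nat}. f \<sigma>) =
     f id + f (Transposition.transpose 1 2) + f (Transposition.transpose 0 1) + f (Transposition.transpose 0 1 \<circ> Transposition.transpose 1 2)
     + f (Transposition.transpose 0 2) + f (Transposition.transpose 0 2 \<circ> Transposition.transpose 1 2)"
proof -
  have f: "finite {1::nat, 2}" "0 \<notin> {1::nat, 2}" "finite {2::nat}" "1 \<notin> {2::nat}" by auto
  have s: "{..<3::nat} = {0, 1, 2}" by auto
  show ?thesis
    unfolding s sum_over_permutations_insert[OF f(1,2)] sum_over_permutations_insert[OF f(3,4)] permutes_sing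
    by (simp add: swap_id_eq add.assoc)
qed

lemma wedge_length: "length vs \<noteq> p + q \<Longrightarrow> wedge p q \<xi> \<eta> vs = 0"
  by (simp add: wedge_def)

lemma wedge_1_0: "wedge 1 0 \<xi> \<eta> [u] = \<xi> [u] * \<eta> []"
proof -
  have s: "{..<1 + 0::nat} = {0}" by auto
  show ?thesis unfolding wedge_def s permutes_sing by simp
qed

lemma add_small: "1 + 1 = (2::nat)" "2 + 1 = (3::nat)" "1 + 2 = (3::nat)" by simp_all

lemma wedge_1_1: "wedge 1 1 \<xi> \<eta> [u, v] = \<xi> [u] * \<eta> [v] - \<xi> [v] * \<eta> [u]"
  unfolding wedge_def add_small sum_permutes_2 by (simp add: sign_swap_id upt_rec)

lemmas permutation_eval = upt_rec sign_swap_id sign_compose permutation_swap_id Transposition.transpose_def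

lemma wedge_2_1:
  assumes "\<And>u v. \<xi> [v, u] = - \<xi> [u, v]"
  shows "wedge 2 1 \<xi> \<eta> [u, v, w] = \<xi> [u, v] * \<eta> [w] - \<xi> [u, w] * \<eta> [v] + \<xi> [v, w] * \<eta> [u]"
  using assms[of u v] assms[of u w] assms[of v w]
  unfolding wedge_def add_small sum_permutes_3 by (simp add: permutation_eval)

lemma wedge_1_2:
  assumes "\<And>u v. \<eta> [v, u] = - \<eta> [u, v]"
  shows "wedge 1 2 \<xi> \<eta> [u, v, w] = \<xi> [u] * \<eta> [v, w] + \<xi> [v] * \<eta> [w, u] + \<xi> [w] * \<eta> [u, v]"
  using assms[of v u] assms[of u w] assms[of w v]
  unfolding wedge_def add_small sum_permutes_3 by (simp add: permutation_eval)

lemma dz_length: "length vs \<noteq> length I \<Longrightarrow> dz I vs = 0"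
  by (cases I) (auto simp: wedge_length)

lemma dz_1: "dz [i] [u] = u $ i"
  unfolding dz.simps list.size(3) wedge_1_0 by simp

lemma dzbar_1: "dzbar [i] [u] = cnj (u $ i)"
  unfolding dzbar.simps list.size(3) wedge_1_0 by simp

lemma dz_2: "dz [i, k] [u, v] = u $ i * v $ k - v $ i * u $ k"
proof -
  have "length [k] = 1" by simp
  then show ?thesis
    unfolding dz.simps(2)[of i] by (simp only: wedge_1_1 dz_1 list.sel)
qed

lemma increasing_1: "increasing 1 = range (\<lambda>i. [i])"
  by (auto simp: increasing_def length_Suc_conv)

lemma increasing_2: "increasing 2 = (\<lambda>(i, k). [i, k]) ` {(i, k). i < k}"
  by (auto simp: increasing_def length_Suc_conv numeral_2_eq_2 image_iff)

lemma sum_increasing_1: "(\<Sum>I\<in>increasing 1. f I) = (\<Sum>i\<in>UNIV. f [i :: 'n::{finite,linorder}])"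
  unfolding increasing_1 by (subst sum.reindex) (auto simp: inj_on_def)

lemma sum_increasing_2:
  "(\<Sum>I\<in>increasing 2. f I) = (\<Sum>(i, k)\<in>{(i, k). i < k}. f [i :: 'n::{finite,linorder}, k])"
  unfolding increasing_2 by (subst sum.reindex) (auto simp: inj_on_def split_def)

text \<open>The values at a point of a \<open>(p,0)\<close>-form with coefficients in the holomorphic tangent space. Taking
  the coefficients to be the values on the frame, rather than unknowns, makes this an equation that
  expands any expression multilinear in several such forms.\<close>

definition vtype :: "nat \<Rightarrow> 'n::{finite,linorder} vext \<Rightarrow> bool" where
  "vtype p \<theta> \<longleftrightarrow> (\<forall>vs. \<theta> vs = (\<Sum>I\<in>increasing p. dz I vs *s \<theta> (frame I)))"

lemma vtype_length:
  assumes "vtype p \<theta>" "length vs \<noteq> p"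
  shows "\<theta> vs = 0"
proof -
  have "\<theta> vs = (\<Sum>I\<in>increasing p. dz I vs *s \<theta> (frame I))"
    using assms(1) unfolding vtype_def by blast
  also have "\<dots> = 0"
    by (rule sum.neutral) (use assms(2) in \<open>auto simp: increasing_def dz_length\<close>)
  finally show ?thesis .
qed

lemma vtype_1I:
  assumes "clinear (\<lambda>u. \<theta> [u])" "\<And>vs. length vs \<noteq> 1 \<Longrightarrow> \<theta> vs = 0"
  shows "vtype 1 \<theta>"
  unfolding vtype_def
proof
  fix vs
  show "\<theta> vs = (\<Sum>I\<in>increasing 1. dz I vs *s \<theta> (frame I))"
  proof (cases "length vs = 1")
    case True
    then obtain u where "vs = [u]" by (auto simp: length_Suc_conv)
    then show ?thesis
      using clinear_expand[OF assms(1), of u] by (simp add: sum_increasing_1 dz_1 frame_def del: dz.simps One_nat_def)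
  next
    case False
    then show ?thesis
      by (auto simp: assms(2) increasing_def dz_length intro!: sum.neutral[symmetric])
  qed
qed

text \<open>Only the terms with \<open>i < k\<close> survive, each collecting the term with the indices exchanged.\<close>

lemma sum_alternating:
  fixes a :: "'n::{finite,linorder} \<Rightarrow> 'n \<Rightarrow> complex^'m"
  assumes alt: "\<And>i k. a k i = - a i k"
  shows "(\<Sum>i\<in>UNIV. \<Sum>k\<in>UNIV. (u i * v k) *s a i k) =
    (\<Sum>(i, k)\<in>{(i, k). i < k}. (u i * v k - v i * u k) *s a i k)"
proof -
  let ?L = "{(i, k). i < (k::'n)}" and ?G = "{(i, k). k < (i::'n)}"
  have diag: "a i i = 0" for i
    using alt[of i i] by (simp add: vec_eq_iff eq_neg_iff_add_eq_0)
  have "(\<Sum>i\<in>UNIV. \<Sum>k\<in>UNIV. (u i * v k) *s a i k) = (\<Sum>(i, k)\<in>UNIV. (u i * v k) *s a i k)"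
    by (simp add: sum.cartesian_product)
  also have "\<dots> = (\<Sum>(i, k)\<in>?L \<union> ?G. (u i * v k) *s a i k)"
    by (rule sum.mono_neutral_right) (auto simp: diag not_less_iff_gr_or_eq)
  also have "\<dots> = (\<Sum>(i, k)\<in>?L. (u i * v k) *s a i k) + (\<Sum>(i, k)\<in>?G. (u i * v k) *s a i k)"
    by (rule sum.union_disjoint) auto
  also have "(\<Sum>(i, k)\<in>?G. (u i * v k) *s a i k) = (\<Sum>(i, k)\<in>?L. (u k * v i) *s a k i)"
    by (rule sum.reindex_bij_witness[of _ "\<lambda>(i, k). (k, i)" "\<lambda>(i, k). (k, i)"]) auto
  also have "(\<Sum>(i, k)\<in>?L. (u i * v k) *s a i k) + (\<Sum>(i, k)\<in>?L. (u k * v i) *s a k i) = (\<Sum>(i, k)\<in>?L. (u i * v k - v i * u k) *s a i k)"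
  proof -
    have "(u i * v k) *s a i k + (u k * v i) *s a k i = (u i * v k - v i * u k) *s a i k" for i k
      unfolding alt[of i k] by (simp add: vec_eq_iff algebra_simps)
    then show ?thesis by (simp add: sum.distrib[symmetric] split_def)
  qed
  finally show ?thesis .
qed

lemma vtype_2I:
  assumes 1: "\<And>v. clinear (\<lambda>u. \<theta> [u, v])" and alt: "\<And>u v. \<theta> [v, u] = - \<theta> [u, v]"
    and len: "\<And>vs. length vs \<noteq> 2 \<Longrightarrow> \<theta> vs = 0"
  shows "vtype 2 \<theta>"
  unfolding vtype_def
proof
  fix vs
  have 2: "clinear (\<lambda>v. \<theta> [u, v])" for u
  proof -
    have "(\<lambda>v. \<theta> [u, v]) = (\<lambda>v. - \<theta> [v, u])" using alt[of u] by auto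
    then show ?thesis
      by (auto intro!: clinearI simp: clinear_add[OF 1] clinear_scale[OF 1] vec_eq_iff)
  qed
  show "\<theta> vs = (\<Sum>I\<in>increasing 2. dz I vs *s \<theta> (frame I))"
  proof (cases "length vs = 2")
    case True
    then obtain u v where vs: "vs = [u, v]" by (auto simp: length_Suc_conv numeral_2_eq_2)
    have "\<theta> [u, v] = (\<Sum>i\<in>UNIV. u $ i *s (\<Sum>k\<in>UNIV. v $ k *s \<theta> [axis i 1, axis k 1]))"
      by (subst clinear_expand[OF 1], subst clinear_expand[OF 2]) simp
    also have "\<dots> = (\<Sum>i\<in>UNIV. \<Sum>k\<in>UNIV. (u $ i * v $ k) *s \<theta> [axis i 1, axis k 1])"
      by (simp add: vec_eq_iff sum_distrib_left mult.assoc)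
    also have "\<dots> = (\<Sum>I\<in>increasing 2. dz I [u, v] *s \<theta> (frame I))"
      unfolding sum_increasing_2
      unfolding sum_alternating[of "\<lambda>i k. \<theta> [axis i 1, axis k 1]", OF alt]
      by (simp add: dz_2 frame_def del: dz.simps)
    finally show ?thesis by (simp add: vs)
  next
    case False
    then show ?thesis
      by (auto simp: len increasing_def dz_length intro!: sum.neutral[symmetric])
  qed
qed

lemma vtype_1_clinear:
  assumes "\<And>vs. \<theta> vs = (\<Sum>I\<in>increasing 1. dz I vs *s a I)"
  shows "clinear (\<lambda>u. \<theta> [u])"
  unfolding assms sum_increasing_1 dz_1
  by (rule clinearI) (simp_all add: vec_eq_iff sum.distrib sum_distrib_left algebra_simps)

lemma vtype_1_iff:
  "vtype 1 \<theta> \<longleftrightarrow> (\<exists>a. \<forall>vs. \<theta> vs = (\<Sum>I\<in>increasing 1. dz I vs *s a I))"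
proof
  assume "\<exists>a. \<forall>vs. \<theta> vs = (\<Sum>I\<in>increasing 1. dz I vs *s a I)"
  then obtain a where a: "\<And>vs. \<theta> vs = (\<Sum>I\<in>increasing 1. dz I vs *s a I)" by blast
  show "vtype 1 \<theta>"
  proof (rule vtype_1I)
    show "clinear (\<lambda>u. \<theta> [u])" by (rule vtype_1_clinear[OF a])
    show "\<theta> vs = 0" if "length vs \<noteq> 1" for vs
      unfolding a using that by (auto simp: increasing_def dz_length intro!: sum.neutral)
  qed
next
  assume "vtype 1 \<theta>"
  then show "\<exists>a. \<forall>vs. \<theta> vs = (\<Sum>I\<in>increasing 1. dz I vs *s a I)"
    unfolding vtype_def by (rule exI[of _ "\<lambda>I. \<theta> (frame I)"])
qed

lemma vtype_2D:
  assumes "\<And>vs. \<theta> vs = (\<Sum>I\<in>increasing 2. dz I vs *s a I)"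
  shows "clinear (\<lambda>u. \<theta> [u, v])" "\<theta> [v, u] = - \<theta> [u, v]"
proof -
  show "clinear (\<lambda>u. \<theta> [u, v])"
    unfolding assms sum_increasing_2 split_def dz_2
    by (rule clinearI) (simp_all add: vec_eq_iff sum.distrib[symmetric] sum_distrib_left algebra_simps)
  show "\<theta> [v, u] = - \<theta> [u, v]"
    unfolding assms sum_increasing_2 split_def dz_2 sum_negf[symmetric]
    by (intro sum.cong refl) (simp add: vec_eq_iff algebra_simps)
qed

lemma vtype_2_iff:
  "vtype 2 \<theta> \<longleftrightarrow> (\<exists>a. \<forall>vs. \<theta> vs = (\<Sum>I\<in>increasing 2. dz I vs *s a I))"
proof
  assume "\<exists>a. \<forall>vs. \<theta> vs = (\<Sum>I\<in>increasing 2. dz I vs *s a I)"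
  then obtain a where a: "\<And>vs. \<theta> vs = (\<Sum>I\<in>increasing 2. dz I vs *s a I)" by blast
  show "vtype 2 \<theta>"
  proof (rule vtype_2I)
    show "clinear (\<lambda>u. \<theta> [u, v])" "\<theta> [v, u] = - \<theta> [u, v]" for u v
      by (rule vtype_2D[OF a])+
    show "\<theta> vs = 0" if "length vs \<noteq> 2" for vs
      unfolding a using that by (auto simp: increasing_def dz_length intro!: sum.neutral)
  qed
next
  assume "vtype 2 \<theta>"
  then show "\<exists>a. \<forall>vs. \<theta> vs = (\<Sum>I\<in>increasing 2. dz I vs *s a I)"
    unfolding vtype_def by (rule exI[of _ "\<lambda>I. \<theta> (frame I)"])
qed

section \<open>The bracket in coordinates\<close>

text \<open>The Lie bracket of the vector fields \<open>\<theta>(us)\<close> and \<open>\<phi>(vs)\<close>, for constant arguments.\<close>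

definition lie :: "(complex^'n::finite \<Rightarrow> 'n vext) \<Rightarrow> (complex^'n \<Rightarrow> 'n vext) \<Rightarrow> complex^'n \<Rightarrow>
    (complex^'n) list \<Rightarrow> (complex^'n) list \<Rightarrow> complex^'n" where
  "lie \<theta> \<phi> z us vs = wirt (\<lambda>y. \<phi> y vs) z (\<theta> z us) - wirt (\<lambda>y. \<theta> y us) z (\<phi> z vs)"

lemma wirt_sum:
  assumes "\<And>i. i \<in> I \<Longrightarrow> f i differentiable (at z)"
  shows "wirt (\<lambda>y. \<Sum>i\<in>I. f i y) z x = (\<Sum>i\<in>I. wirt (f i) z x)"
  using assms
proof (induction I rule: infinite_finite_induct)
  case (insert i I)
  then show ?case by (simp add: wirt_add differentiable_sum)
qed (simp_all add: wirt_const)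

lemma clinear_scaling: "clinear (\<lambda>x. c *s x)"
  by (rule clinearI) (auto simp: vec_eq_iff algebra_simps)

lemma differentiable_clinear:
  "clinear L \<Longrightarrow> f differentiable F \<Longrightarrow> (\<lambda>y. L (f y)) differentiable F"
  unfolding differentiable_def
  by (blast intro: bounded_linear.has_derivative[OF clinear_imp_bounded_linear])

lemma wirt_vtype:
  assumes S: "open S" "z \<in> S" and t: "\<And>y. y \<in> S \<Longrightarrow> vtype p (\<theta> y)"
    and d: "\<And>vs. (\<lambda>y. \<theta> y vs) differentiable (at z)"
  shows "wirt (\<lambda>y. \<theta> y vs) z x = (\<Sum>I\<in>increasing p. dz I vs *s wirt (\<lambda>y. \<theta> y (frame I)) z x)"
proof -
  have eq: "\<theta> y vs = (\<Sum>I\<in>increasing p. dz I vs *s \<theta> y (frame I))" if "y \<in> S" for y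
    using t[OF that] unfolding vtype_def by blast
  have "wirt (\<lambda>y. \<theta> y vs) z x = wirt (\<lambda>y. \<Sum>I\<in>increasing p. dz I vs *s \<theta> y (frame I)) z x"
    by (rule wirt_cong_open[OF S eq d])
  also have "\<dots> = (\<Sum>I\<in>increasing p. wirt (\<lambda>y. dz I vs *s \<theta> y (frame I)) z x)"
    by (rule wirt_sum) (rule differentiable_clinear[OF clinear_scaling d])
  also have "\<dots> = (\<Sum>I\<in>increasing p. dz I vs *s wirt (\<lambda>y. \<theta> y (frame I)) z x)"
    by (simp add: wirt_clinear[OF clinear_scaling d])
  finally show ?thesis .
qed

text \<open>The Lie bracket with constant arguments is multilinear in them, although it is not linear over
  functions.\<close>

lemma lie_expand:
  assumes S: "open S" "z \<in> S"
    and \<theta>: "\<And>y. y \<in> S \<Longrightarrow> vtype p (\<theta> y)" "\<And>vs. (\<lambda>y. \<theta> y vs) differentiable (at z)"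
    and \<phi>: "\<And>y. y \<in> S \<Longrightarrow> vtype q (\<phi> y)" "\<And>vs. (\<lambda>y. \<phi> y vs) differentiable (at z)"
  shows "(\<Sum>I\<in>increasing p. \<Sum>K\<in>increasing q. (dz I us * dz K vs) *s lie \<theta> \<phi> z (frame I) (frame K))
     = lie \<theta> \<phi> z us vs"
proof -
  have t: "\<theta> z us = (\<Sum>I\<in>increasing p. dz I us *s \<theta> z (frame I))"
    "\<phi> z vs = (\<Sum>K\<in>increasing q. dz K vs *s \<phi> z (frame K))"
    using \<theta>(1)[OF S(2)] \<phi>(1)[OF S(2)] unfolding vtype_def by blast+
  note c = clinear_wirt[OF \<theta>(2)] clinear_wirt[OF \<phi>(2)]
  have w: "wirt (\<lambda>y. \<theta> y us) z x = (\<Sum>I\<in>increasing p. dz I us *s wirt (\<lambda>y. \<theta> y (frame I)) z x)"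
    "wirt (\<lambda>y. \<phi> y vs) z x = (\<Sum>K\<in>increasing q. dz K vs *s wirt (\<lambda>y. \<phi> y (frame K)) z x)" for x
    by (rule wirt_vtype[OF S \<theta>] wirt_vtype[OF S \<phi>]; assumption)+
  have 1: "wirt (\<lambda>y. \<phi> y vs) z (\<theta> z us) =
    (\<Sum>I\<in>increasing p. \<Sum>K\<in>increasing q. (dz I us * dz K vs) *s wirt (\<lambda>y. \<phi> y (frame K)) z (\<theta> z (frame I)))"
    unfolding t(1) clinear_sum[OF c(2)] clinear_scale[OF c(2)] w(2)
    by (subst sum.swap) (simp add: vec_eq_iff sum_distrib_left mult_ac)
  have 2: "wirt (\<lambda>y. \<theta> y us) z (\<phi> z vs) =
    (\<Sum>I\<in>increasing p. \<Sum>K\<in>increasing q. (dz I us * dz K vs) *s wirt (\<lambda>y. \<theta> y (frame I)) z (\<phi> z (frame K)))"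
    unfolding t(2) clinear_sum[OF c(1)] clinear_scale[OF c(1)] w(1)
    by (simp add: vec_eq_iff sum_distrib_left mult_ac)
  show ?thesis
    unfolding lie_def 1 2
    by (simp add: sum_subtractf vec_eq_iff algebra_simps)
qed

lemma coord_bracket_lie:
  assumes \<theta>: "\<And>vs. (\<lambda>y. \<theta> y vs) differentiable (at z)"
    and \<phi>: "\<And>vs. (\<lambda>y. \<phi> y vs) differentiable (at z)"
  shows "coord_bracket p q \<theta> \<phi> z vs =
    (\<Sum>I\<in>increasing p. \<Sum>K\<in>increasing q. wedge p q (dz I) (dz K) vs *s lie \<theta> \<phi> z (frame I) (frame K))"
proof -
  have "(\<chi> l. \<Sum>j\<in>UNIV. \<theta> z us $ j * del j (\<lambda>y. \<phi> y ws $ l) z - \<phi> z ws $ j * del j (\<lambda>y. \<theta> y us $ l) z)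
    = lie \<theta> \<phi> z us ws" for us ws
    by (simp add: lie_def vec_eq_iff wirt_nth[OF \<theta>] wirt_nth[OF \<phi>] sum_subtractf)
  then show ?thesis by (simp add: coord_bracket_def)
qed

lemma coord_bracket_1_1:
  assumes S: "open S" "z \<in> S"
    and \<theta>: "\<And>y. y \<in> S \<Longrightarrow> vtype 1 (\<theta> y)" "\<And>vs. (\<lambda>y. \<theta> y vs) differentiable (at z)"
    and \<phi>: "\<And>y. y \<in> S \<Longrightarrow> vtype 1 (\<phi> y)" "\<And>vs. (\<lambda>y. \<phi> y vs) differentiable (at z)"
  shows "coord_bracket 1 1 \<theta> \<phi> z [u, v] = lie \<theta> \<phi> z [u] [v] - lie \<theta> \<phi> z [v] [u]"
proof -
  have le: "(\<Sum>I\<in>increasing 1. \<Sum>K\<in>increasing 1. (dz I us * dz K vs) *s lie \<theta> \<phi> z (frame I) (frame K))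
     = lie \<theta> \<phi> z us vs" for us vs
    by (rule lie_expand[OF S \<theta> \<phi>])
  show ?thesis
    unfolding coord_bracket_lie[OF \<theta>(2) \<phi>(2)] wedge_1_1
      le[of "[u]" "[v]", symmetric] le[of "[v]" "[u]", symmetric]
    by (simp add: sum_subtractf vector_sub_rdistrib)
qed

lemma dz_2_alternating: "length K = 2 \<Longrightarrow> dz K [v, u] = - dz K [u, v]"
  by (auto simp: length_Suc_conv numeral_2_eq_2 dz_2 simp del: dz.simps)

lemma coord_bracket_1_2:
  assumes S: "open S" "z \<in> S"
    and \<theta>: "\<And>y. y \<in> S \<Longrightarrow> vtype 1 (\<theta> y)" "\<And>vs. (\<lambda>y. \<theta> y vs) differentiable (at z)"
    and \<phi>: "\<And>y. y \<in> S \<Longrightarrow> vtype 2 (\<phi> y)" "\<And>vs. (\<lambda>y. \<phi> y vs) differentiable (at z)"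
  shows "coord_bracket 1 2 \<theta> \<phi> z [u, v, w] =
    lie \<theta> \<phi> z [u] [v, w] + lie \<theta> \<phi> z [v] [w, u] + lie \<theta> \<phi> z [w] [u, v]"
proof -
  have "wedge 1 2 (dz I) (dz K) [u, v, w] =
     dz I [u] * dz K [v, w] + dz I [v] * dz K [w, u] + dz I [w] * dz K [u, v]"
    if "K \<in> increasing 2" for I K
    using that by (intro wedge_1_2 dz_2_alternating) (simp add: increasing_def)
  moreover have le: "(\<Sum>I\<in>increasing 1. \<Sum>K\<in>increasing 2. (dz I us * dz K vs) *s lie \<theta> \<phi> z (frame I) (frame K))
     = lie \<theta> \<phi> z us vs" for us vs
    by (rule lie_expand[OF S \<theta> \<phi>])
  ultimately show ?thesis
    unfolding coord_bracket_lie[OF \<theta>(2) \<phi>(2)] le[of "[u]" "[v, w]", symmetric]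
      le[of "[v]" "[w, u]", symmetric] le[of "[w]" "[u, v]", symmetric]
    by (simp add: sum.distrib vector_sadd_rdistrib)
qed

lemma coord_bracket_length: "length vs \<noteq> p + q \<Longrightarrow> coord_bracket p q \<theta> \<phi> z vs = 0"
  by (simp add: coord_bracket_def wedge_length)

section \<open>Forms of type (1,1)\<close>

definition type11 :: "'n::{finite,linorder} ext \<Rightarrow> bool" where
  "type11 \<eta> \<longleftrightarrow> (\<exists>a. \<forall>vs. \<eta> vs = (\<Sum>I\<in>increasing 1. \<Sum>J\<in>increasing 1. a I J * wedge 1 1 (dz I) (dzbar J) vs))"

lemma type11_coefficients:
  fixes \<eta> :: "'n::{finite,linorder} ext"
  assumes "type11 \<eta>"
  obtains a where
    "\<And>u v :: (complex, 'n) vec. \<eta> [u, v] = (\<Sum>i\<in>UNIV. \<Sum>j\<in>UNIV. a i j * (u $ i * cnj (v $ j) - v $ i * cnj (u $ j)))"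
    "\<And>u v :: (complex, 'n) vec. contract u \<eta> [v] = (\<Sum>i\<in>UNIV. \<Sum>j\<in>UNIV. a i j * (u $ i * cnj (v $ j)))"
    "\<And>vs. length vs \<noteq> 2 \<Longrightarrow> \<eta> vs = 0"
proof -
  obtain a where a: "\<And>vs. \<eta> vs = (\<Sum>I\<in>increasing 1. \<Sum>J\<in>increasing 1. a I J * wedge 1 1 (dz I) (dzbar J) vs)"
    using assms unfolding type11_def by blast
  have 1: "\<eta> [u, v] = (\<Sum>i\<in>UNIV. \<Sum>j\<in>UNIV. a [i] [j] * (u $ i * cnj (v $ j) - v $ i * cnj (u $ j)))"
    for u v :: "(complex, 'n) vec"
    unfolding a sum_increasing_1 wedge_1_1 dz_1 dzbar_1 by simp
  have 2: "contract u \<eta> [v] = (\<Sum>i\<in>UNIV. \<Sum>j\<in>UNIV. a [i] [j] * (u $ i * cnj (v $ j)))"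
    for u v :: "(complex, 'n) vec"
    unfolding contract_def 1 sum_distrib_left sum_subtractf[symmetric] sum_divide_distrib
    by (intro sum.cong refl) (simp add: field_simps)
  have 3: "\<eta> vs = 0" if "length vs \<noteq> 2" for vs
    using that by (simp add: a wedge_length)
  show thesis by (rule that, rule 1, rule 2, rule 3)
qed

text \<open>Contraction with a vector turns a \<open>(1,1)\<close>-form into a form that is complex-linear in the vector and
  antilinear in the remaining argument; the form is recovered by antisymmetrising.\<close>

lemma type11_contract:
  fixes \<eta> :: "'n::{finite,linorder} ext"
  assumes "type11 \<eta>"
  shows "contract (u + u') \<eta> [v] = contract u \<eta> [v] + contract u' \<eta> [v]"
    and "contract (c *s u) \<eta> [v] = c * contract u \<eta> [v]"
    and "contract u \<eta> [v + v'] = contract u \<eta> [v] + contract u \<eta> [v']"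
    and "contract u \<eta> [c *s v] = cnj c * contract u \<eta> [v]"
    and "\<eta> [u, v] = contract u \<eta> [v] - contract v \<eta> [u]"
    and "length ws \<noteq> 1 \<Longrightarrow> contract u \<eta> ws = 0"
    and "length vs \<noteq> 2 \<Longrightarrow> \<eta> vs = 0"
proof -
  obtain a where a:
    "\<And>u v :: (complex, 'n) vec. \<eta> [u, v] = (\<Sum>i\<in>UNIV. \<Sum>j\<in>UNIV. a i j * (u $ i * cnj (v $ j) - v $ i * cnj (u $ j)))"
    "\<And>u v :: (complex, 'n) vec. contract u \<eta> [v] = (\<Sum>i\<in>UNIV. \<Sum>j\<in>UNIV. a i j * (u $ i * cnj (v $ j)))"
    "\<And>vs. length vs \<noteq> 2 \<Longrightarrow> \<eta> vs = 0"
    by (rule type11_coefficients[OF assms]) (rule that)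
  show "contract (u + u') \<eta> [v] = contract u \<eta> [v] + contract u' \<eta> [v]"
    unfolding a(2) sum.distrib[symmetric] by (intro sum.cong refl) (simp add: algebra_simps)
  show "contract (c *s u) \<eta> [v] = c * contract u \<eta> [v]"
    unfolding a(2) sum_distrib_left by (intro sum.cong refl) (simp add: algebra_simps)
  show "contract u \<eta> [v + v'] = contract u \<eta> [v] + contract u \<eta> [v']"
    unfolding a(2) sum.distrib[symmetric] by (intro sum.cong refl) (simp add: algebra_simps)
  show "contract u \<eta> [c *s v] = cnj c * contract u \<eta> [v]"
    unfolding a(2) sum_distrib_left by (intro sum.cong refl) (simp add: algebra_simps)
  show "\<eta> [u, v] = contract u \<eta> [v] - contract v \<eta> [u]"
    unfolding a(1,2) sum_subtractf[symmetric] by (intro sum.cong refl) (simp add: algebra_simps)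
  show "length ws \<noteq> 1 \<Longrightarrow> contract u \<eta> ws = 0"
    by (simp add: contract_def a(3))
  show "length vs \<noteq> 2 \<Longrightarrow> \<eta> vs = 0" by (rule a(3))
qed

text \<open>The coefficient vector of the antilinear function obtained by contraction with \<open>u\<close>.\<close>

definition lower :: "'n::finite ext \<Rightarrow> complex^'n \<Rightarrow> complex^'n" where
  "lower \<eta> u = (\<chi> j. contract u \<eta> [axis j 1])"

lemma clinear_lower: "type11 \<eta> \<Longrightarrow> clinear (lower \<eta>)"
  by (rule clinearI) (simp_all add: lower_def vec_eq_iff type11_contract)

lemma contract_lower:
  assumes "type11 \<eta>"
  shows "contract u \<eta> [w] = (\<Sum>j\<in>UNIV. lower \<eta> u $ j * cnj (w $ j))"
proof -
  have s: "contract u \<eta> [\<Sum>j\<in>J. w $ j *s axis j 1] = (\<Sum>j\<in>J. contract u \<eta> [axis j 1] * cnj (w $ j))" for J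
  proof (induction J rule: infinite_finite_induct)
    case (insert j J)
    then show ?case by (simp add: type11_contract(3,4)[OF assms] mult.commute)
  qed (use type11_contract(4)[OF assms, of u 0 0] in \<open>simp_all\<close>)
  show ?thesis
    using s[of UNIV] vec_expand[of w] by (simp add: lower_def)
qed

lemma vtype_contract:
  assumes t: "type11 \<eta>" and \<theta>: "vtype p \<theta>"
  shows "(\<Sum>I\<in>increasing p. dz I us * contract (\<theta> (frame I)) \<eta> [w]) = contract (\<theta> us) \<eta> [w]"
proof -
  have "\<theta> us = (\<Sum>I\<in>increasing p. dz I us *s \<theta> (frame I))" using \<theta> unfolding vtype_def by blast
  then have "lower \<eta> (\<theta> us) = (\<Sum>I\<in>increasing p. dz I us *s lower \<eta> (\<theta> (frame I)))"
    by (simp add: clinear_sum[OF clinear_lower[OF t]] clinear_scale[OF clinear_lower[OF t]])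
  then show ?thesis
    by (simp add: contract_lower[OF t] sum_distrib_left sum_distrib_right mult.assoc)
       (subst sum.swap, simp)
qed

lemma interior_prod_1:
  assumes t: "type11 \<eta>" and \<theta>: "vtype 1 \<theta>"
  shows "interior_prod 1 1 \<theta> \<eta> [u, w] = contract (\<theta> [u]) \<eta> [w] - contract (\<theta> [w]) \<eta> [u]"
  unfolding interior_prod_def wedge_1_1 by (simp add: sum_subtractf vtype_contract[OF t \<theta>] del: One_nat_def)

lemma interior_prod_2:
  assumes t: "type11 \<eta>" and \<theta>: "vtype 2 \<theta>"
  shows "interior_prod 2 1 \<theta> \<eta> [u, v, w] =
    contract (\<theta> [u, v]) \<eta> [w] - contract (\<theta> [u, w]) \<eta> [v] + contract (\<theta> [v, w]) \<eta> [u]"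
proof -
  have "interior_prod 2 1 \<theta> \<eta> [u, v, w] = (\<Sum>I\<in>increasing 2.
      dz I [u, v] * contract (\<theta> (frame I)) \<eta> [w] - dz I [u, w] * contract (\<theta> (frame I)) \<eta> [v]
      + dz I [v, w] * contract (\<theta> (frame I)) \<eta> [u])"
    unfolding interior_prod_def
    by (intro sum.cong refl wedge_2_1 dz_2_alternating) (simp add: increasing_def)
  then show ?thesis by (simp add: sum_subtractf sum.distrib vtype_contract[OF t \<theta>])
qed

lemma wedge_sum3_right:
  assumes "\<And>vs. \<eta> vs = \<eta>1 vs + \<eta>2 vs + \<eta>3 vs"
  shows "wedge p q \<xi> \<eta> vs = wedge p q \<xi> \<eta>1 vs + wedge p q \<xi> \<eta>2 vs + wedge p q \<xi> \<eta>3 vs"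
  by (simp add: wedge_def assms distrib_left sum.distrib add_divide_distrib)

lemma interior_prod_sum3:
  assumes t: "type11 \<eta>"
  shows "interior_prod p 1 \<theta>1 \<eta> vs + interior_prod p 1 \<theta>2 \<eta> vs + interior_prod p 1 \<theta>3 \<eta> vs
    = interior_prod p 1 (\<lambda>us. \<theta>1 us + \<theta>2 us + \<theta>3 us) \<eta> vs"
proof -
  have c: "contract (a + b + c) \<eta> ws = contract a \<eta> ws + contract b \<eta> ws + contract c \<eta> ws" for a b c ws
  proof (cases "length ws = 1")
    case True
    then obtain w where "ws = [w]" by (auto simp: length_Suc_conv)
    then show ?thesis by (simp add: type11_contract(1)[OF t])
  qed (simp add: type11_contract(6)[OF t])
  show ?thesis
    unfolding interior_prod_def sum.distrib[symmetric]
    by (intro sum.cong refl wedge_sum3_right[symmetric] c)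
qed

lemma interior_prod_zero:
  assumes t: "type11 \<eta>"
  shows "interior_prod p 1 (\<lambda>us. 0) \<eta> vs = 0"
proof -
  have c0: "contract 0 \<eta> ws = 0" for ws
  proof (cases "length ws = 1")
    case True
    then obtain w where "ws = [w]" by (auto simp: length_Suc_conv)
    then show ?thesis using type11_contract(2)[OF t, of 0 0] by simp
  qed (simp add: type11_contract(6)[OF t])
  have "contract 0 \<eta> = (\<lambda>ws. 0)" by (rule ext) (rule c0)
  then show ?thesis by (simp add: interior_prod_def wedge_def cong: if_cong)
qed

section \<open>Charts and transition maps\<close>

lemma chart_inj:
  assumes "is_chart X c"
  shows "inj_on (snd c) (fst c)"
proof -
  have "topspace (subtopology X (fst c)) = fst c"
    using assms openin_subset[of X "fst c"] by (auto simp: is_chart_def)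
  then show ?thesis
    using assms homeomorphic_imp_injective_map unfolding is_chart_def by metis
qed

lemma chart_open_image:
  assumes "is_chart X c" "openin X U"
  shows "open (snd c ` (fst c \<inter> U))"
proof -
  have "openin (subtopology X (fst c)) (fst c \<inter> U)"
    using assms(2) by (auto simp: openin_subtopology_Int2)
  moreover have "open_map (subtopology X (fst c)) (top_of_set (snd c ` fst c)) (snd c)"
    using assms(1) homeomorphic_imp_open_map unfolding is_chart_def by metis
  ultimately have "openin (top_of_set (snd c ` fst c)) (snd c ` (fst c \<inter> U))"
    by (simp add: open_map_def)
  then show ?thesis
    using assms(1) openin_open_trans unfolding is_chart_def by metis
qed

lemma transition_chart:
  assumes "is_chart X c" "p \<in> fst c"
  shows "transition c d (snd c p) = snd d p"
  using inv_into_f_f[OF chart_inj[OF assms(1)] assms(2)] by (simp add: transition_def)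

locale complex_manifold =
  fixes X :: "'a topology" and A :: "('a, 'n::{finite,linorder}) chart set"
  assumes atlas: "complex_atlas X A"
begin

abbreviation "cdom c \<equiv> snd c ` fst c" for c :: "('a, 'n) chart"

lemma chartsD: "c \<in> charts X A \<Longrightarrow> is_chart X c"
  by (simp add: charts_def)

lemma atlas_subset_charts: "A \<subseteq> charts X A"
  using atlas by (auto simp: complex_atlas_def charts_def)

lemma open_cdom: "c \<in> charts X A \<Longrightarrow> open (cdom c)"
  by (simp add: charts_def is_chart_def)

lemma openin_chart: "c \<in> charts X A \<Longrightarrow> openin X (fst c)"
  by (simp add: charts_def is_chart_def)

lemma open_overlap: "c \<in> charts X A \<Longrightarrow> d \<in> charts X A \<Longrightarrow> open (snd c ` (fst c \<inter> fst d))"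
  using chart_open_image chartsD openin_chart by metis

lemma transition_eq: "c \<in> charts X A \<Longrightarrow> p \<in> fst c \<Longrightarrow> transition c d (snd c p) = snd d p"
  using transition_chart chartsD by metis

lemma holomorphic_transition:
  assumes c: "c \<in> charts X A" and d: "d \<in> charts X A"
  shows "holomorphic_map_on (snd c ` (fst c \<inter> fst d)) (transition c d)"
  unfolding holomorphic_map_on_def
proof
  fix z assume "z \<in> snd c ` (fst c \<inter> fst d)"
  then obtain p where p: "z = snd c p" "p \<in> fst c" "p \<in> fst d" by auto
  have "p \<in> topspace X" using p openin_subset[OF openin_chart[OF c]] by auto
  then obtain e where e: "e \<in> A" "p \<in> fst e"
    using atlas unfolding complex_atlas_def by blast
  have e': "e \<in> charts X A" using e atlas_subset_charts by auto
  have "holomorphic_map_on (snd c ` (fst c \<inter> fst e)) (transition c e)"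
    "holomorphic_map_on (snd e ` (fst d \<inter> fst e)) (transition e d)"
    using c d e by (auto simp: charts_def compatible_def Int_commute)
  then obtain D1 D2 where D: "(transition c e has_derivative D1) (at z)" "\<And>t v. D1 (t *s v) = t *s D1 v"
    "(transition e d has_derivative D2) (at (snd e p))" "\<And>t v. D2 (t *s v) = t *s D2 v"
    using p e unfolding holomorphic_map_on_def by (metis IntI image_eqI)
  have S: "open (snd c ` (fst c \<inter> (fst d \<inter> fst e)))"
    by (intro chart_open_image[OF chartsD[OF c]] openin_Int openin_chart d e')
  have eq: "transition e d (transition c e y) = transition c d y"
    if "y \<in> snd c ` (fst c \<inter> (fst d \<inter> fst e))" for y
    using that by (auto simp: transition_eq c d e')
  have "((\<lambda>y. transition e d (transition c e y)) has_derivative (\<lambda>v. D2 (D1 v))) (at z)"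
    using has_derivative_compose[OF D(1), of "transition e d" D2] D(3) p by (simp add: transition_eq c)
  then have "(transition c d has_derivative (\<lambda>v. D2 (D1 v))) (at z)"
    by (rule has_derivative_transform_within_open[OF _ S _ eq]) (use p e in auto)
  then show "\<exists>D. (transition c d has_derivative D) (at z) \<and> (\<forall>t v. D (t *s v) = t *s D v)"
    using D by (intro exI[of _ "\<lambda>v. D2 (D1 v)"]) auto
qed

lemma
  assumes c: "c \<in> charts X A" "d \<in> charts X A" and p: "p \<in> fst c" "p \<in> fst d"
  shows has_derivative_transition: "(transition c d has_derivative jac c d (snd c p)) (at (snd c p))"
    and clinear_jac: "clinear (jac c d (snd c p))"
  unfolding jac_def
  by (rule holomorphic_map_onD[OF holomorphic_transition[OF c]]; use p in auto)+

lemma holomorphic_jac: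
  assumes c: "c \<in> charts X A" "d \<in> charts X A"
  shows "holomorphic_map_on (snd c ` (fst c \<inter> fst d)) (\<lambda>z. jac c d z u)"
  unfolding jac_def
  by (rule holomorphic_map_on_derivative[OF open_overlap[OF c] holomorphic_transition[OF c]])

lemma jac_chain:
  assumes c: "c \<in> charts X A" "d \<in> charts X A" "e \<in> charts X A" and p: "p \<in> fst c" "p \<in> fst d" "p \<in> fst e"
  shows "jac d e (snd d p) (jac c d (snd c p) v) = jac c e (snd c p) v"
proof -
  have S: "open (snd c ` (fst c \<inter> (fst d \<inter> fst e)))"
    by (intro chart_open_image[OF chartsD] openin_Int openin_chart c)
  have eq: "transition d e (transition c d y) = transition c e y"
    if "y \<in> snd c ` (fst c \<inter> (fst d \<inter> fst e))" for y
    using that by (auto simp: transition_eq c)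
  have "((\<lambda>y. transition d e (transition c d y)) has_derivative
      (\<lambda>v. jac d e (snd d p) (jac c d (snd c p) v))) (at (snd c p))"
    using has_derivative_compose[OF has_derivative_transition[OF c(1,2) p(1,2)], of "transition d e"
        "jac d e (snd d p)"] has_derivative_transition[OF c(2,3) p(2,3)]
    by (simp add: transition_eq c p)
  then have "(transition c e has_derivative (\<lambda>v. jac d e (snd d p) (jac c d (snd c p) v))) (at (snd c p))"
    by (rule has_derivative_transform_within_open[OF _ S _ eq]) (use p in auto)
  from has_derivative_unique[OF this has_derivative_transition[OF c(1,3) p(1,3)]]
  show ?thesis by metis
qed

lemma jac_self:
  assumes c: "c \<in> charts X A" and p: "p \<in> fst c"
  shows "jac c c (snd c p) v = v"
proof -
  have "((\<lambda>y. y) has_derivative jac c c (snd c p)) (at (snd c p))"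
    by (rule has_derivative_transform_within_open[OF has_derivative_transition[OF c c p p] open_cdom[OF c]])
       (use p in \<open>auto simp: transition_eq c\<close>)
  from has_derivative_unique[OF this has_derivative_ident] show ?thesis by metis
qed

lemma jac_inverse:
  assumes "c \<in> charts X A" "d \<in> charts X A" "p \<in> fst c" "p \<in> fst d"
  shows "jac d c (snd d p) (jac c d (snd c p) v) = v"
  using jac_chain[of c d c] jac_self assms by metis

end

section \<open>The Kaehler metric in a chart\<close>

locale kaehler = complex_manifold X A
  for X :: "'a topology" and A :: "('a, 'n::{finite,linorder}) chart set" +
  fixes \<omega> :: "('a, 'n) form"
  assumes kaehler: "kaehler_form X A \<omega>"
begin

lemma omega_forms: "\<omega> \<in> forms X A 1 1"
  using kaehler by (simp add: kaehler_form_def)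

lemma omega_type11: "c \<in> charts X A \<Longrightarrow> z \<in> cdom c \<Longrightarrow> type11 (\<omega> c z)"
  using omega_forms unfolding forms_def type11_def by blast

lemma omega_smooth: "c \<in> charts X A \<Longrightarrow> smooth_on (cdom c) (\<lambda>z. \<omega> c z vs)"
  using omega_forms by (simp add: forms_def)

abbreviation "low c z \<equiv> lower (\<omega> c z)"

lemma clinear_low: "c \<in> charts X A \<Longrightarrow> z \<in> cdom c \<Longrightarrow> clinear (low c z)"
  by (rule clinear_lower[OF omega_type11])

lemma low_nth: "low c z u $ j = (\<omega> c z [u, axis j 1] - \<i> * \<omega> c z [\<i> *s u, axis j 1]) / 2"
  by (simp add: lower_def contract_def)

lemma smooth_lower:
  assumes \<eta>: "\<eta> \<in> forms X A p q" and c: "c \<in> charts X A"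
  shows "smooth_on (cdom c) (\<lambda>z. lower (\<eta> c z) u)"
proof -
  have \<eta>s: "smooth_on (cdom c) (\<lambda>z. \<eta> c z vs)" for vs
    using \<eta> c unfolding forms_def by blast
  have "smooth_on (cdom c) (\<lambda>z. (\<eta> c z [u, axis j 1] + (- \<i>) * \<eta> c z [\<i> *s u, axis j 1]) * (1/2))" for j
    by (intro smooth_on_mult smooth_on_add smooth_on_const \<eta>s c open_cdom)
  then show ?thesis
    by (intro smooth_on_vecI open_cdom c) (simp add: lower_def contract_def)
qed

lemmas smooth_low = smooth_lower[OF omega_forms]

lemma metric_hermitian:
  assumes c: "c \<in> charts X A" "z \<in> cdom c"
  shows "contract u (\<omega> c z) [w] = - cnj (contract w (\<omega> c z) [u])"
proof -
  note t = type11_contract[OF omega_type11[OF c]]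
  have "\<omega> c z [u, w] \<in> \<real>" "\<omega> c z [\<i> *s u, w] \<in> \<real>"
    using kaehler c by (auto simp: kaehler_form_def)
  then have "Im (contract u (\<omega> c z) [w] - contract w (\<omega> c z) [u]) = 0"
    "Im (\<i> * contract u (\<omega> c z) [w] + \<i> * contract w (\<omega> c z) [u]) = 0"
    by (auto simp: t(5)[of u w] t(5)[of "\<i> *s u" w] t(2,4) complex_is_Real_iff)
  then show ?thesis by (simp add: complex_eq_iff)
qed

lemma metric_positive:
  assumes c: "c \<in> charts X A" "z \<in> cdom c" and "u \<noteq> 0"
  shows "\<exists>r>0. contract u (\<omega> c z) [u] = \<i> * of_real r"
proof -
  note t = type11_contract[OF omega_type11[OF c]]
  have "kaehler_metric \<omega> c z u u > 0"
    using kaehler assms by (auto simp: kaehler_form_def)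
  then have "Re (contract u (\<omega> c z) [\<i> *s u] - contract (\<i> *s u) (\<omega> c z) [u]) > 0"
    by (simp add: kaehler_metric_def t(5)[of u "\<i> *s u"])
  then have "Im (contract u (\<omega> c z) [u]) > 0" by (simp add: t(2,4))
  moreover have "Re (contract u (\<omega> c z) [u]) = 0"
    using arg_cong[OF metric_hermitian[OF c, of u u], of Re] by simp
  ultimately show ?thesis
    by (intro exI[of _ "Im (contract u (\<omega> c z) [u])"]) (simp add: complex_eq_iff)
qed

lemma low_injective:
  assumes c: "c \<in> charts X A" "z \<in> cdom c" and "low c z u = 0"
  shows "u = 0"
proof (rule ccontr)
  assume "u \<noteq> 0"
  from metric_positive[OF c this] show False
    using contract_lower[OF omega_type11[OF c], of u u] assms(3) by auto
qed

definition raise :: "('a, 'n) chart \<Rightarrow> (complex, 'n) vec \<Rightarrow> (complex, 'n) vec \<Rightarrow> (complex, 'n) vec" where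
  "raise c z = inv (low c z)"

lemma
  assumes c: "c \<in> charts X A" "z \<in> cdom c"
  shows low_raise: "low c z (raise c z b) = b"
    and raise_low: "raise c z (low c z u) = u"
proof -
  have lin: "linear (low c z)" by (rule clinear_imp_linear[OF clinear_low[OF c]])
  have inj: "inj (low c z)"
    using low_injective[OF c] by (simp add: linear_injective_0[OF lin])
  show "low c z (raise c z b) = b"
    unfolding raise_def by (rule surj_f_inv_f[OF linear_injective_imp_surjective]) (use lin inj in auto)
  show "raise c z (low c z u) = u"
    unfolding raise_def by (rule inv_f_f[OF inj])
qed

lemma low_eq_iff:
  assumes c: "c \<in> charts X A" "z \<in> cdom c"
  shows "low c z u = low c z v \<longleftrightarrow> u = v"
  using raise_low[OF c] by metis

lemma clinear_raise:
  assumes c: "c \<in> charts X A" "z \<in> cdom c"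
  shows "clinear (raise c z)"
  by (rule clinearI; subst low_eq_iff[OF c, symmetric])
     (simp_all add: clinear_add[OF clinear_low[OF c]] clinear_scale[OF clinear_low[OF c]] low_raise[OF c])

lemma smooth_raise:
  assumes c: "c \<in> charts X A" and b: "smooth_on (cdom c) b"
  shows "smooth_on (cdom c) (\<lambda>z. raise c z (b z))"
  by (rule smooth_on_linear_solve[OF open_cdom[OF c] b, where L = "low c"])
     (use c in \<open>auto intro: low_raise clinear_low low_injective smooth_low\<close>)

text \<open>\<open>\<Gamma>(x,u)\<close> for the Chern connection of the metric: the derivative of \<open>g(u,\<sqdot>)\<close> along \<open>x\<close>, with its index
  raised.\<close>

definition christoffel :: "('a, 'n) chart \<Rightarrow> (complex, 'n) vec \<Rightarrow> (complex, 'n) vec \<Rightarrow> (complex, 'n) vec \<Rightarrow> (complex, 'n) vec" where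
  "christoffel c z x u = raise c z (wirt (\<lambda>y. low c y u) z x)"

lemma low_christoffel:
  "c \<in> charts X A \<Longrightarrow> z \<in> cdom c \<Longrightarrow> low c z (christoffel c z x u) = wirt (\<lambda>y. low c y u) z x"
  by (simp add: christoffel_def low_raise)

lemma smooth_christoffel:
  assumes c: "c \<in> charts X A"
  shows "smooth_on (cdom c) (\<lambda>z. christoffel c z x u)"
  unfolding christoffel_def
  by (intro smooth_raise smooth_on_wirt open_cdom smooth_low c)

lemma differentiable_low: "c \<in> charts X A \<Longrightarrow> z \<in> cdom c \<Longrightarrow> (\<lambda>y. low c y u) differentiable (at z)"
  by (rule smooth_on_imp_differentiable[OF smooth_low])

lemma clinear_christoffel_1:
  assumes c: "c \<in> charts X A" "z \<in> cdom c"
  shows "clinear (\<lambda>x. christoffel c z x u)"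
  unfolding christoffel_def
  by (rule clinearI)
    (simp_all add: clinear_add[OF clinear_wirt[OF differentiable_low[OF c]]]
       clinear_scale[OF clinear_wirt[OF differentiable_low[OF c]]]
       clinear_add[OF clinear_raise[OF c]] clinear_scale[OF clinear_raise[OF c]])

text \<open>The component of type \<open>(2,1)\<close> of \<open>d\<omega> = 0\<close>. It is isolated by projecting two of the three arguments of
  \<open>d\<omega>\<close> to type \<open>(1,0)\<close>, which kills the derivative of \<open>\<omega>(u,v)\<close> along the third.\<close>

lemma wirt_low_symmetric:
  assumes c: "c \<in> charts X A" "z \<in> cdom c"
  shows "wirt (\<lambda>y. low c y v) z u = wirt (\<lambda>y. low c y u) z v"
proof -
  define N where "N u v w = frechet_derivative (\<lambda>y. \<omega> c y [v, w]) (at z) u" for u v w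
  have hd: "((\<lambda>y. \<omega> c y [v, w]) has_derivative (\<lambda>u. N u v w)) (at z)" for v w
    using smooth_on_imp_differentiable[OF omega_smooth[OF c(1)] c(2), of "[v, w]"]
    by (simp add: N_def frechet_derivative_works)
  have closed: "N u v w - N v u w + N w u v = 0" for u v w
  proof -
    have "ext_deriv (\<omega> c) z [u, v, w] = 0" using kaehler c by (auto simp: kaehler_form_def)
    moreover have "{..<3::nat} = {0, 1, 2}" by auto
    ultimately show ?thesis by (simp add: ext_deriv_def N_def)
  qed
  have w: "wirt (\<lambda>y. low c y v) z u $ j = (1/4) * (N u v (axis j 1) - \<i> * N u (\<i> *s v) (axis j 1)
      - \<i> * N (\<i> *s u) v (axis j 1) - N (\<i> *s u) (\<i> *s v) (axis j 1))" for u v j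
  proof -
    have der: "((\<lambda>y. low c y v $ j) has_derivative
       (\<lambda>u. (N u v (axis j 1) - \<i> * N u (\<i> *s v) (axis j 1)) / 2)) (at z)"
      unfolding low_nth by (intro bounded_linear.has_derivative[OF bounded_linear_divide] has_derivative_diff has_derivative_mult_right hd)
    have fr: "frechet_derivative (\<lambda>y. low c y v) (at z) u $ j = (N u v (axis j 1) - \<i> * N u (\<i> *s v) (axis j 1)) / 2" for u
      using fun_cong[OF frechet_derivative_at[OF der], of u]
      by (simp add: frechet_derivative_linear[OF bounded_linear_vec_nth differentiable_low[OF c]])
    show ?thesis unfolding wirt_def by (simp add: fr field_simps)
  qed
  have zero: "N w u v - \<i> * N w u (\<i> *s v) - \<i> * N w (\<i> *s u) v - N w (\<i> *s u) (\<i> *s v) = 0" for u v w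
  proof -
    have 0: "\<omega> c y [u, v] - \<i> * \<omega> c y [u, \<i> *s v] - \<i> * \<omega> c y [\<i> *s u, v] - \<omega> c y [\<i> *s u, \<i> *s v] = 0"
      if "y \<in> cdom c" for y
    proof -
      note t = type11_contract[OF omega_type11[OF c(1) that]]
      show ?thesis by (simp add: t(5) t(2,4) algebra_simps)
    qed
    have "((\<lambda>y. \<omega> c y [u, v] - \<i> * \<omega> c y [u, \<i> *s v] - \<i> * \<omega> c y [\<i> *s u, v] - \<omega> c y [\<i> *s u, \<i> *s v])
        has_derivative (\<lambda>w. N w u v - \<i> * N w u (\<i> *s v) - \<i> * N w (\<i> *s u) v - N w (\<i> *s u) (\<i> *s v))) (at z)"
      by (intro has_derivative_diff has_derivative_mult_right hd)
    then have "((\<lambda>y. 0) has_derivative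
        (\<lambda>w. N w u v - \<i> * N w u (\<i> *s v) - \<i> * N w (\<i> *s u) v - N w (\<i> *s u) (\<i> *s v))) (at z)"
      by (rule has_derivative_transform_within_open[OF _ open_cdom[OF c(1)] c(2) 0])
    from has_derivative_unique[OF this has_derivative_const] show ?thesis by metis
  qed
  show ?thesis
  proof (rule vec_eq_iff[THEN iffD2, rule_format])
    fix j
    have "4 * (wirt (\<lambda>y. low c y v) z u $ j - wirt (\<lambda>y. low c y u) z v $ j) = 0"
      unfolding w
      using closed[of u v "axis j 1"] closed[of u "\<i> *s v" "axis j 1"] closed[of "\<i> *s u" v "axis j 1"]
        closed[of "\<i> *s u" "\<i> *s v" "axis j 1"] zero[of "axis j 1" u v]
      by algebra
    then show "wirt (\<lambda>y. low c y v) z u $ j = wirt (\<lambda>y. low c y u) z v $ j" by simp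
  qed
qed

lemma christoffel_symmetric:
  "c \<in> charts X A \<Longrightarrow> z \<in> cdom c \<Longrightarrow> christoffel c z x u = christoffel c z u x"
  by (simp add: christoffel_def wirt_low_symmetric)

lemma clinear_christoffel_2:
  assumes c: "c \<in> charts X A" "z \<in> cdom c"
  shows "clinear (christoffel c z x)"
proof -
  have "christoffel c z x = (\<lambda>u. christoffel c z u x)" by (rule ext) (rule christoffel_symmetric[OF c])
  then show ?thesis using clinear_christoffel_1[OF c, of x] by simp
qed

end

section \<open>The Chern connection under coordinate changes\<close>

context kaehler
begin

lemma contract_transition:
  assumes \<eta>: "\<eta> \<in> forms X A 1 1" and c: "c \<in> charts X A" "d \<in> charts X A" and p: "p \<in> fst c" "p \<in> fst d"
  shows "contract u (\<eta> c (snd c p)) [w] =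
    contract (jac c d (snd c p) u) (\<eta> d (snd d p)) [jac c d (snd c p) w]"
proof -
  have m: "snd c p \<in> snd c ` (fst c \<inter> fst d)" using p by auto
  have "\<forall>z \<in> snd c ` (fst c \<inter> fst d). \<forall>vs. \<eta> c z vs = \<eta> d (transition c d z) (map (jac c d z) vs)"
    using \<eta> c unfolding forms_def by blast
  then have "\<eta> c (snd c p) vs = \<eta> d (snd d p) (map (jac c d (snd c p)) vs)" for vs
    using m transition_eq[OF c(1) p(1), of d] by metis
  then show ?thesis by (simp add: contract_def clinear_scale[OF clinear_jac[OF c p]])
qed

lemma
  assumes c: "c \<in> charts X A" "d \<in> charts X A" and p: "p \<in> fst c" "p \<in> fst d"
  shows differentiable_jac: "(\<lambda>z. jac c d z u) differentiable (at (snd c p))"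
    and has_derivative_jac: "((\<lambda>z. jac c d z u) has_derivative
      frechet_derivative (\<lambda>z. jac c d z u) (at (snd c p))) (at (snd c p))"
proof -
  have m: "snd c p \<in> snd c ` (fst c \<inter> fst d)" using p by auto
  note h = holomorphic_map_onD[OF holomorphic_jac[OF c] m, of u]
  show "((\<lambda>z. jac c d z u) has_derivative
      frechet_derivative (\<lambda>z. jac c d z u) (at (snd c p))) (at (snd c p))"
    by (rule h(1))
  show "(\<lambda>z. jac c d z u) differentiable (at (snd c p))" using h(1) by (auto simp: differentiable_def)
qed

text \<open>Differentiate \<open>g\<^sub>c(u,w) = g\<^sub>d(J u, J w)\<close> along a \<open>(1,0)\<close>-vector. The second argument enters antilinearly
  and so contributes nothing, as \<open>J\<close> is holomorphic; the first contributes the derivative of \<open>J\<close>.\<close>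

lemma christoffel_transition:
  assumes c: "c \<in> charts X A" "d \<in> charts X A" and p: "p \<in> fst c" "p \<in> fst d"
  shows "jac c d (snd c p) (christoffel c (snd c p) x u) =
    christoffel d (snd d p) (jac c d (snd c p) x) (jac c d (snd c p) u)
    + wirt (\<lambda>z. jac c d z u) (snd c p) x"
proof -
  define z where "z = snd c p"
  define S where "S = snd c ` (fst c \<inter> fst d)"
  define J where "J = jac c d"
  define T where "T = transition c d"
  have S: "open S" "z \<in> S" using open_overlap[OF c] p by (auto simp: S_def z_def)
  have zc: "z \<in> cdom c" "T z = snd d p" "snd d p \<in> cdom d"
    using p transition_eq[OF c(1) p(1)] by (auto simp: z_def T_def)
  have Jlin: "clinear (J y)" if "y \<in> S" for y
    using that clinear_jac[OF c] by (auto simp: S_def J_def)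
  have Tin: "T y \<in> cdom d" if y: "y \<in> S" for y
  proof -
    obtain q where "y = snd c q" "q \<in> fst c" "q \<in> fst d" using y by (auto simp: S_def)
    then show ?thesis by (simp add: T_def transition_eq[OF c(1)])
  qed
  have T: "(T has_derivative J z) (at z)"
    using has_derivative_transition[OF c p] by (simp add: T_def J_def z_def)
  have dJ: "(\<lambda>y. J y v) differentiable (at z)" for v
    using differentiable_jac[OF c p] by (simp add: J_def z_def)
  \<comment> \<open>Pulling the lowered index back along \<open>J\<close> is the antiholomorphic factor.\<close>
  define K where "K y v = (\<chi> j. \<Sum>m\<in>UNIV. v $ m * cnj (J y (axis j 1) $ m))" for y and v :: "(complex, 'n) vec"
  have Klin: "clinear (K y)" for y
    by (rule clinearI) (simp_all add: K_def vec_eq_iff sum.distrib sum_distrib_left algebra_simps)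
  have low: "K y (low d (T y) (J y u)) = low c y u" if y: "y \<in> S" for y u
  proof -
    obtain q where q: "y = snd c q" "q \<in> fst c" "q \<in> fst d" using y by (auto simp: S_def)
    then have T': "T y = snd d q" by (simp add: T_def transition_eq[OF c(1)])
    show ?thesis
      using contract_transition[OF omega_forms c q(2,3), of u] contract_lower[OF omega_type11[OF c(2) imageI[OF q(3), of "snd d"]]]
      unfolding T' by (simp add: vec_eq_iff K_def lower_def[of "\<omega> c (snd c q)"] q(1) J_def)
  qed
  define H where "H v = frechet_derivative (\<lambda>y. J y v) (at z)" for v
  have H: "((\<lambda>y. J y v) has_derivative H v) (at z)" "clinear (H v)" for v
    using has_derivative_jac[OF c p, of v] holomorphic_map_onD(2)[OF holomorphic_jac[OF c], of "snd c p" v] p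
    by (auto simp: H_def J_def z_def)
  have Kd: "((\<lambda>y. K y v) has_derivative (\<lambda>h. \<chi> j. \<Sum>m\<in>UNIV. v $ m * cnj (H (axis j 1) h $ m))) (at z)" for v
    by (rule has_derivative_vecI)
       (auto simp: K_def intro!: has_derivative_sum has_derivative_mult_right H
          bounded_linear.has_derivative[OF bounded_linear_cnj] bounded_linear.has_derivative[OF bounded_linear_vec_nth])
  have K0: "wirt (\<lambda>y. K y v) z x = 0" for v
    by (rule wirt_antiholomorphic[OF Kd])
       (simp add: clinear_scale[OF H(2)] vec_eq_iff sum_distrib_left algebra_simps)
  have Kdiff: "(\<lambda>y. K y v) differentiable (at z)" for v using Kd by (auto simp: differentiable_def)
  have Tdiff: "(\<lambda>y. low d (T y) v) differentiable (at z)" for v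
    using has_derivative_compose[OF T, of "\<lambda>w. low d w v"] differentiable_low[OF c(2) zc(3), of v] zc(2)
    unfolding differentiable_def by fastforce
  have Wdiff: "(\<lambda>y. low d (T y) (J y u)) differentiable (at z)"
    by (rule differentiable_family[OF S clinear_low[OF c(2) Tin] Tdiff dJ])
  have "low c z (christoffel c z x u) = wirt (\<lambda>y. low c y u) z x"
    by (rule low_christoffel[OF c(1) zc(1)])
  also have "\<dots> = wirt (\<lambda>y. K y (low d (T y) (J y u))) z x"
    by (rule wirt_cong_open[OF S low[symmetric] differentiable_low[OF c(1) zc(1)]])
  also have "\<dots> = K z (wirt (\<lambda>y. low d (T y) (J y u)) z x)"
    by (subst wirt_family[OF S Klin Kdiff Wdiff]) (simp add: K0)
  also have "wirt (\<lambda>y. low d (T y) (J y u)) z x =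
      wirt (\<lambda>y. low d (T y) (J z u)) z x + low d (T z) (wirt (\<lambda>y. J y u) z x)"
    by (rule wirt_family[OF S clinear_low[OF c(2) Tin] Tdiff dJ])
  also have "wirt (\<lambda>y. low d (T y) (J z u)) z x = wirt (\<lambda>w. low d w (J z u)) (T z) (J z x)"
    by (rule wirt_chain[OF T clinear_scale[OF Jlin[OF S(2)]]])
       (use differentiable_low[OF c(2) zc(3)] zc(2) in simp)
  also have "\<dots> = low d (T z) (christoffel d (T z) (J z x) (J z u))"
    using low_christoffel[OF c(2) zc(3)] zc(2) by simp
  also have "\<dots> + low d (T z) (wirt (\<lambda>y. J y u) z x) =
      low d (T z) (christoffel d (T z) (J z x) (J z u) + wirt (\<lambda>y. J y u) z x)" (is "_ = low d _ ?G")
    using clinear_low[OF c(2) zc(3)] zc(2) by (simp add: clinear_add)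
  also have "?G = J z (jac d c (snd d p) ?G)"
    using jac_inverse[OF c(2,1) p(2,1)] by (simp add: J_def z_def)
  also have "K z (low d (T z) (J z (jac d c (snd d p) ?G))) = low c z (jac d c (snd d p) ?G)"
    by (rule low[OF S(2)])
  finally have "christoffel c z x u = jac d c (snd d p) ?G"
    by (simp only: low_eq_iff[OF c(1) zc(1)])
  then have "J z (christoffel c z x u) = ?G"
    using jac_inverse[OF c(2,1) p(2,1)] by (simp add: J_def z_def)
  then show ?thesis by (simp add: J_def z_def[symmetric] zc)
qed

end

section \<open>Existence of normal charts\<close>

text \<open>The derivative vanishes at \<open>0\<close> and is itself differentiable there, so it is bounded by a multiple of
  \<open>norm z\<close>; apply the mean value inequality.\<close>

lemma bigo_norm_square:
  fixes f :: "'a::euclidean_space \<Rightarrow> complex"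
  assumes S: "open S" "0 \<in> S" and f: "Ck_on 2 S f" and f0: "f 0 = 0"
    and D0: "\<And>h. frechet_derivative f (at 0) h = 0"
  shows "f \<in> O[nhds 0](\<lambda>z. of_real ((norm z)\<^sup>2))"
proof -
  define D where "D z = frechet_derivative f (at z)" for z
  have fd: "(f has_derivative D z) (at z)" if "z \<in> S" for z
    using f that by (auto simp: numeral_2_eq_2 D_def frechet_derivative_works)
  have "\<exists>C d. d > 0 \<and> (\<forall>z. norm z < d \<longrightarrow> norm (D z b) \<le> C * norm z)" for b
  proof -
    have "(\<lambda>z. D z b) differentiable (at 0)"
      using f S by (auto simp: numeral_2_eq_2 D_def)
    then obtain E where E: "((\<lambda>z. D z b) has_derivative E) (at 0)" by (auto simp: differentiable_def)
    then obtain d where d: "d > 0" "\<And>y. norm y < d \<Longrightarrow> norm (D y b - E y) \<le> norm y"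
      using D0 unfolding has_derivative_at_alt D_def by (metis diff_zero mult_1 zero_less_one)
    obtain K where K: "\<And>h. norm (E h) \<le> norm h * K"
      using bounded_linear.bounded[OF has_derivative_bounded_linear[OF E]] by blast
    have "norm (D z b) \<le> (1 + K) * norm z" if "norm z < d" for z
      using d(2)[OF that] K[of z] norm_triangle_sub[of "D z b" "E z"] by (simp add: algebra_simps)
    then show ?thesis using d(1) by blast
  qed
  then obtain C d where Cd: "\<And>b. d b > (0::real)" "\<And>b z. norm z < d b \<Longrightarrow> norm (D z b) \<le> C b * norm z" by metis
  obtain r where r: "r > 0" "ball 0 r \<subseteq> S" using S open_contains_ball by blast
  define R where "R = Min (insert r (d ` Basis))"
  have R: "R > 0" "R \<le> r" "\<And>b. b \<in> Basis \<Longrightarrow> R \<le> d b"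
    using r Cd by (auto simp: R_def intro!: Min_le simp del: Min_insert)
  define B where "B = (\<Sum>b\<in>Basis. \<bar>C b\<bar>)"
  have B: "norm (D z h) \<le> B * norm z * norm h" if z: "norm z < R" for z h
  proof -
    have "z \<in> S" using z R r by auto
    have lin: "linear (D z)" by (rule has_derivative_linear[OF fd[OF \<open>z \<in> S\<close>]])
    have "D z h = (\<Sum>b\<in>Basis. (h \<bullet> b) *\<^sub>R D z b)"
      by (subst euclidean_representation[of h, symmetric]) (simp only: linear_sum[OF lin] linear_cmul[OF lin])
    also have "norm \<dots> \<le> (\<Sum>b\<in>Basis. norm h * (\<bar>C b\<bar> * norm z))"
    proof (rule sum_norm_le)
      fix b :: 'a assume b: "b \<in> Basis"
      have "norm (D z b) \<le> C b * norm z" using Cd(2)[of z b] R(3)[OF b] z by simp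
      also have "\<dots> \<le> \<bar>C b\<bar> * norm z" by (simp add: mult_right_mono)
      finally show "norm ((h \<bullet> b) *\<^sub>R D z b) \<le> norm h * (\<bar>C b\<bar> * norm z)"
        using Basis_le_norm[OF b, of h] by (simp add: mult_mono)
    qed
    finally show ?thesis by (simp add: B_def sum_distrib_left sum_distrib_right mult_ac)
  qed
  have "norm (f z) \<le> B * norm ((norm z)\<^sup>2)" if z: "norm z < R" for z
  proof -
    have "norm (f z - f 0) \<le> (B * norm z) * norm (z - 0)"
    proof (rule differentiable_bound[of "cball 0 (norm z)" f D])
      fix x :: 'a assume x: "x \<in> cball 0 (norm z)"
      then have "x \<in> S" "norm x < R" using z R r by auto
      show "(f has_derivative D x) (at x within cball 0 (norm z))"
        by (rule has_derivative_at_withinI[OF fd[OF \<open>x \<in> S\<close>]])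
      show "onorm (D x) \<le> B * norm z"
      proof (rule onorm_bound)
        have B0: "B \<ge> 0" by (auto simp: B_def intro: sum_nonneg)
        then show "0 \<le> B * norm z" by simp
        show "norm (D x h) \<le> B * norm z * norm h" for h
        proof -
          have "norm (D x h) \<le> B * norm x * norm h" by (rule B[OF \<open>norm x < R\<close>])
          also have "\<dots> \<le> B * norm z * norm h"
            using x B0 by (intro mult_right_mono mult_left_mono) auto
          finally show ?thesis .
        qed
      qed
    qed auto
    then show ?thesis by (simp add: f0 power2_eq_square mult.assoc)
  qed
  then have "eventually (\<lambda>z. norm (f z) \<le> B * norm (complex_of_real ((norm z)\<^sup>2))) (nhds 0)"
    unfolding eventually_nhds_metric using R(1) by (intro exI[of _ R]) (auto simp: dist_norm norm_power)
  then show ?thesis by (rule bigoI)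
qed

text \<open>Gram-Schmidt: a frame of fewer than \<open>n\<close> vectors has a nonzero orthogonal vector.\<close>

lemma exists_unitary_frame:
  fixes G :: "complex^'n::finite \<Rightarrow> complex^'n \<Rightarrow> complex"
  assumes add: "\<And>u v w. G (u + v) w = G u w + G v w" and scale: "\<And>c u w. G (c *s u) w = c * G u w"
    and herm: "\<And>u w. G u w = cnj (G w u)" and pos: "\<And>u. u \<noteq> 0 \<Longrightarrow> \<exists>r>0. G u u = of_real r"
  shows "\<exists>e :: 'n \<Rightarrow> complex^'n. \<forall>i j. G (e i) (e j) = (if i = j then 1 else 0)"
proof -
  have expand: "G v w = (\<Sum>m\<in>UNIV. v $ m * G (axis m 1) w)" for v w
  proof -
    have G0: "G 0 w = 0" using scale[of 0 0 w] by simp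
    have "G (\<Sum>m\<in>M. v $ m *s axis m 1) w = (\<Sum>m\<in>M. v $ m * G (axis m 1) w)" for M
      by (induction M rule: infinite_finite_induct) (simp_all add: add scale G0)
    from this[of UNIV] show ?thesis by (simp only: vec_expand[symmetric])
  qed
  have scale2: "G u (c *s w) = cnj c * G u w" for c u w
    using herm[of u "c *s w"] scale[of c w u] herm[of u w] by simp
  have "\<exists>e. \<forall>i\<in>I. \<forall>j\<in>I. G (e i) (e j) = (if i = j then 1 else 0)" if "finite I" for I :: "'n set"
    using that
  proof (induction I)
    case (insert k I)
    then obtain e where e: "\<And>i j. i \<in> I \<Longrightarrow> j \<in> I \<Longrightarrow> G (e i) (e j) = (if i = j then 1 else 0)" by blast
    \<comment> \<open>The orthogonality conditions, padded with zero rows to a square singular matrix.\<close>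
    define R where "R = (\<chi> i m. if i \<in> I then G (axis m 1) (e i) else 0)"
    have "row k R = 0" using insert(2) by (simp add: row_def R_def vec_eq_iff)
    then have "det R = 0" by (rule det_zero_row)
    then have "\<nexists>B. B ** R = mat 1" using invertible_left_inverse invertible_det_nz by metis
    then obtain v where v: "v \<noteq> 0" "R *v v = 0" using matrix_left_invertible_ker by blast
    have Gv: "G v (e i) = 0" if "i \<in> I" for i
      using arg_cong[OF v(2), of "\<lambda>x. x $ i"] that expand[of v "e i"]
      by (simp add: matrix_vector_mult_def R_def mult.commute)
    then have Gv': "G (e i) v = 0" if "i \<in> I" for i using that herm[of "e i" v] by simp
    obtain r where r: "r > 0" "G v v = of_real r" using pos[OF v(1)] by blast
    define e' where "e' = e(k := (1 / of_real (sqrt r)) *s v)"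
    have s: "(1 / complex_of_real (sqrt r)) * ((1 / of_real (sqrt r)) * of_real r) = 1"
      using r(1) by (simp add: field_simps flip: of_real_mult)
    have "\<forall>i\<in>insert k I. \<forall>j\<in>insert k I. G (e' i) (e' j) = (if i = j then 1 else 0)"
      using e insert(2) s Gv Gv' by (auto simp: e'_def scale scale2 r(2))
    then show ?case by blast
  qed auto
  from this[of UNIV, OF finite] obtain e
    where "\<forall>i\<in>(UNIV :: 'n set). \<forall>j\<in>UNIV. G (e i) (e j) = (if i = j then 1 else 0)" by blast
  then show ?thesis by (intro exI[of _ e]) blast
qed

context complex_manifold
begin

text \<open>The inverse function theorem makes a local biholomorphism \<open>T\<close> of \<open>\<complex>\<^sup>n\<close> the transition map from a new
  chart to a given one.\<close>

lemma reparametrised_chart: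
  assumes d: "d \<in> charts X A" and P: "P \<in> fst d"
    and T: "\<And>z. (T has_derivative D z) (at z)" and D: "\<And>z. clinear (D z)"
    and cont: "\<And>v. continuous_on UNIV (\<lambda>z. D z v)"
    and T0: "T 0 = snd d P" and inj: "\<And>v. D 0 v = 0 \<Longrightarrow> v = 0"
  shows "\<exists>c\<in>charts X A. P \<in> fst c \<and> fst c \<subseteq> fst d \<and> snd c P = 0 \<and> (\<forall>z\<in>cdom c. transition c d z = T z)"
proof -
  define f' where "f' z = Blinfun (D z)" for z
  have f': "blinfun_apply (f' z) = D z" for z
    unfolding f'_def by (rule bounded_linear_Blinfun_apply[OF clinear_imp_bounded_linear[OF D]])
  have contf': "continuous_on S f'" for S
    by (rule continuous_on_blinfun_componentwise) (auto simp: f' intro: continuous_on_subset[OF cont])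
  have lin0: "linear (D 0)" by (rule clinear_imp_linear[OF D])
  obtain L where L: "linear L" "\<And>v. L (D 0 v) = v"
    using linear_injective_left_inverse[OF lin0] linear_injective_0[OF lin0] inj
    by (metis comp_apply id_apply)
  define invf where "invf = Blinfun L"
  have invf: "blinfun_apply invf = L"
    unfolding invf_def using L(1) by (intro bounded_linear_Blinfun_apply) (simp add: linear_conv_bounded_linear)
  have id: "invf o\<^sub>L f' 0 = id_blinfun"
    by (rule blinfun_eqI) (simp add: invf f' L)
  have contT: "continuous_on UNIV T"
    using T by (auto intro!: continuous_at_imp_continuous_on has_derivative_continuous)
  have U: "open (T -` cdom d)"
    by (rule open_vimage[OF open_cdom[OF d] contT])
  have U0: "0 \<in> T -` cdom d" using T0 P by auto
  have Tf': "(T has_derivative blinfun_apply (f' z)) (at z)" for z using T f' by simp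
  obtain U' V g g' where UV: "open U'" "U' \<subseteq> T -` cdom d" "0 \<in> U'" "open V" "T 0 \<in> V"
      "homeomorphism U' V T g"
    and g: "\<And>y. y \<in> V \<Longrightarrow> (g has_derivative (g' y)) (at y)"
      "\<And>y. y \<in> V \<Longrightarrow> g' y = inv (blinfun_apply (f' (g y)))" "\<And>y. y \<in> V \<Longrightarrow> bij (blinfun_apply (f' (g y)))"
    by (rule inverse_function_theorem[OF U Tf' contf' U0 id]) (rule that)
  have TV: "T ` U' = V" "g ` V = U'" "\<And>z. z \<in> U' \<Longrightarrow> g (T z) = z" "\<And>y. y \<in> V \<Longrightarrow> T (g y) = y"
    using UV(6) by (auto simp: homeomorphism_def)
  have Vd: "V \<subseteq> cdom d" using UV(2) TV(1) by auto
  have ghol: "g' y (t *s v) = t *s g' y v" if "y \<in> V" for y t v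
  proof -
    have b: "bij (D (g y))" and gi: "g' y = inv (D (g y))" using g(2,3)[OF that] by (auto simp: f')
    have "D (g y) (t *s g' y v) = t *s v"
      by (simp add: clinear_scale[OF D] gi surj_f_inv_f[OF bij_is_surj[OF b]])
    then show ?thesis unfolding gi by (metis b bij_inv_eq_iff gi)
  qed
  \<comment> \<open>The inverse of a complex-linear derivative is complex-linear, so \<open>g\<close> is holomorphic and \<open>c\<close> is
    compatible with the atlas.\<close>
  define c where "c = ({p \<in> fst d. snd d p \<in> V}, \<lambda>p. g (snd d p))"
  have cp: "p \<in> fst c \<longleftrightarrow> p \<in> fst d \<and> snd d p \<in> V" "snd c p = g (snd d p)" for p
    by (auto simp: c_def)
  have img_d: "snd d ` fst c = V"
  proof (intro equalityI subsetI)
    fix y assume y: "y \<in> V"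
    then obtain p where "p \<in> fst d" "y = snd d p" using Vd by auto
    then show "y \<in> snd d ` fst c" using y cp(1)[of p] by auto
  qed (auto simp: cp(1))
  have img: "cdom c = U'"
    using img_d TV(2) by (simp add: cp(2) flip: image_image[of g "snd d"])
  note chd = chartsD[OF d, unfolded is_chart_def]
  have top_d: "topspace (subtopology X (fst d)) = fst d"
    using openin_subset[OF openin_chart[OF d]] by auto
  have openc: "openin X (fst c)"
  proof -
    have "openin (top_of_set (cdom d)) V" using UV(4) Vd unfolding openin_open by blast
    then have "openin (subtopology X (fst d)) {p \<in> topspace (subtopology X (fst d)). snd d p \<in> V}"
      using openin_continuous_map_preimage[OF homeomorphic_imp_continuous_map] chd by blast
    then have "openin X {p \<in> topspace (subtopology X (fst d)). snd d p \<in> V}"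
      using openin_trans_full openin_chart[OF d] by blast
    then show ?thesis unfolding top_d by (simp add: c_def)
  qed
  have "homeomorphic_map (subtopology (subtopology X (fst d)) (fst c)) (subtopology (top_of_set (cdom d)) V) (snd d)"
    by (rule homeomorphic_map_subtopologies)
       (use chd img_d Vd top_d in \<open>auto simp: cp(1) Int_absorb1 subset_iff\<close>)
  moreover have "fst d \<inter> fst c = fst c" "cdom d \<inter> V = V" using Vd by (auto simp: cp(1))
  ultimately have "homeomorphic_map (subtopology X (fst c)) (top_of_set V) (snd d)"
    by (simp add: subtopology_subtopology)
  moreover have "homeomorphic_map (top_of_set V) (top_of_set U') g"
    unfolding homeomorphic_map_maps homeomorphic_maps_def
    using UV(6) by (intro exI[of _ T]) (auto simp: homeomorphism_def)
  ultimately have "homeomorphic_map (subtopology X (fst c)) (top_of_set U') (g \<circ> snd d)"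
    by (rule homeomorphic_map_compose)
  moreover have "snd c = g \<circ> snd d" by (auto simp: cp(2))
  ultimately have ch: "is_chart X c"
    unfolding is_chart_def img using openc UV(1) by simp
  have tr: "transition c e (snd c p) = snd e p" if "p \<in> fst c" for e p
    by (rule transition_chart[OF ch that])
  have Tc: "T (snd c p) = snd d p" if "p \<in> fst c" for p using that TV(4) by (simp add: cp)
  have comp: "compatible c e" if e: "e \<in> A" for e
    unfolding compatible_def
  proof
    have e': "e \<in> charts X A" using e atlas_subset_charts by auto
    note he = holomorphic_transition[OF d e'] holomorphic_transition[OF e' d]
    show "holomorphic_map_on (snd c ` (fst c \<inter> fst e)) (transition c e)"
      unfolding holomorphic_map_on_def
    proof
      fix z assume z: "z \<in> snd c ` (fst c \<inter> fst e)"
      then obtain p where p: "z = snd c p" "p \<in> fst c" "p \<in> fst e" by auto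
      then have "T z \<in> snd d ` (fst d \<inter> fst e)" using Tc by (auto simp: cp(1))
      then obtain E where E: "(transition d e has_derivative E) (at (T z))" "\<And>t v. E (t *s v) = t *s E v"
        using he(1) unfolding holomorphic_map_on_def by blast
      have "((\<lambda>y. transition d e (T y)) has_derivative (\<lambda>v. E (D z v))) (at z)"
        by (rule has_derivative_compose[OF T E(1)])
      then have "(transition c e has_derivative (\<lambda>v. E (D z v))) (at z)"
      proof (rule has_derivative_transform_within_open[OF _ chart_open_image[OF ch openin_chart[OF e']] z])
        fix y assume "y \<in> snd c ` (fst c \<inter> fst e)"
        then obtain q where q: "y = snd c q" "q \<in> fst c" "q \<in> fst e" by auto
        then have "q \<in> fst d" by (simp add: cp(1))
        then show "transition d e (T y) = transition c e y"
          using q by (simp only: tr Tc transition_eq[OF d])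
      qed
      then show "\<exists>D. (transition c e has_derivative D) (at z) \<and> (\<forall>t v. D (t *s v) = t *s D v)"
        by (intro exI[of _ "\<lambda>v. E (D z v)"]) (simp add: E clinear_scale[OF D])
    qed
    show "holomorphic_map_on (snd e ` (fst c \<inter> fst e)) (transition e c)"
      unfolding holomorphic_map_on_def
    proof
      fix z assume z: "z \<in> snd e ` (fst c \<inter> fst e)"
      then obtain p where p: "z = snd e p" "p \<in> fst c" "p \<in> fst e" by auto
      then have "z \<in> snd e ` (fst e \<inter> fst d)" by (auto simp: cp(1))
      then obtain E where E: "(transition e d has_derivative E) (at z)" "\<And>t v. E (t *s v) = t *s E v"
        using he(2) unfolding holomorphic_map_on_def by blast
      have V: "transition e d z \<in> V" using p by (simp add: transition_eq e' cp(1))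
      have z': "z \<in> snd e ` (fst e \<inter> fst c)" using z by (simp add: Int_commute)
      have "((\<lambda>y. g (transition e d y)) has_derivative (\<lambda>v. g' (transition e d z) (E v))) (at z)"
        by (rule has_derivative_compose[OF E(1) g(1)[OF V]])
      then have "(transition e c has_derivative (\<lambda>v. g' (transition e d z) (E v))) (at z)"
        by (rule has_derivative_transform_within_open[OF _ chart_open_image[OF chartsD[OF e'] openc] z'])
           (use e' in \<open>auto simp: transition_eq cp(2)\<close>)
      then show "\<exists>D. (transition e c has_derivative D) (at z) \<and> (\<forall>t v. D (t *s v) = t *s D v)"
        by (intro exI[of _ "\<lambda>v. g' (transition e d z) (E v)"]) (simp add: E ghol[OF V])
    qed
  qed
  have c: "c \<in> charts X A" using ch comp by (simp add: charts_def)
  show ?thesis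
  proof (intro bexI[OF _ c] conjI ballI)
    show "P \<in> fst c" using P UV(5) T0 by (simp add: cp(1))
    show "fst c \<subseteq> fst d" by (auto simp: cp(1))
    show "snd c P = 0" using TV(3)[OF UV(3)] T0 by (simp add: cp(2))
    fix z assume "z \<in> cdom c"
    then obtain p where "z = snd c p" "p \<in> fst c" by auto
    then show "transition c d z = T z" by (simp only: tr Tc)
  qed
qed

end

lemma flat_form_2: "flat_form [u, w] = \<i> / 2 * (\<Sum>i\<in>UNIV. u $ i * cnj (w $ i) - w $ i * cnj (u $ i))"
  unfolding flat_form_def wedge_1_1 dz_1 dzbar_1 ..

lemma flat_form_length: "length vs \<noteq> 2 \<Longrightarrow> flat_form vs = 0"
  by (simp add: flat_form_def wedge_length)

context kaehler
begin

text \<open>The derivative of \<open>g(u,w)\<close> vanishes in the \<open>(1,0)\<close>-directions by assumption, and in the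
  \<open>(0,1)\<close>-directions because \<open>g(w,u)\<close> is its conjugate up to a sign.\<close>

lemma omega_derivative_zero:
  assumes c: "c \<in> charts X A" "z \<in> cdom c" and w0: "\<And>u x. wirt (\<lambda>y. low c y u) z x = 0"
  shows "frechet_derivative (\<lambda>y. \<omega> c y vs) (at z) x = 0"
proof (cases "length vs = 2")
  case True
  then obtain u w where vs: "vs = [u, w]" by (auto simp: length_Suc_conv numeral_2_eq_2)
  define f where "f u w y = contract u (\<omega> c y) [w]" for u w y
  have fd: "f u w differentiable (at z)" for u w
    unfolding f_def contract_def
    by (rule smooth_on_imp_differentiable[OF _ c(2)])
       (simp only: f_def contract_def divide_inverse,
        intro smooth_on_mult smooth_on_diff smooth_on_const open_cdom omega_smooth c)
  define E where "E u w = frechet_derivative (f u w) (at z)" for u w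
  have E: "(f u w has_derivative E u w) (at z)" for u w
    using fd by (simp add: E_def frechet_derivative_works)
  have holo: "E u w x = \<i> * E u w (\<i> *s x)" for u w x
  proof -
    have f_low: "(\<Sum>j\<in>UNIV. low c y u $ j * cnj (w $ j)) = f u w y" if "y \<in> cdom c" for y
      using contract_lower[OF omega_type11[OF c(1) that]] by (simp add: f_def)
    define F where "F = frechet_derivative (\<lambda>y. low c y u) (at z)"
    have F: "((\<lambda>y. low c y u) has_derivative F) (at z)"
      using differentiable_low[OF c, of u] by (simp add: F_def frechet_derivative_works)
    have "((\<lambda>y. \<Sum>j\<in>UNIV. low c y u $ j * cnj (w $ j)) has_derivative (\<lambda>x. \<Sum>j\<in>UNIV. F x $ j * cnj (w $ j))) (at z)"
      by (intro has_derivative_sum has_derivative_mult_left bounded_linear.has_derivative[OF bounded_linear_vec_nth] F)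
    then have "(f u w has_derivative (\<lambda>x. \<Sum>j\<in>UNIV. F x $ j * cnj (w $ j))) (at z)"
      by (rule has_derivative_transform_within_open[OF _ open_cdom[OF c(1)] c(2) f_low])
    then have Eq: "E u w x = (\<Sum>j\<in>UNIV. F x $ j * cnj (w $ j))" for x
      by (rule fun_cong[OF has_derivative_unique[OF E]])
    have "F x $ j = \<i> * F (\<i> *s x) $ j" for j
      using arg_cong[OF w0[of u x], of "\<lambda>v. 2 * v $ j"] by (simp add: wirt_def F_def)
    then show ?thesis unfolding Eq by (simp add: sum_distrib_left mult.assoc)
  qed
  have herm: "E u w x = - cnj (E w u x)" for u w x
  proof -
    have "((\<lambda>y. - cnj (f w u y)) has_derivative (\<lambda>x. - cnj (E w u x))) (at z)"
      by (intro has_derivative_minus bounded_linear.has_derivative[OF bounded_linear_cnj] E)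
    then have "(f u w has_derivative (\<lambda>x. - cnj (E w u x))) (at z)"
      by (rule has_derivative_transform_within_open[OF _ open_cdom[OF c(1)] c(2)])
         (simp add: f_def metric_hermitian[OF c(1), of _ w u])
    then show ?thesis by (rule fun_cong[OF has_derivative_unique[OF E]])
  qed
  have E0: "E u w x = 0" for u w x
  proof -
    have "E u w x = - cnj (\<i> * E w u (\<i> *s x))" using herm[of u w x] holo[of w u x] by simp
    also have "\<dots> = - (\<i> * E u w (\<i> *s x))" using herm[of u w "\<i> *s x"] by simp
    finally show ?thesis using holo[of u w x] by simp
  qed
  have eq: "f u w y - f w u y = \<omega> c y vs" if "y \<in> cdom c" for y
    using type11_contract(5)[OF omega_type11[OF c(1) that], of u w] by (simp add: f_def vs)
  have "((\<lambda>y. f u w y - f w u y) has_derivative (\<lambda>x. E u w x - E w u x)) (at z)"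
    by (intro has_derivative_diff E)
  then have "((\<lambda>y. \<omega> c y vs) has_derivative (\<lambda>x. E u w x - E w u x)) (at z)"
    by (rule has_derivative_transform_within_open[OF _ open_cdom[OF c(1)] c(2) eq])
  from fun_cong[OF frechet_derivative_at[OF this], of x] show ?thesis by (simp add: E0)
next
  case False
  have eq: "0 = \<omega> c y vs" if "y \<in> cdom c" for y
    using type11_contract(7)[OF omega_type11[OF c(1) that] False] by simp
  have "((\<lambda>y. \<omega> c y vs) has_derivative (\<lambda>x. 0)) (at z)"
    by (rule has_derivative_transform_within_open[OF has_derivative_const open_cdom[OF c(1)] c(2) eq])
  from fun_cong[OF frechet_derivative_at[OF this], of x] show ?thesis by simp
qed

lemma normal_chartI:
  assumes c: "c \<in> charts X A" "P \<in> fst c" "snd c P = 0"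
    and h: "\<And>u w. contract u (\<omega> c 0) [w] = \<i> / 2 * (\<Sum>i\<in>UNIV. u $ i * cnj (w $ i))"
    and \<Gamma>: "\<And>x u. christoffel c 0 x u = 0"
  shows "normal_chart X A \<omega> P c"
  unfolding normal_chart_def
proof (intro conjI allI c)
  fix vs
  have 0: "0 \<in> cdom c" using c by force
  have "wirt (\<lambda>y. low c y u) 0 x = 0" for u x
    using low_christoffel[OF c(1) 0, of x u] \<Gamma> clinear_zero[OF clinear_low[OF c(1) 0]] by simp
  then have D0: "frechet_derivative (\<lambda>y. \<omega> c y vs) (at 0) x = 0" for x
    by (rule omega_derivative_zero[OF c(1) 0])
  have val: "\<omega> c 0 vs = flat_form vs"
  proof (cases "length vs = 2")
    case True
    then obtain u w where vs: "vs = [u, w]" by (auto simp: length_Suc_conv numeral_2_eq_2)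
    show ?thesis
      unfolding vs type11_contract(5)[OF omega_type11[OF c(1) 0]] h flat_form_2
      by (simp add: sum_subtractf right_diff_distrib)
  next
    case False
    then show ?thesis by (simp add: flat_form_length type11_contract(7)[OF omega_type11[OF c(1) 0]])
  qed
  have sm: "smooth_on (cdom c) (\<lambda>z. \<omega> c z vs - flat_form vs)"
    by (intro smooth_on_diff open_cdom c omega_smooth smooth_on_const)
  have "frechet_derivative (\<lambda>z. \<omega> c z vs - flat_form vs) (at 0) x = 0" for x
  proof -
    have "((\<lambda>z. \<omega> c z vs - flat_form vs) has_derivative (\<lambda>x. frechet_derivative (\<lambda>z. \<omega> c z vs) (at 0) x - 0)) (at 0)"
      using smooth_on_imp_differentiable[OF omega_smooth[OF c(1)] 0]
      by (intro has_derivative_diff has_derivative_const) (simp flip: frechet_derivative_works)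
    from fun_cong[OF frechet_derivative_at[OF this], of x] show ?thesis by (simp add: D0)
  qed
  then show "(\<lambda>z. \<omega> c z vs - flat_form vs) \<in> O[nhds 0](\<lambda>z. of_real ((norm z)\<^sup>2))"
    using sm val by (intro bigo_norm_square[OF open_cdom[OF c(1)] 0]) (auto simp: smooth_on_def)
qed

text \<open>A unitary frame \<open>M\<close> makes the metric standard at the centre. The transition map
  \<open>T z = w + M z - \<Gamma>(M z, M z) / 2\<close> has Jacobian \<open>M u - \<Gamma>(M z, M u)\<close> by the symmetry of \<open>\<Gamma>\<close>, and the derivative
  of the Jacobian cancels \<open>\<Gamma>\<close> in the transformation law of the Christoffel symbols.\<close>

lemma exists_normal_chart:
  assumes "P \<in> topspace X"
  shows "\<exists>c. normal_chart X A \<omega> P c"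
proof -
  obtain d where "d \<in> A" and P: "P \<in> fst d"
    using atlas assms unfolding complex_atlas_def by blast
  then have d: "d \<in> charts X A" using atlas_subset_charts by auto
  define w where "w = snd d P"
  have w: "w \<in> cdom d" using P by (simp add: w_def)
  note t = type11_contract[OF omega_type11[OF d w]]
  \<comment> \<open>The contraction with \<open>\<omega>\<close> is \<open>\<i>/2\<close> times the Hermitian metric.\<close>
  have "\<exists>e :: 'n \<Rightarrow> (complex, 'n) vec. \<forall>i j. - 2 * \<i> * contract (e i) (\<omega> d w) [e j] = (if i = j then 1 else 0)"
  proof (rule exists_unitary_frame)
    show "\<exists>r>0. - 2 * \<i> * contract u (\<omega> d w) [u] = complex_of_real r" if u: "u \<noteq> 0" for u
    proof -
      obtain r where "r > 0" "contract u (\<omega> d w) [u] = \<i> * of_real r" using metric_positive[OF d w u] by blast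
      then show ?thesis by (intro exI[of _ "2 * r"]) simp
    qed
    show "- 2 * \<i> * contract u (\<omega> d w) [v] = cnj (- 2 * \<i> * contract v (\<omega> d w) [u])" for u v
      using metric_hermitian[OF d w, of u v] by simp
  qed (simp_all add: t(1,2) algebra_simps)
  then obtain e :: "'n \<Rightarrow> (complex, 'n) vec"
    where e: "\<And>i j. - 2 * \<i> * contract (e i) (\<omega> d w) [e j] = (if i = j then 1 else 0)" by blast
  have he: "contract (e i) (\<omega> d w) [e j] = (if i = j then \<i> / 2 else 0)" for i j
  proof -
    have "\<i> / 2 * (- 2 * \<i> * contract (e i) (\<omega> d w) [e j]) = contract (e i) (\<omega> d w) [e j]" by simp
    then show ?thesis unfolding e by (cases "i = j") auto
  qed
  define M where "M v = (\<Sum>i\<in>UNIV. v $ i *s e i)" for v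
  have M: "clinear M"
    by (rule clinearI) (simp_all add: M_def vec_eq_iff sum.distrib sum_distrib_left algebra_simps)
  have hM: "contract (M u) (\<omega> d w) [M v] = \<i> / 2 * (\<Sum>i\<in>UNIV. u $ i * cnj (v $ i))" for u v
  proof -
    have z: "contract 0 (\<omega> d w) [x] = 0" "contract x (\<omega> d w) [0] = 0" for x
      using t(2)[of 0 0 x] t(4)[of x 0 0] by simp_all
    have 1: "contract (\<Sum>i\<in>I. u $ i *s e i) (\<omega> d w) [x] = (\<Sum>i\<in>I. u $ i * contract (e i) (\<omega> d w) [x])" for I x
      by (induction I rule: infinite_finite_induct) (simp_all add: z t(1,2))
    have 2: "contract x (\<omega> d w) [\<Sum>i\<in>I. v $ i *s e i] = (\<Sum>i\<in>I. cnj (v $ i) * contract x (\<omega> d w) [e i])" for I x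
      by (induction I rule: infinite_finite_induct) (simp_all add: z t(3,4))
    show ?thesis
      unfolding M_def 1 2 he by (simp add: if_distrib sum_distrib_left mult_ac cong: if_cong)
  qed
  have Minj: "v = 0" if "M v = 0" for v
  proof (rule ccontr)
    assume "v \<noteq> 0"
    then obtain i where i: "v $ i \<noteq> 0" by (auto simp: vec_eq_iff)
    have "(\<Sum>i\<in>UNIV. v $ i * cnj (v $ i)) = 0"
      using hM[of v v] t(2)[of 0 0 0] that by simp
    then have "complex_of_real (\<Sum>i\<in>UNIV. (cmod (v $ i))\<^sup>2) = 0"
      by (simp only: of_real_sum complex_norm_square)
    then have "(\<Sum>i\<in>UNIV. (cmod (v $ i))\<^sup>2) = 0" by (simp only: of_real_eq_0_iff)
    then show False using i by (simp add: sum_nonneg_eq_0_iff)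
  qed
  define \<Gamma> where "\<Gamma> = christoffel d w"
  have \<Gamma>1: "clinear (\<lambda>x. \<Gamma> x u)" and \<Gamma>2: "clinear (\<Gamma> x)" and \<Gamma>s: "\<Gamma> x u = \<Gamma> u x" for x u
    unfolding \<Gamma>_def
    by (rule clinear_christoffel_1[OF d w] clinear_christoffel_2[OF d w] christoffel_symmetric[OF d w])+
  define T where "T z = w + (M z - (1/2) *s \<Gamma> (M z) (M z))" for z
  define D where "D z v = M v - \<Gamma> (M z) (M v)" for z v
  have MD: "(M has_derivative M) (at z)" for z
    by (rule bounded_linear_imp_has_derivative[OF clinear_imp_bounded_linear[OF M]])
  have \<Gamma>M: "((\<lambda>z. \<Gamma> (M z) u) has_derivative (\<lambda>v. \<Gamma> (M v) u)) (at z)" for z u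
    by (rule bounded_linear.has_derivative[OF clinear_imp_bounded_linear[OF \<Gamma>1] MD])
  have T: "(T has_derivative D z) (at z)" for z
  proof -
    have "((\<lambda>z. \<Gamma> (M z) (M z)) has_derivative (\<lambda>v. \<Gamma> (M v) (M z) + \<Gamma> (M z) (M v))) (at z)"
      by (rule has_derivative_family[OF open_UNIV UNIV_I clinear_imp_linear[OF \<Gamma>2] \<Gamma>M MD])
    then have "(T has_derivative (\<lambda>v. 0 + (M v - (1/2) *s (\<Gamma> (M v) (M z) + \<Gamma> (M z) (M v))))) (at z)"
      unfolding T_def
      by (intro has_derivative_add has_derivative_const has_derivative_diff MD
          bounded_linear.has_derivative[OF clinear_imp_bounded_linear[OF clinear_scaling]])
    then show ?thesis
      by (rule has_derivative_eq_rhs) (auto simp: D_def \<Gamma>s[of _ "M z"] vec_eq_iff)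
  qed
  have Dlin: "clinear (D z)" for z
    by (rule clinearI)
       (simp_all add: D_def clinear_add[OF M] clinear_scale[OF M] clinear_add[OF \<Gamma>2] clinear_scale[OF \<Gamma>2]
          vec_eq_iff algebra_simps)
  have D0: "D 0 v = M v" for v by (simp add: D_def clinear_zero[OF M] clinear_zero[OF \<Gamma>1])
  have T0: "T 0 = snd d P" by (simp add: T_def clinear_zero[OF M] clinear_zero[OF \<Gamma>1] w_def vec_eq_iff)
  have DD: "((\<lambda>z. D z v) has_derivative (\<lambda>x. 0 - \<Gamma> (M x) (M v))) (at z)" for v z
    unfolding D_def by (intro has_derivative_diff has_derivative_const \<Gamma>M)
  have contD: "continuous_on UNIV (\<lambda>z. D z v)" for v
    using DD by (auto intro!: continuous_at_imp_continuous_on has_derivative_continuous)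
  obtain c where c: "c \<in> charts X A" "P \<in> fst c" "fst c \<subseteq> fst d" "snd c P = 0"
    and cT: "\<And>z. z \<in> cdom c \<Longrightarrow> transition c d z = T z"
    using reparametrised_chart[OF d P T Dlin contD T0] Minj unfolding D0 by blast
  have c0: "0 \<in> cdom c" using c by force
  have jac: "jac c d z v = D z v" if "z \<in> cdom c" for z v
  proof -
    obtain p where p: "z = snd c p" "p \<in> fst c" "p \<in> fst d" using \<open>z \<in> cdom c\<close> c(3) by auto
    have "(transition c d has_derivative D z) (at z)"
      by (rule has_derivative_transform_within_open[OF T open_cdom[OF c(1)] that]) (simp add: cT)
    from has_derivative_unique[OF this has_derivative_transition[OF c(1) d p(2,3), folded p(1)]]
    show ?thesis by simp
  qed
  have wj: "wirt (\<lambda>z. jac c d z u) 0 x = - \<Gamma> (M x) (M u)" for u x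
  proof -
    have "((\<lambda>z. jac c d z u) has_derivative (\<lambda>x. 0 - \<Gamma> (M x) (M u))) (at 0)"
      by (rule has_derivative_transform_within_open[OF DD open_cdom[OF c(1)] c0]) (simp add: jac)
    from wirt_holomorphic[OF this] show ?thesis
      by (simp add: clinear_scale[OF M] clinear_scale[OF \<Gamma>1])
  qed
  have "christoffel c 0 x u = 0" for x u
  proof (rule Minj)
    show "M (christoffel c 0 x u) = 0"
      using christoffel_transition[OF c(1) d c(2) P, of x u]
      by (simp add: c(4) jac[OF c0] D0 wj \<Gamma>_def w_def)
  qed
  moreover have "contract u (\<omega> c 0) [v] = \<i> / 2 * (\<Sum>i\<in>UNIV. u $ i * cnj (v $ i))" for u v
    using contract_transition[OF omega_forms c(1) d c(2) P, of u v] hM[of u v]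
    by (simp add: c(4) jac[OF c0] D0 w_def)
  ultimately show ?thesis using normal_chartI[OF c(1,2,4)] by blast
qed

end

section \<open>The bracket as an antisymmetrised covariant derivative\<close>

context complex_manifold
begin

lemma
  assumes "\<theta> \<in> vforms X A p" "c \<in> charts X A"
  shows vforms_smooth: "smooth_on (cdom c) (\<lambda>z. \<theta> c z vs)"
    and vforms_zero: "z \<notin> cdom c \<Longrightarrow> \<theta> c z vs = 0"
  using assms unfolding vforms_def by blast+

lemma vforms_zero': "\<theta> \<in> vforms X A p \<Longrightarrow> c \<notin> charts X A \<Longrightarrow> \<theta> c z vs = 0"
  unfolding vforms_def by blast

lemma vforms_vtype:
  assumes "\<theta> \<in> vforms X A p" "c \<in> charts X A" "z \<in> cdom c" "p = 1 \<or> p = 2"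
  shows "vtype p (\<theta> c z)"
  using assms(4) assms(1-3) unfolding vforms_def by (auto simp: vtype_1_iff[unfolded One_nat_def] vtype_2_iff)

lemma vforms_clinear:
  assumes "\<theta> \<in> vforms X A 1" "c \<in> charts X A" "z \<in> cdom c"
  shows "clinear (\<lambda>u. \<theta> c z [u])"
proof -
  have "vtype 1 (\<theta> c z)" using vforms_vtype[OF assms] by simp
  then have "\<theta> c z vs = (\<Sum>I\<in>increasing 1. dz I vs *s \<theta> c z (frame I))" for vs
    unfolding vtype_def by blast
  then show ?thesis by (rule vtype_1_clinear)
qed

lemma vforms_transition:
  assumes \<theta>: "\<theta> \<in> vforms X A p" and c: "c \<in> charts X A" "d \<in> charts X A" and p: "q \<in> fst c" "q \<in> fst d"
  shows "jac c d (snd c q) (\<theta> c (snd c q) vs) = \<theta> d (snd d q) (map (jac c d (snd c q)) vs)"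
proof -
  have m: "snd c q \<in> snd c ` (fst c \<inter> fst d)" using p by auto
  have "\<forall>z \<in> snd c ` (fst c \<inter> fst d). \<forall>vs. jac c d z (\<theta> c z vs) = \<theta> d (transition c d z) (map (jac c d z) vs)"
    using \<theta> c unfolding vforms_def by blast
  then show ?thesis using m transition_eq[OF c(1) p(1), of d] by metis
qed

lemma vforms_differentiable:
  "\<theta> \<in> vforms X A p \<Longrightarrow> c \<in> charts X A \<Longrightarrow> z \<in> cdom c \<Longrightarrow> (\<lambda>y. \<theta> c y vs) differentiable (at z)"
  by (rule smooth_on_imp_differentiable[OF vforms_smooth])

end

context kaehler
begin

text \<open>The covariant derivative along \<open>x\<close>, evaluated at \<open>v\<close>, of a one-form with values in the tangent bundle.\<close>

definition nabla :: "('a, 'n) vform \<Rightarrow> ('a, 'n) chart \<Rightarrow> (complex, 'n) vec \<Rightarrow> (complex, 'n) vec \<Rightarrow>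
    (complex, 'n) vec \<Rightarrow> (complex, 'n) vec" where
  "nabla \<theta> c z x v = wirt (\<lambda>y. \<theta> c y [v]) z x + christoffel c z x (\<theta> c z [v]) - \<theta> c z [christoffel c z x v]"

text \<open>Differentiate \<open>J (\<theta>\<^sub>c(v)) = \<theta>\<^sub>d(J v)\<close> along \<open>x\<close>; the derivatives of \<open>J\<close> on the two sides are exchanged for
  Christoffel symbols by their transformation law.\<close>

lemma nabla_transition:
  assumes \<theta>: "\<theta> \<in> vforms X A 1" and c: "c \<in> charts X A" "d \<in> charts X A" and p: "p \<in> fst c" "p \<in> fst d"
  shows "jac c d (snd c p) (nabla \<theta> c (snd c p) x v) =
    nabla \<theta> d (snd d p) (jac c d (snd c p) x) (jac c d (snd c p) v)"
proof -
  define z where "z = snd c p"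
  define S where "S = snd c ` (fst c \<inter> fst d)"
  define J where "J = jac c d"
  define T where "T = transition c d"
  have S: "open S" "z \<in> S" using open_overlap[OF c] p by (auto simp: S_def z_def)
  have Tz: "T z = snd d p" using transition_eq[OF c(1) p(1)] by (simp add: z_def T_def)
  have zc: "z \<in> cdom c" "T z \<in> cdom d" using p by (auto simp: z_def Tz[unfolded z_def])
  have Jlin: "clinear (J y)" if "y \<in> S" for y
    using that clinear_jac[OF c] by (auto simp: S_def J_def)
  have Tin: "T y \<in> cdom d" if y: "y \<in> S" for y
  proof -
    obtain q where "y = snd c q" "q \<in> fst c" "q \<in> fst d" using y by (auto simp: S_def)
    then show ?thesis by (simp add: T_def transition_eq[OF c(1)])
  qed
  have T: "(T has_derivative J z) (at z)"
    using has_derivative_transition[OF c p] by (simp add: T_def J_def z_def)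
  have dJ: "(\<lambda>y. J y v) differentiable (at z)" for v
    using differentiable_jac[OF c p] by (simp add: J_def z_def)
  have tr: "J y (\<theta> c y [v]) = \<theta> d (T y) [J y v]" if y: "y \<in> S" for y v
  proof -
    obtain q where "y = snd c q" "q \<in> fst c" "q \<in> fst d" using y by (auto simp: S_def)
    then show ?thesis
      using vforms_transition[OF \<theta> c, of q "[v]"] by (simp add: T_def J_def transition_eq[OF c(1)])
  qed
  have d\<theta>: "(\<lambda>y. \<theta> d y [w]) differentiable (at (T z))" for w
    by (rule vforms_differentiable[OF \<theta> c(2) zc(2)])
  have dT: "(\<lambda>y. \<theta> d (T y) [w]) differentiable (at z)" for w
    using has_derivative_compose[OF T] d\<theta>[of w] unfolding differentiable_def by blast
  have d\<theta>c: "(\<lambda>y. \<theta> c y [w]) differentiable (at z)" for w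
    by (rule vforms_differentiable[OF \<theta> c(1) zc(1)])
  have wJ: "wirt (\<lambda>y. J y u) z x = J z (christoffel c z x u) - christoffel d (T z) (J z x) (J z u)" for u
    using christoffel_transition[OF c p, of x u] by (simp add: J_def z_def Tz[unfolded z_def])
  have L: "wirt (\<lambda>y. \<theta> d (T y) [J y v]) z x =
      wirt (\<lambda>y. \<theta> d y [J z v]) (T z) (J z x) + \<theta> d (T z) [wirt (\<lambda>y. J y v) z x]"
    by (subst wirt_family[OF S vforms_clinear[OF \<theta> c(2) Tin] dT dJ])
       (simp_all add: wirt_chain[OF T clinear_scale[OF Jlin[OF S(2)]] d\<theta>])
  have R: "wirt (\<lambda>y. J y (\<theta> c y [v])) z x =
      wirt (\<lambda>y. J y (\<theta> c z [v])) z x + J z (wirt (\<lambda>y. \<theta> c y [v]) z x)"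
    by (rule wirt_family[OF S Jlin dJ d\<theta>c])
  have "wirt (\<lambda>y. J y (\<theta> c y [v])) z x = wirt (\<lambda>y. \<theta> d (T y) [J y v]) z x"
    by (rule wirt_cong_open[OF S tr differentiable_family[OF S Jlin dJ d\<theta>c]])
  note eq = this[unfolded L R wJ]
  note l = clinear_add[OF Jlin[OF S(2)]] clinear_diff[OF Jlin[OF S(2)]]
    clinear_diff[OF vforms_clinear[OF \<theta> c(2) zc(2)]]
  have "J z (nabla \<theta> c z x v) = nabla \<theta> d (T z) (J z x) (J z v)"
    using eq unfolding nabla_def l tr[OF S(2), symmetric] by (simp add: algebra_simps)
  then show ?thesis by (simp add: J_def z_def Tz[unfolded z_def])
qed

lemma smooth_on_christoffel_family:
  assumes c: "c \<in> charts X A" and "smooth_on (cdom c) f" "smooth_on (cdom c) g"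
  shows "smooth_on (cdom c) (\<lambda>z. christoffel c z (f z) (g z))"
proof -
  have "smooth_on (cdom c) (\<lambda>z. christoffel c z (f z) x)" for x
    by (rule smooth_on_family[OF open_cdom[OF c], where A = "\<lambda>z y. christoffel c z y x" and X = f])
       (rule clinear_christoffel_1[OF c] smooth_christoffel[OF c] assms(2); assumption?)+
  from smooth_on_family[OF open_cdom[OF c] clinear_christoffel_2[OF c] this assms(3)]
  show ?thesis .
qed

lemma smooth_on_vforms_family:
  assumes \<theta>: "\<theta> \<in> vforms X A 1" and c: "c \<in> charts X A" and "smooth_on (cdom c) f"
  shows "smooth_on (cdom c) (\<lambda>z. \<theta> c z [f z])"
  by (rule smooth_on_family[OF open_cdom[OF c] vforms_clinear[OF \<theta> c] vforms_smooth[OF \<theta> c] assms(3)])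

lemma clinear_nabla_1:
  assumes \<theta>: "\<theta> \<in> vforms X A 1" and c: "c \<in> charts X A" "z \<in> cdom c"
  shows "clinear (\<lambda>x. nabla \<theta> c z x v)"
proof -
  note l = clinear_wirt[OF vforms_differentiable[OF \<theta> c]] clinear_christoffel_1[OF c] vforms_clinear[OF \<theta> c]
  show ?thesis
    by (rule clinearI)
       (simp_all add: nabla_def clinear_add[OF l(1)] clinear_add[OF l(2)] clinear_add[OF l(3)]
          clinear_scale[OF l(1)] clinear_scale[OF l(2)] clinear_scale[OF l(3)] vec_eq_iff algebra_simps)
qed

lemma
  assumes \<theta>: "\<theta> \<in> vforms X A 1" and c: "c \<in> charts X A" "z \<in> cdom c"
  shows wirt_vform_add: "wirt (\<lambda>y. \<theta> c y [u + v]) z x = wirt (\<lambda>y. \<theta> c y [u]) z x + wirt (\<lambda>y. \<theta> c y [v]) z x"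
    and wirt_vform_scale: "wirt (\<lambda>y. \<theta> c y [a *s v]) z x = a *s wirt (\<lambda>y. \<theta> c y [v]) z x"
proof -
  note d = vforms_differentiable[OF \<theta> c]
  have "wirt (\<lambda>y. \<theta> c y [u + v]) z x = wirt (\<lambda>y. \<theta> c y [u] + \<theta> c y [v]) z x"
    by (rule wirt_cong_open[OF open_cdom[OF c(1)] c(2) _ d]) (simp add: clinear_add[OF vforms_clinear[OF \<theta> c(1)]])
  then show "wirt (\<lambda>y. \<theta> c y [u + v]) z x = wirt (\<lambda>y. \<theta> c y [u]) z x + wirt (\<lambda>y. \<theta> c y [v]) z x"
    by (simp add: wirt_add d)
  have "wirt (\<lambda>y. \<theta> c y [a *s v]) z x = wirt (\<lambda>y. a *s \<theta> c y [v]) z x"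
    by (rule wirt_cong_open[OF open_cdom[OF c(1)] c(2) _ d]) (simp add: clinear_scale[OF vforms_clinear[OF \<theta> c(1)]])
  then show "wirt (\<lambda>y. \<theta> c y [a *s v]) z x = a *s wirt (\<lambda>y. \<theta> c y [v]) z x"
    by (simp add: wirt_clinear[OF clinear_scaling d])
qed

lemma clinear_nabla_2:
  assumes \<theta>: "\<theta> \<in> vforms X A 1" and c: "c \<in> charts X A" "z \<in> cdom c"
  shows "clinear (nabla \<theta> c z x)"
proof -
  note l = clinear_christoffel_2[OF c] vforms_clinear[OF \<theta> c]
  show ?thesis
    by (rule clinearI)
       (simp_all add: nabla_def wirt_vform_add[OF \<theta> c] wirt_vform_scale[OF \<theta> c]
          clinear_add[OF l(1)] clinear_add[OF l(2)] clinear_scale[OF l(1)] clinear_scale[OF l(2)]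
          vec_eq_iff algebra_simps)
qed

lemma smooth_nabla:
  assumes \<theta>: "\<theta> \<in> vforms X A 1" and c: "c \<in> charts X A"
  shows "smooth_on (cdom c) (\<lambda>z. nabla \<theta> c z x v)"
  unfolding nabla_def
  by (intro smooth_on_diff smooth_on_add smooth_on_wirt smooth_on_christoffel_family smooth_on_vforms_family
      smooth_on_const open_cdom vforms_smooth[OF \<theta>] \<theta> c)

definition nabla_bracket :: "('a, 'n) vform \<Rightarrow> ('a, 'n) vform \<Rightarrow> ('a, 'n) chart \<Rightarrow> (complex, 'n) vec \<Rightarrow>
    (complex, 'n) vec \<Rightarrow> (complex, 'n) vec \<Rightarrow> (complex, 'n) vec" where
  "nabla_bracket \<theta> \<phi> c z u v = nabla \<phi> c z (\<theta> c z [u]) v - nabla \<theta> c z (\<phi> c z [v]) u"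

lemma nabla_bracket_transition:
  assumes \<theta>: "\<theta> \<in> vforms X A 1" and \<phi>: "\<phi> \<in> vforms X A 1"
    and c: "c \<in> charts X A" "d \<in> charts X A" and p: "p \<in> fst c" "p \<in> fst d"
  shows "jac c d (snd c p) (nabla_bracket \<theta> \<phi> c (snd c p) u v) =
    nabla_bracket \<theta> \<phi> d (snd d p) (jac c d (snd c p) u) (jac c d (snd c p) v)"
  using vforms_transition[OF \<theta> c p, of "[u]"] vforms_transition[OF \<phi> c p, of "[v]"]
  by (simp add: nabla_bracket_def clinear_diff[OF clinear_jac[OF c p]] nabla_transition[OF \<theta> c p] nabla_transition[OF \<phi> c p])

lemma clinear_nabla_bracket:
  assumes \<theta>: "\<theta> \<in> vforms X A 1" and \<phi>: "\<phi> \<in> vforms X A 1" and c: "c \<in> charts X A" "z \<in> cdom c"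
  shows "clinear (\<lambda>u. nabla_bracket \<theta> \<phi> c z u v)" "clinear (nabla_bracket \<theta> \<phi> c z u)"
proof -
  note l = vforms_clinear[OF \<theta> c] vforms_clinear[OF \<phi> c] clinear_nabla_1[OF \<theta> c] clinear_nabla_1[OF \<phi> c]
    clinear_nabla_2[OF \<theta> c] clinear_nabla_2[OF \<phi> c]
  note a = clinear_add[OF l(1)] clinear_add[OF l(2)] clinear_add[OF l(3)] clinear_add[OF l(4)]
    clinear_add[OF l(5)] clinear_add[OF l(6)]
    clinear_scale[OF l(1)] clinear_scale[OF l(2)] clinear_scale[OF l(3)] clinear_scale[OF l(4)]
    clinear_scale[OF l(5)] clinear_scale[OF l(6)]
  show "clinear (\<lambda>u. nabla_bracket \<theta> \<phi> c z u v)" "clinear (nabla_bracket \<theta> \<phi> c z u)"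
    by (rule clinearI; simp add: nabla_bracket_def a vec_eq_iff algebra_simps)+
qed

lemma smooth_nabla_bracket:
  assumes \<theta>: "\<theta> \<in> vforms X A 1" and \<phi>: "\<phi> \<in> vforms X A 1" and c: "c \<in> charts X A"
  shows "smooth_on (cdom c) (\<lambda>z. nabla_bracket \<theta> \<phi> c z u v)"
  unfolding nabla_bracket_def
  by (intro smooth_on_diff open_cdom c;
      rule smooth_on_family[OF open_cdom[OF c] clinear_nabla_1[OF \<phi> c] smooth_nabla[OF \<phi> c] vforms_smooth[OF \<theta> c]]
        smooth_on_family[OF open_cdom[OF c] clinear_nabla_1[OF \<theta> c] smooth_nabla[OF \<theta> c] vforms_smooth[OF \<phi> c]])

text \<open>The two terms in which the connection acts on the vector part cancel, as it is symmetric.\<close>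

lemma nabla_bracket_eq:
  assumes c: "c \<in> charts X A" "z \<in> cdom c"
  shows "nabla_bracket \<theta> \<phi> c z u v = lie (\<theta> c) (\<phi> c) z [u] [v]
    - \<phi> c z [christoffel c z (\<theta> c z [u]) v] + \<theta> c z [christoffel c z (\<phi> c z [v]) u]"
  by (simp add: nabla_bracket_def nabla_def lie_def christoffel_symmetric[OF c, of "\<phi> c z [v]" "\<theta> c z [u]"])

text \<open>A function of order \<open>O(|z|\<^sup>2)\<close> has vanishing derivative at \<open>0\<close>, so the metric is constant to first order.\<close>

lemma normal_chart_christoffel:
  assumes n: "normal_chart X A \<omega> P c"
  shows "christoffel c 0 x u = 0"
proof -
  have c: "c \<in> charts X A" "0 \<in> cdom c" using n by (auto simp: normal_chart_def image_iff)
  have D: "((\<lambda>y. \<omega> c y vs) has_derivative (\<lambda>h. 0)) (at 0)" for vs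
  proof -
    have "(\<lambda>z. \<omega> c z vs - flat_form vs) \<in> O[nhds 0](\<lambda>z. of_real ((norm z)\<^sup>2))"
      using n unfolding normal_chart_def by blast
    then obtain C where C: "C > 0"
      "eventually (\<lambda>z. norm (\<omega> c z vs - flat_form vs) \<le> C * norm (complex_of_real ((norm z)\<^sup>2))) (nhds 0)"
      by (elim landau_o.bigE) auto
    then obtain d where d: "d > 0"
      "\<And>z. norm z < d \<Longrightarrow> norm (\<omega> c z vs - flat_form vs) \<le> C * (norm z)\<^sup>2"
      unfolding eventually_nhds_metric by (auto simp: dist_norm norm_power)
    have v0: "\<omega> c 0 vs = flat_form vs" using d(2)[of 0] d(1) by simp
    show ?thesis
      unfolding has_derivative_at_alt
    proof (intro conjI allI impI)
      fix e :: real assume e: "e > 0"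
      show "\<exists>d>0. \<forall>y. norm (y - 0) < d \<longrightarrow> norm (\<omega> c y vs - \<omega> c 0 vs - 0) \<le> e * norm (y - 0)"
      proof (intro exI[of _ "min d (e / C)"] conjI allI impI)
        show "min d (e / C) > 0" using d e C by simp
        fix y :: "(complex, 'n) vec" assume y: "norm (y - 0) < min d (e / C)"
        have "norm (\<omega> c y vs - \<omega> c 0 vs) \<le> C * (norm y)\<^sup>2" using d(2)[of y] y by (simp add: v0)
        also have "\<dots> = (C * norm y) * norm y" by (simp add: power2_eq_square)
        also have "\<dots> \<le> e * norm y"
          using y C(1) by (intro mult_right_mono) (auto simp: field_simps)
        finally show "norm (\<omega> c y vs - \<omega> c 0 vs - 0) \<le> e * norm (y - 0)" by simp
      qed
    qed simp
  qed
  have "((\<lambda>y. low c y u) has_derivative (\<lambda>h. 0)) (at 0)"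
  proof (rule has_derivative_vecI)
    fix l
    have "((\<lambda>y. (\<omega> c y [u, axis l 1] - \<i> * \<omega> c y [\<i> *s u, axis l 1]) / 2) has_derivative
        (\<lambda>h. (0 - \<i> * 0) / 2)) (at 0)"
      by (intro bounded_linear.has_derivative[OF bounded_linear_divide] has_derivative_diff has_derivative_mult_right D)
    then show "((\<lambda>y. low c y u $ l) has_derivative (\<lambda>h. 0 $ l)) (at 0)" by (simp add: low_nth)
  qed
  from wirt_eq[OF this] have "low c 0 (christoffel c 0 x u) = 0"
    by (simp add: low_christoffel[OF c])
  then show ?thesis by (rule low_injective[OF c])
qed

definition normal_at :: "'a \<Rightarrow> ('a, 'n) chart" where
  "normal_at P = (SOME c. normal_chart X A \<omega> P c)"

lemma normal_at:
  assumes "P \<in> topspace X"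
  shows "normal_chart X A \<omega> P (normal_at P)"
  unfolding normal_at_def by (rule someI_ex[OF exists_normal_chart[OF assms]])

lemma normal_atD:
  assumes "P \<in> topspace X"
  shows "normal_at P \<in> charts X A" "P \<in> fst (normal_at P)" "snd (normal_at P) P = 0" "0 \<in> cdom (normal_at P)"
  using normal_at[OF assms] by (force simp: normal_chart_def)+

lemma vbracket_chart:
  assumes d: "d \<in> charts X A" and P: "P \<in> fst d"
  shows "vbracket X A \<omega> p q \<theta> \<phi> d (snd d P) vs =
    jac (normal_at P) d 0 (coord_bracket p q (\<theta> (normal_at P)) (\<phi> (normal_at P)) 0
      (map (jac d (normal_at P) (snd d P)) vs))"
  using d P inv_into_f_f[OF chart_inj[OF chartsD[OF d]] P]
  by (simp add: vbracket_def Let_def normal_at_def)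

text \<open>At the centre of the chosen normal chart the covariant derivative is the coordinate derivative; then
  covariance transports the formula to every chart.\<close>

lemma vbracket_1_1:
  assumes \<theta>: "\<theta> \<in> vforms X A 1" and \<phi>: "\<phi> \<in> vforms X A 1" and d: "d \<in> charts X A" and z: "z \<in> cdom d"
  shows "vbracket X A \<omega> 1 1 \<theta> \<phi> d z [u, v] = nabla_bracket \<theta> \<phi> d z u v - nabla_bracket \<theta> \<phi> d z v u"
proof -
  obtain P where P: "P \<in> fst d" "z = snd d P" using z by auto
  have PX: "P \<in> topspace X" using P openin_subset[OF openin_chart[OF d]] by auto
  define c where "c = normal_at P"
  note c = normal_atD[OF PX, folded c_def]
  have \<Gamma>: "christoffel c 0 x u = 0" for x u
    using normal_chart_christoffel[OF normal_at[OF PX]] by (simp add: c_def)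
  have zero: "\<theta> c 0 [0] = 0" "\<phi> c 0 [0] = 0"
    using clinear_zero[OF vforms_clinear[OF \<theta> c(1,4)]] clinear_zero[OF vforms_clinear[OF \<phi> c(1,4)]] by auto
  have lie: "lie (\<theta> c) (\<phi> c) 0 [a] [b] = nabla_bracket \<theta> \<phi> c 0 a b" for a b
    by (simp add: nabla_bracket_eq[OF c(1,4)] \<Gamma> zero)
  have vt: "vtype 1 (\<theta> c y)" "vtype 1 (\<phi> c y)" if "y \<in> cdom c" for y
    using vforms_vtype[OF \<theta> c(1) that] vforms_vtype[OF \<phi> c(1) that] by auto
  have cb: "coord_bracket 1 1 (\<theta> c) (\<phi> c) 0 [a, b] = nabla_bracket \<theta> \<phi> c 0 a b - nabla_bracket \<theta> \<phi> c 0 b a" for a b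
    unfolding lie[symmetric]
    by (rule coord_bracket_1_1[OF open_cdom[OF c(1)] c(4)])
       (auto intro: vt vforms_differentiable[OF \<theta> c(1,4)] vforms_differentiable[OF \<phi> c(1,4)] simp del: One_nat_def)
  note tr = nabla_bracket_transition[OF \<theta> \<phi> c(1) d c(2) P(1), unfolded c(3)]
  note ji = jac_inverse[OF d c(1) P(1) c(2), unfolded c(3)]
  show ?thesis
    unfolding P(2) vbracket_chart[OF d P(1), folded c_def]
    by (simp add: cb tr ji clinear_diff[OF clinear_jac[OF c(1) d c(2) P(1), unfolded c(3)]] del: One_nat_def)
qed

lemma vbracket_length:
  assumes d: "d \<in> charts X A" and z: "z \<in> cdom d" and "length vs \<noteq> p + q"
  shows "vbracket X A \<omega> p q \<theta> \<phi> d z vs = 0"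
proof -
  obtain P where P: "P \<in> fst d" "z = snd d P" using z by auto
  have PX: "P \<in> topspace X" using P openin_subset[OF openin_chart[OF d]] by auto
  note c = normal_atD[OF PX]
  show ?thesis
    unfolding P(2) vbracket_chart[OF d P(1)]
    using clinear_zero[OF clinear_jac[OF c(1) d c(2) P(1), unfolded c(3)]] assms(3)
    by (simp add: coord_bracket_length)
qed

lemma vbracket_vforms:
  assumes \<theta>: "\<theta> \<in> vforms X A 1" and \<phi>: "\<phi> \<in> vforms X A 1"
  shows "vbracket X A \<omega> 1 1 \<theta> \<phi> \<in> vforms X A 2"
proof -
  let ?\<psi> = "vbracket X A \<omega> 1 1 \<theta> \<phi>"
  have len: "?\<psi> c z vs = 0" if "c \<in> charts X A" "z \<in> cdom c" "length vs \<noteq> 2" for c z vs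
    using vbracket_length[OF that(1,2), of vs 1 1] that(3) by simp
  note val = vbracket_1_1[OF \<theta> \<phi>]
  have "vtype 2 (?\<psi> c z)" if c: "c \<in> charts X A" "z \<in> cdom c" for c z
  proof (rule vtype_2I)
    note l = clinear_nabla_bracket[OF \<theta> \<phi> c]
    show "clinear (\<lambda>u. ?\<psi> c z [u, v])" for v
      unfolding val[OF c]
      by (rule clinearI)
         (simp_all add: clinear_add[OF l(1)] clinear_add[OF l(2)] clinear_scale[OF l(1)] clinear_scale[OF l(2)]
            vec_eq_iff algebra_simps)
    show "?\<psi> c z [v, u] = - ?\<psi> c z [u, v]" for u v unfolding val[OF c] by simp
    show "?\<psi> c z vs = 0" if "length vs \<noteq> 2" for vs by (rule len[OF c that])
  qed
  then have 1: "\<forall>c\<in>charts X A. \<forall>z\<in>cdom c. \<exists>a. \<forall>vs. ?\<psi> c z vs = (\<Sum>I\<in>increasing 2. dz I vs *s a I)"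
    unfolding vtype_2_iff by blast
  have 2: "smooth_on (cdom c) (\<lambda>z. ?\<psi> c z vs)" if c: "c \<in> charts X A" for c vs
  proof (cases "length vs = 2")
    case True
    then obtain u v where vs: "vs = [u, v]" by (auto simp: length_Suc_conv numeral_2_eq_2)
    have "smooth_on (cdom c) (\<lambda>z. nabla_bracket \<theta> \<phi> c z u v - nabla_bracket \<theta> \<phi> c z v u)"
      by (intro smooth_on_diff open_cdom c smooth_nabla_bracket \<theta> \<phi>)
    then show ?thesis
      by (rule smooth_on_cong[OF open_cdom[OF c], rotated]) (simp only: vs val[OF c])
  next
    case False
    show ?thesis
      by (rule smooth_on_cong[OF open_cdom[OF c] _ smooth_on_const[OF open_cdom[OF c], of 0]])
         (simp only: len[OF c _ False])
  qed
  have 3: "jac c d z (?\<psi> c z vs) = ?\<psi> d (transition c d z) (map (jac c d z) vs)"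
    if c: "c \<in> charts X A" "d \<in> charts X A" and z: "z \<in> snd c ` (fst c \<inter> fst d)" for c d z vs
  proof -
    obtain p where p: "z = snd c p" "p \<in> fst c" "p \<in> fst d" using z by auto
    have T: "transition c d z = snd d p" by (simp add: p transition_eq[OF c(1)])
    have m: "snd c p \<in> cdom c" "snd d p \<in> cdom d" using p by auto
    show ?thesis
    proof (cases "length vs = 2")
      case True
      then obtain u v where vs: "vs = [u, v]" by (auto simp: length_Suc_conv numeral_2_eq_2)
      show ?thesis
        unfolding T unfolding p(1) vs list.map val[OF c(1) m(1)] val[OF c(2) m(2)]
        by (simp only: clinear_diff[OF clinear_jac[OF c p(2,3)]] nabla_bracket_transition[OF \<theta> \<phi> c p(2,3)])
    next
      case False
      then show ?thesis
        unfolding T unfolding p(1)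
        by (simp only: len[OF c(1) m(1) False] len[OF c(2) m(2)] length_map not_False_eq_True
            clinear_zero[OF clinear_jac[OF c p(2,3)]])
    qed
  qed
  have 4: "?\<psi> c z vs = 0" if "c \<notin> charts X A \<or> z \<notin> cdom c" for c z vs
    using that by (auto simp: vbracket_def)
  show ?thesis
    unfolding vforms_def mem_Collect_eq using 1 2 3 4 by blast
qed

section \<open>Raising and lowering with the Kaehler form\<close>

lemma form11_zero: "\<alpha> \<in> forms X A 1 1 \<Longrightarrow> c \<notin> charts X A \<or> z \<notin> cdom c \<Longrightarrow> \<alpha> c z vs = 0"
  unfolding forms_def by blast

lemma form11_type11: "\<alpha> \<in> forms X A 1 1 \<Longrightarrow> c \<in> charts X A \<Longrightarrow> z \<in> cdom c \<Longrightarrow> type11 (\<alpha> c z)"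
  unfolding forms_def type11_def by blast

lemma contract_zero: "contract u (\<lambda>vs. 0) = (\<lambda>vs. 0)"
  by (rule ext) (simp add: contract_def)

lemma interior_prod_zero_form: "interior_prod p k \<theta> (\<lambda>vs. 0) vs = 0"
  by (simp add: interior_prod_def contract_zero wedge_def cong: if_cong)

definition sharp :: "('a, 'n) form \<Rightarrow> ('a, 'n) vform" where
  "sharp \<alpha> c z vs = (if c \<in> charts X A \<and> z \<in> cdom c \<and> length vs = 1
     then raise c z (lower (\<alpha> c z) (hd vs)) else 0)"

lemma sharp_vforms:
  assumes \<alpha>: "\<alpha> \<in> forms X A 1 1"
  shows "sharp \<alpha> \<in> vforms X A 1"
proof -
  have val: "sharp \<alpha> c z [u] = raise c z (lower (\<alpha> c z) u)" if "c \<in> charts X A" "z \<in> cdom c" for c z u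
    using that by (simp add: sharp_def)
  have 0: "sharp \<alpha> c z vs = 0" if "length vs \<noteq> 1" for c z vs using that by (simp add: sharp_def)
  have "vtype 1 (sharp \<alpha> c z)" if c: "c \<in> charts X A" "z \<in> cdom c" for c z
  proof (rule vtype_1I)
    note l = clinear_raise[OF c] clinear_lower[OF form11_type11[OF \<alpha> c]]
    show "clinear (\<lambda>u. sharp \<alpha> c z [u])"
      unfolding val[OF c]
      by (rule clinearI) (simp_all add: clinear_add[OF l(1)] clinear_add[OF l(2)] clinear_scale[OF l(1)] clinear_scale[OF l(2)])
    show "sharp \<alpha> c z vs = 0" if "length vs \<noteq> 1" for vs by (rule 0[OF that])
  qed
  then have 1: "\<forall>c\<in>charts X A. \<forall>z\<in>cdom c. \<exists>a. \<forall>vs. sharp \<alpha> c z vs = (\<Sum>I\<in>increasing 1. dz I vs *s a I)"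
    unfolding vtype_1_iff by blast
  have 2: "smooth_on (cdom c) (\<lambda>z. sharp \<alpha> c z vs)" if c: "c \<in> charts X A" for c vs
  proof (cases "length vs = 1")
    case True
    then obtain u where vs: "vs = [u]" by (auto simp: length_Suc_conv)
    from smooth_raise[OF c smooth_lower[OF \<alpha> c]] show ?thesis
      by (rule smooth_on_cong[OF open_cdom[OF c], rotated]) (simp add: vs val[OF c])
  next
    case False
    show ?thesis
      by (rule smooth_on_cong[OF open_cdom[OF c] _ smooth_on_const[OF open_cdom[OF c], of 0]])
         (simp only: 0[OF False])
  qed
  have 3: "jac c d z (sharp \<alpha> c z vs) = sharp \<alpha> d (transition c d z) (map (jac c d z) vs)"
    if c: "c \<in> charts X A" "d \<in> charts X A" and z: "z \<in> snd c ` (fst c \<inter> fst d)" for c d z vs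
  proof -
    obtain p where p: "z = snd c p" "p \<in> fst c" "p \<in> fst d" using z by auto
    have T: "transition c d z = snd d p" by (simp add: p transition_eq[OF c(1)])
    have m: "snd c p \<in> cdom c" "snd d p \<in> cdom d" using p by auto
    show ?thesis
    proof (cases "length vs = 1")
      case True
      then obtain u where vs: "vs = [u]" by (auto simp: length_Suc_conv)
      define J where "J = jac c d (snd c p)"
      define q where "q = raise d (snd d p) (lower (\<alpha> d (snd d p)) (J u))"
      define r where "r = jac d c (snd d p) q"
      have Jr: "J r = q" unfolding r_def J_def by (rule jac_inverse[OF c(2,1) p(3,2)])
      have "low c (snd c p) r = lower (\<alpha> c (snd c p)) u"
        unfolding vec_eq_iff
      proof
        fix j
        have "low c (snd c p) r $ j = contract q (\<omega> d (snd d p)) [J (axis j 1)]"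
          unfolding Jr[symmetric] lower_def
          using contract_transition[OF omega_forms c p(2,3), of r "axis j 1"] by (simp add: J_def)
        also have "\<dots> = contract (J u) (\<alpha> d (snd d p)) [J (axis j 1)]"
          unfolding contract_lower[OF omega_type11[OF c(2) m(2)]] contract_lower[OF form11_type11[OF \<alpha> c(2) m(2)]]
          by (simp add: q_def low_raise[OF c(2) m(2)])
        also have "\<dots> = lower (\<alpha> c (snd c p)) u $ j"
          unfolding lower_def
          using contract_transition[OF \<alpha> c p(2,3), of u "axis j 1"] by (simp add: J_def)
        finally show "low c (snd c p) r $ j = lower (\<alpha> c (snd c p)) u $ j" .
      qed
      then have "r = raise c (snd c p) (lower (\<alpha> c (snd c p)) u)"
        using raise_low[OF c(1) m(1), of r] by simp
      then show ?thesis
        unfolding T unfolding p(1) vs list.map val[OF c(1) m(1)] val[OF c(2) m(2)]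
        using Jr by (simp add: J_def q_def)
    next
      case False
      then show ?thesis
        unfolding T unfolding p(1)
        by (simp only: 0[OF False] 0 length_map not_False_eq_True clinear_zero[OF clinear_jac[OF c p(2,3)]])
    qed
  qed
  have 4: "sharp \<alpha> c z vs = 0" if "c \<notin> charts X A \<or> z \<notin> cdom c" for c z vs
    using that by (auto simp: sharp_def)
  show ?thesis
    unfolding vforms_def mem_Collect_eq using 1 2 3 4 by blast
qed

text \<open>Raising the antiholomorphic index of a \<open>(1,1)\<close>-form with the metric inverts the interior product.\<close>

lemma vinterior_sharp:
  assumes \<alpha>: "\<alpha> \<in> forms X A 1 1"
  shows "vinterior 1 (sharp \<alpha>) \<omega> = \<alpha>"
proof (intro ext)
  fix c z vs
  show "vinterior 1 (sharp \<alpha>) \<omega> c z vs = \<alpha> c z vs"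
  proof (cases "c \<in> charts X A \<and> z \<in> cdom c")
    case True
    then have c: "c \<in> charts X A" "z \<in> cdom c" by auto
    note t = omega_type11[OF c] form11_type11[OF \<alpha> c]
    show ?thesis
    proof (cases "length vs = 2")
      case True
      then obtain u w where vs: "vs = [u, w]" by (auto simp: length_Suc_conv numeral_2_eq_2)
      have "contract (sharp \<alpha> c z [u]) (\<omega> c z) [w] = contract u (\<alpha> c z) [w]" for u w
        using c by (simp add: contract_lower[OF t(1)] contract_lower[OF t(2)] sharp_def low_raise[OF c])
      moreover have "vtype 1 (sharp \<alpha> c z)"
        using vforms_vtype[OF sharp_vforms[OF \<alpha>] c] by simp
      ultimately show ?thesis
        unfolding vs vinterior_def by (simp only: interior_prod_1[OF t(1)] type11_contract(5)[OF t(2), of u w])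
    next
      case False
      then show ?thesis
        unfolding vinterior_def interior_prod_def
        by (simp add: wedge_length type11_contract(7)[OF t(2)])
    qed
  next
    case False
    then have "\<omega> c z = (\<lambda>vs. 0)" "\<alpha> c z vs = 0"
      using form11_zero[OF omega_forms] form11_zero[OF \<alpha>] by blast+
    then show ?thesis by (simp add: vinterior_def interior_prod_zero_form)
  qed
qed

lemma to_vform_1:
  assumes "\<alpha> \<in> forms X A 1 1"
  shows "to_vform X A \<omega> 1 \<alpha> \<in> vforms X A 1"
  unfolding to_vform_def
  by (rule inv_into_into) (rule image_eqI[where x = "sharp \<alpha>"], simp only: vinterior_sharp[OF assms], rule sharp_vforms[OF assms])

text \<open>Projecting the first two arguments to type \<open>(1,0)\<close> isolates one of the three terms of \<open>\<theta> \<lrcorner> \<omega>\<close>.\<close>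

lemma interior_prod_2_polarised:
  assumes t: "type11 \<eta>" and \<theta>: "vtype 2 \<theta>"
  shows "4 * contract (\<theta> [u, v]) \<eta> [w] =
    interior_prod 2 1 \<theta> \<eta> [u, v, w] - \<i> * interior_prod 2 1 \<theta> \<eta> [u, \<i> *s v, w]
    - \<i> * interior_prod 2 1 \<theta> \<eta> [\<i> *s u, v, w] - interior_prod 2 1 \<theta> \<eta> [\<i> *s u, \<i> *s v, w]"
proof -
  have "\<And>vs. \<theta> vs = (\<Sum>I\<in>increasing 2. dz I vs *s \<theta> (frame I))" using \<theta> unfolding vtype_def by blast
  note D = vtype_2D[OF this]
  have s1: "\<theta> [c *s u, v] = c *s \<theta> [u, v]" for c u v using clinear_scale[OF D(1)] .
  have s2: "\<theta> [u, c *s v] = c *s \<theta> [u, v]" for c u v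
    unfolding D(2)[of u] s1 by (simp add: vec_eq_iff)
  have neg: "contract (- x) \<eta> [w] = - contract x \<eta> [w]" for x w
    using type11_contract(2)[OF t, of "-1" x w] by simp
  show ?thesis
    unfolding interior_prod_2[OF t \<theta>]
    by (simp add: s1 s2 neg type11_contract(2,4)[OF t] algebra_simps)
qed

lemma to_vform_2:
  assumes \<psi>: "\<psi> \<in> vforms X A 2"
  shows "to_vform X A \<omega> 2 (vinterior 2 \<psi> \<omega>) = \<psi>"
  unfolding to_vform_def
proof (rule inv_into_f_f[OF _ \<psi>], rule inj_onI)
  fix \<theta> \<phi> assume \<theta>: "\<theta> \<in> vforms X A 2" and \<phi>: "\<phi> \<in> vforms X A 2" and eq: "vinterior 2 \<theta> \<omega> = vinterior 2 \<phi> \<omega>"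
  show "\<theta> = \<phi>"
  proof (intro ext)
    fix c z vs
    show "\<theta> c z vs = \<phi> c z vs"
    proof (cases "c \<in> charts X A \<and> z \<in> cdom c")
      case True
      then have c: "c \<in> charts X A" "z \<in> cdom c" by auto
      have v: "vtype 2 (\<theta> c z)" "vtype 2 (\<phi> c z)"
        using vforms_vtype[OF \<theta> c] vforms_vtype[OF \<phi> c] by auto
      show ?thesis
      proof (cases "length vs = 2")
        case True
        then obtain u w where vs: "vs = [u, w]" by (auto simp: length_Suc_conv numeral_2_eq_2)
        have ip: "interior_prod 2 1 (\<theta> c z) (\<omega> c z) = interior_prod 2 1 (\<phi> c z) (\<omega> c z)"
          using fun_cong[OF fun_cong[OF eq, of c], of z] by (simp add: vinterior_def)
        have "contract (\<theta> c z [u, w]) (\<omega> c z) [x] = contract (\<phi> c z [u, w]) (\<omega> c z) [x]" for x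
        proof -
          have "4 * contract (\<theta> c z [u, w]) (\<omega> c z) [x] = 4 * contract (\<phi> c z [u, w]) (\<omega> c z) [x]"
            by (simp only: interior_prod_2_polarised[OF omega_type11[OF c] v(1)]
                interior_prod_2_polarised[OF omega_type11[OF c] v(2)] ip)
          then show ?thesis by simp
        qed
        then have "low c z (\<theta> c z [u, w]) = low c z (\<phi> c z [u, w])" by (simp add: lower_def)
        then show ?thesis by (simp add: vs low_eq_iff[OF c])
      next
        case False
        then show ?thesis using vtype_length[OF v(1)] vtype_length[OF v(2)] by simp
      qed
    next
      case False
      then show ?thesis
        by (cases "c \<in> charts X A")
           (simp_all add: vforms_zero[OF \<theta>] vforms_zero[OF \<phi>] vforms_zero'[OF \<theta>] vforms_zero'[OF \<phi>])
    qed
  qed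
qed

section \<open>The Jacobi identity\<close>

text \<open>The part of \<open>[\<gamma>, [\<theta>, \<phi>]](v, u, w)\<close> in which \<open>\<gamma>\<close>, \<open>\<theta>\<close>, \<open>\<phi>\<close> receive \<open>v\<close>, \<open>u\<close>, \<open>w\<close>, at the centre of a
  normal chart; the double bracket is its antisymmetrisation.\<close>

definition jacobiator :: "('a, 'n) vform \<Rightarrow> ('a, 'n) vform \<Rightarrow> ('a, 'n) vform \<Rightarrow> ('a, 'n) chart \<Rightarrow>
    (complex, 'n) vec \<Rightarrow> (complex, 'n) vec \<Rightarrow> (complex, 'n) vec \<Rightarrow> (complex, 'n) vec" where
  "jacobiator \<gamma> \<theta> \<phi> c v u w =
     wirt (\<lambda>y. nabla_bracket \<theta> \<phi> c y u w) 0 (\<gamma> c 0 [v]) - wirt (\<lambda>y. \<gamma> c y [v]) 0 (nabla_bracket \<theta> \<phi> c 0 u w)"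

text \<open>Where \<open>\<Gamma>\<close> vanishes, lowering the index of \<open>\<partial>\<^sub>x \<Gamma>(t,w)\<close> gives \<open>\<partial>\<^sub>x \<partial>\<^sub>t g(w,\<sqdot>)\<close>.\<close>

lemma wirt_christoffel_symmetric:
  assumes c: "c \<in> charts X A" "0 \<in> cdom c" and \<Gamma>: "\<And>x u. christoffel c 0 x u = 0"
  shows "wirt (\<lambda>y. christoffel c y t w) 0 x = wirt (\<lambda>y. christoffel c y x w) 0 t"
proof -
  have d: "(\<lambda>y. christoffel c y t w) differentiable (at 0)" for t
    by (rule smooth_on_imp_differentiable[OF smooth_christoffel[OF c(1)] c(2)])
  have "low c 0 (wirt (\<lambda>y. christoffel c y t w) 0 x) = wirt (\<lambda>y. wirt (\<lambda>y. low c y w) y t) 0 x" for x t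
  proof -
    have "wirt (\<lambda>y. low c y 0) 0 x = wirt (\<lambda>y. 0) 0 x"
      by (rule wirt_cong_open[OF open_cdom[OF c(1)] c(2) _ differentiable_low[OF c]])
         (simp add: clinear_zero[OF clinear_low[OF c(1)]])
    then have z: "wirt (\<lambda>y. low c y 0) 0 x = 0" by (simp add: wirt_const)
    have "wirt (\<lambda>y. wirt (\<lambda>y. low c y w) y t) 0 x = wirt (\<lambda>y. low c y (christoffel c y t w)) 0 x"
      by (rule wirt_cong_open[OF open_cdom[OF c(1)] c(2)])
         (simp_all add: low_christoffel[OF c(1)]
            smooth_on_imp_differentiable[OF smooth_on_wirt[OF open_cdom[OF c(1)] smooth_low[OF c(1)]] c(2)])
    also have "\<dots> = wirt (\<lambda>y. low c y (christoffel c 0 t w)) 0 x + low c 0 (wirt (\<lambda>y. christoffel c y t w) 0 x)"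
      by (rule wirt_family[OF open_cdom[OF c(1)] c(2) clinear_low[OF c(1)] differentiable_low[OF c] d])
    finally show ?thesis by (simp add: \<Gamma> z)
  qed
  then have "low c 0 (wirt (\<lambda>y. christoffel c y t w) 0 x) = low c 0 (wirt (\<lambda>y. christoffel c y x w) 0 t)"
    using wirt_commute[OF open_cdom[OF c(1)] c(2) smooth_low[OF c(1)], of w t x] by simp
  then show ?thesis by (simp only: low_eq_iff[OF c])
qed

text \<open>The product rule for all four terms of the bracket. As \<open>\<Gamma>\<close> vanishes at \<open>0\<close>, in the terms that contain it
  only \<open>\<Gamma>\<close> itself has to be differentiated.\<close>

lemma wirt_nabla_bracket:
  assumes \<theta>: "\<theta> \<in> vforms X A 1" and \<phi>: "\<phi> \<in> vforms X A 1"
    and c: "c \<in> charts X A" "0 \<in> cdom c" and \<Gamma>: "\<And>x u. christoffel c 0 x u = 0"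
  shows "wirt (\<lambda>y. nabla_bracket \<theta> \<phi> c y u w) 0 x =
    wirt (\<lambda>y. wirt (\<lambda>y. \<phi> c y [w]) y (\<theta> c 0 [u])) 0 x + wirt (\<lambda>y. \<phi> c y [w]) 0 (wirt (\<lambda>y. \<theta> c y [u]) 0 x)
    - (wirt (\<lambda>y. wirt (\<lambda>y. \<theta> c y [u]) y (\<phi> c 0 [w])) 0 x + wirt (\<lambda>y. \<theta> c y [u]) 0 (wirt (\<lambda>y. \<phi> c y [w]) 0 x))
    - \<phi> c 0 [wirt (\<lambda>y. christoffel c y (\<theta> c 0 [u]) w) 0 x]
    + \<theta> c 0 [wirt (\<lambda>y. christoffel c y (\<phi> c 0 [w]) u) 0 x]"
proof -
  note S = open_cdom[OF c(1)] c(2)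
  note sd = smooth_on_imp_differentiable[OF _ c(2)]
  have dw: "(\<lambda>y. wirt (\<lambda>y. \<eta> c y [w]) y t) differentiable (at 0)" if "\<eta> \<in> vforms X A 1" for \<eta> w t
    by (rule sd[OF smooth_on_wirt[OF S(1) vforms_smooth[OF that c(1)]]])
  have d: "(\<lambda>y. \<eta> c y [w]) differentiable (at 0)" if "\<eta> \<in> vforms X A 1" for \<eta> w
    by (rule vforms_differentiable[OF that c])
  have fam: "(\<lambda>y. wirt (\<lambda>y. \<eta> c y [w]) y (\<xi> c y [u])) differentiable (at 0)"
    "wirt (\<lambda>y. wirt (\<lambda>y. \<eta> c y [w]) y (\<xi> c y [u])) 0 x =
      wirt (\<lambda>y. wirt (\<lambda>y. \<eta> c y [w]) y (\<xi> c 0 [u])) 0 x + wirt (\<lambda>y. \<eta> c y [w]) 0 (wirt (\<lambda>y. \<xi> c y [u]) 0 x)"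
    if \<eta>: "\<eta> \<in> vforms X A 1" and \<xi>: "\<xi> \<in> vforms X A 1" for \<eta> \<xi> u w
    by (rule differentiable_family[OF S clinear_wirt[OF vforms_differentiable[OF \<eta> c(1)]] dw[OF \<eta>] d[OF \<xi>]]
        wirt_family[OF S clinear_wirt[OF vforms_differentiable[OF \<eta> c(1)]] dw[OF \<eta>] d[OF \<xi>]]; assumption)+
  have chr: "(\<lambda>y. \<eta> c y [christoffel c y (\<xi> c y [u]) w]) differentiable (at 0)"
    "wirt (\<lambda>y. \<eta> c y [christoffel c y (\<xi> c y [u]) w]) 0 x = \<eta> c 0 [wirt (\<lambda>y. christoffel c y (\<xi> c 0 [u]) w) 0 x]"
    if \<eta>: "\<eta> \<in> vforms X A 1" and \<xi>: "\<xi> \<in> vforms X A 1" for \<eta> \<xi> u w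
  proof -
    have sc: "smooth_on (cdom c) (\<lambda>y. christoffel c y (\<xi> c y [u]) w)"
      by (intro smooth_on_christoffel_family c vforms_smooth[OF \<xi>] smooth_on_const open_cdom)
    show "(\<lambda>y. \<eta> c y [christoffel c y (\<xi> c y [u]) w]) differentiable (at 0)"
      by (rule sd[OF smooth_on_vforms_family[OF \<eta> c(1) sc]])
    have "wirt (\<lambda>y. \<eta> c y [0]) 0 x = wirt (\<lambda>y. 0) 0 x"
      by (rule wirt_cong_open[OF S _ d[OF \<eta>]]) (simp add: clinear_zero[OF vforms_clinear[OF \<eta> c(1)]])
    then have z: "wirt (\<lambda>y. \<eta> c y [0]) 0 x = 0" by (simp add: wirt_const)
    have "wirt (\<lambda>y. \<eta> c y [christoffel c y (\<xi> c y [u]) w]) 0 x =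
      wirt (\<lambda>y. \<eta> c y [christoffel c 0 (\<xi> c 0 [u]) w]) 0 x + \<eta> c 0 [wirt (\<lambda>y. christoffel c y (\<xi> c y [u]) w) 0 x]"
      by (rule wirt_family[OF S vforms_clinear[OF \<eta> c(1)] d[OF \<eta>] sd[OF sc]])
    also have "wirt (\<lambda>y. christoffel c y (\<xi> c y [u]) w) 0 x =
      wirt (\<lambda>y. christoffel c y (\<xi> c 0 [u]) w) 0 x + christoffel c 0 (wirt (\<lambda>y. \<xi> c y [u]) 0 x) w"
      by (rule wirt_family[OF S clinear_christoffel_1[OF c(1)] sd[OF smooth_christoffel[OF c(1)]] d[OF \<xi>]])
    finally show "wirt (\<lambda>y. \<eta> c y [christoffel c y (\<xi> c y [u]) w]) 0 x =
        \<eta> c 0 [wirt (\<lambda>y. christoffel c y (\<xi> c 0 [u]) w) 0 x]"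
      by (simp add: \<Gamma> z)
  qed
  have "wirt (\<lambda>y. nabla_bracket \<theta> \<phi> c y u w) 0 x =
    wirt (\<lambda>y. wirt (\<lambda>y. \<phi> c y [w]) y (\<theta> c y [u]) - wirt (\<lambda>y. \<theta> c y [u]) y (\<phi> c y [w])
       - \<phi> c y [christoffel c y (\<theta> c y [u]) w] + \<theta> c y [christoffel c y (\<phi> c y [w]) u]) 0 x"
    by (rule wirt_cong_open[OF S]) (simp_all add: nabla_bracket_eq[OF c(1)] lie_def sd[OF smooth_nabla_bracket[OF \<theta> \<phi> c(1)]])
  then show ?thesis
    using fam[OF \<phi> \<theta>, of w u] fam[OF \<theta> \<phi>, of u w] chr[OF \<phi> \<theta>, of u w] chr[OF \<theta> \<phi>, of w u]
    by (simp add: wirt_add wirt_diff)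
qed

text \<open>Each second derivative and each derivative of a Christoffel symbol occurs twice, with opposite signs
  and with its two directions of differentiation exchanged.\<close>

lemma jacobiator_cyclic:
  assumes \<theta>: "\<theta> \<in> vforms X A 1" and \<phi>: "\<phi> \<in> vforms X A 1" and \<gamma>: "\<gamma> \<in> vforms X A 1"
    and c: "c \<in> charts X A" "0 \<in> cdom c" and \<Gamma>: "\<And>x u. christoffel c 0 x u = 0"
  shows "jacobiator \<gamma> \<theta> \<phi> c v u w + jacobiator \<phi> \<gamma> \<theta> c w v u + jacobiator \<theta> \<phi> \<gamma> c u w v = 0"
proof -
  have br: "nabla_bracket \<eta> \<xi> c 0 a b = wirt (\<lambda>y. \<xi> c y [b]) 0 (\<eta> c 0 [a]) - wirt (\<lambda>y. \<eta> c y [a]) 0 (\<xi> c 0 [b])"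
    if "\<eta> \<in> vforms X A 1" "\<xi> \<in> vforms X A 1" for \<eta> \<xi> a b
    using clinear_zero[OF vforms_clinear[OF that(1) c]] clinear_zero[OF vforms_clinear[OF that(2) c]]
    by (simp add: nabla_bracket_eq[OF c] lie_def \<Gamma>)
  note w = wirt_nabla_bracket[OF _ _ c \<Gamma>]
  note lw = clinear_diff[OF clinear_wirt[OF vforms_differentiable[OF \<theta> c]]]
    clinear_diff[OF clinear_wirt[OF vforms_differentiable[OF \<phi> c]]]
    clinear_diff[OF clinear_wirt[OF vforms_differentiable[OF \<gamma> c]]]
  have com: "wirt (\<lambda>y. wirt (\<lambda>y. \<eta> c y [b]) y s) 0 t = wirt (\<lambda>y. wirt (\<lambda>y. \<eta> c y [b]) y t) 0 s"
    if "\<eta> \<in> vforms X A 1" for \<eta> b s t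
    by (rule wirt_commute[OF open_cdom[OF c(1)] c(2) vforms_smooth[OF that c(1)]])
  note sym = wirt_christoffel_symmetric[OF c \<Gamma>]
  show ?thesis
    unfolding jacobiator_def w[OF \<theta> \<phi>] w[OF \<gamma> \<theta>] w[OF \<phi> \<gamma>] br[OF \<theta> \<phi>] br[OF \<gamma> \<theta>] br[OF \<phi> \<gamma>] lw
      com[OF \<phi>, of w "\<theta> c 0 [u]" "\<gamma> c 0 [v]"] com[OF \<theta>, of u "\<phi> c 0 [w]" "\<gamma> c 0 [v]"]
      com[OF \<gamma>, of v "\<theta> c 0 [u]" "\<phi> c 0 [w]"]
      sym[of "\<theta> c 0 [u]" w "\<gamma> c 0 [v]"] sym[of "\<phi> c 0 [w]" u "\<gamma> c 0 [v]"] sym[of "\<theta> c 0 [u]" v "\<phi> c 0 [w]"]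
    by (simp add: algebra_simps)
qed

lemma coord_bracket_1_2_jacobiator:
  assumes \<theta>: "\<theta> \<in> vforms X A 1" and \<phi>: "\<phi> \<in> vforms X A 1" and \<gamma>: "\<gamma> \<in> vforms X A 1"
    and c: "c \<in> charts X A" "0 \<in> cdom c"
  shows "coord_bracket 1 2 (\<gamma> c) (vbracket X A \<omega> 1 1 \<theta> \<phi> c) 0 [p, q, r] =
    jacobiator \<gamma> \<theta> \<phi> c p q r - jacobiator \<gamma> \<theta> \<phi> c p r q
    + (jacobiator \<gamma> \<theta> \<phi> c q r p - jacobiator \<gamma> \<theta> \<phi> c q p r)
    + (jacobiator \<gamma> \<theta> \<phi> c r p q - jacobiator \<gamma> \<theta> \<phi> c r q p)"
proof -
  define \<psi> where "\<psi> = vbracket X A \<omega> 1 1 \<theta> \<phi>"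
  have \<psi>: "\<psi> \<in> vforms X A 2" unfolding \<psi>_def by (rule vbracket_vforms[OF \<theta> \<phi>])
  have val: "\<psi> c y [u, w] = nabla_bracket \<theta> \<phi> c y u w - nabla_bracket \<theta> \<phi> c y w u" if "y \<in> cdom c" for y u w
    unfolding \<psi>_def by (rule vbracket_1_1[OF \<theta> \<phi> c(1) that])
  have d: "(\<lambda>y. nabla_bracket \<theta> \<phi> c y u w) differentiable (at 0)" for u w
    by (rule smooth_on_imp_differentiable[OF smooth_nabla_bracket[OF \<theta> \<phi> c(1)] c(2)])
  have lie: "lie (\<gamma> c) (\<psi> c) 0 [v] [u, w] = jacobiator \<gamma> \<theta> \<phi> c v u w - jacobiator \<gamma> \<theta> \<phi> c v w u" for v u w
  proof -
    have "wirt (\<lambda>y. \<psi> c y [u, w]) 0 x = wirt (\<lambda>y. nabla_bracket \<theta> \<phi> c y u w - nabla_bracket \<theta> \<phi> c y w u) 0 x" for x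
      by (rule wirt_cong_open[OF open_cdom[OF c(1)] c(2) val vforms_differentiable[OF \<psi> c]])
    then show ?thesis
      by (simp add: lie_def jacobiator_def wirt_diff d val[OF c(2)]
          clinear_diff[OF clinear_wirt[OF vforms_differentiable[OF \<gamma> c]]])
  qed
  have "coord_bracket 1 2 (\<gamma> c) (\<psi> c) 0 [p, q, r] =
      lie (\<gamma> c) (\<psi> c) 0 [p] [q, r] + lie (\<gamma> c) (\<psi> c) 0 [q] [r, p] + lie (\<gamma> c) (\<psi> c) 0 [r] [p, q]"
  proof (rule coord_bracket_1_2[OF open_cdom[OF c(1)] c(2)])
    show "vtype 1 (\<gamma> c y)" "vtype 2 (\<psi> c y)" if "y \<in> cdom c" for y
      using vforms_vtype[OF \<gamma> c(1) that] vforms_vtype[OF \<psi> c(1) that] by auto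
    show "(\<lambda>y. \<gamma> c y vs) differentiable (at 0)" "(\<lambda>y. \<psi> c y vs) differentiable (at 0)" for vs
      by (rule vforms_differentiable[OF \<gamma> c] vforms_differentiable[OF \<psi> c])+
  qed
  then show ?thesis unfolding lie by (simp only: \<psi>_def)
qed

lemma vbracket_jacobi:
  assumes \<theta>: "\<theta> \<in> vforms X A 1" and \<phi>: "\<phi> \<in> vforms X A 1" and \<gamma>: "\<gamma> \<in> vforms X A 1"
  shows "vbracket X A \<omega> 1 2 \<gamma> (vbracket X A \<omega> 1 1 \<theta> \<phi>) d z vs
    + vbracket X A \<omega> 1 2 \<phi> (vbracket X A \<omega> 1 1 \<gamma> \<theta>) d z vs
    + vbracket X A \<omega> 1 2 \<theta> (vbracket X A \<omega> 1 1 \<phi> \<gamma>) d z vs = 0"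
proof (cases "d \<in> charts X A \<and> z \<in> cdom d \<and> length vs = 3")
  case True
  then have d: "d \<in> charts X A" and "z \<in> cdom d" "length vs = 3" by auto
  then obtain P where P: "P \<in> fst d" "z = snd d P" by auto
  have PX: "P \<in> topspace X" using P openin_subset[OF openin_chart[OF d]] by auto
  define c where "c = normal_at P"
  note c = normal_atD[OF PX, folded c_def]
  have \<Gamma>: "christoffel c 0 x u = 0" for x u
    using normal_chart_christoffel[OF normal_at[OF PX]] by (simp add: c_def)
  obtain p q r where vs: "map (jac d c (snd d P)) vs = [p, q, r]"
    using \<open>length vs = 3\<close> by (auto simp: length_Suc_conv numeral_3_eq_3)
  \<comment> \<open>The eighteen terms fall into six cyclic sums, one for each order of the arguments.\<close>
  note cyc = jacobiator_cyclic[OF \<theta> \<phi> \<gamma> c(1,4) \<Gamma>]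
  have "coord_bracket 1 2 (\<gamma> c) (vbracket X A \<omega> 1 1 \<theta> \<phi> c) 0 [p, q, r]
      + coord_bracket 1 2 (\<phi> c) (vbracket X A \<omega> 1 1 \<gamma> \<theta> c) 0 [p, q, r]
      + coord_bracket 1 2 (\<theta> c) (vbracket X A \<omega> 1 1 \<phi> \<gamma> c) 0 [p, q, r] =
     (jacobiator \<gamma> \<theta> \<phi> c p q r + jacobiator \<phi> \<gamma> \<theta> c r p q + jacobiator \<theta> \<phi> \<gamma> c q r p)
   - (jacobiator \<gamma> \<theta> \<phi> c p r q + jacobiator \<phi> \<gamma> \<theta> c q p r + jacobiator \<theta> \<phi> \<gamma> c r q p)
   + (jacobiator \<gamma> \<theta> \<phi> c q r p + jacobiator \<phi> \<gamma> \<theta> c p q r + jacobiator \<theta> \<phi> \<gamma> c r p q)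
   - (jacobiator \<gamma> \<theta> \<phi> c q p r + jacobiator \<phi> \<gamma> \<theta> c r q p + jacobiator \<theta> \<phi> \<gamma> c p r q)
   + (jacobiator \<gamma> \<theta> \<phi> c r p q + jacobiator \<phi> \<gamma> \<theta> c q r p + jacobiator \<theta> \<phi> \<gamma> c p q r)
   - (jacobiator \<gamma> \<theta> \<phi> c r q p + jacobiator \<phi> \<gamma> \<theta> c p r q + jacobiator \<theta> \<phi> \<gamma> c q p r)"
    unfolding coord_bracket_1_2_jacobiator[OF \<theta> \<phi> \<gamma> c(1,4)] coord_bracket_1_2_jacobiator[OF \<gamma> \<theta> \<phi> c(1,4)]
      coord_bracket_1_2_jacobiator[OF \<phi> \<gamma> \<theta> c(1,4)]
    by (simp add: algebra_simps)
  also have "\<dots> = 0" unfolding cyc by simp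
  finally show ?thesis
    unfolding P(2) vbracket_chart[OF d P(1), folded c_def] vs
    using clinear_zero[OF clinear_jac[OF c(1) d c(2) P(1), unfolded c(3)]]
    by (simp only: clinear_add[OF clinear_jac[OF c(1) d c(2) P(1), unfolded c(3)], symmetric])
next
  case False
  then consider "d \<notin> charts X A \<or> z \<notin> cdom d" | "d \<in> charts X A" "z \<in> cdom d" "length vs \<noteq> 1 + 2" by fastforce
  then show ?thesis
  proof cases
    case 1
    then show ?thesis by (auto simp: vbracket_def)
  next
    case 2
    show ?thesis by (simp only: vbracket_length[OF 2] add_0_left)
  qed
qed

theorem bracket_jacobi:
  assumes \<alpha>: "\<alpha> \<in> forms X A 1 1" and \<beta>: "\<beta> \<in> forms X A 1 1" and \<gamma>: "\<gamma> \<in> forms X A 1 1"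
  shows "bracket X A \<omega> 1 2 \<gamma> (bracket X A \<omega> 1 1 \<alpha> \<beta>) c z vs
    + bracket X A \<omega> 1 2 \<beta> (bracket X A \<omega> 1 1 \<gamma> \<alpha>) c z vs
    + bracket X A \<omega> 1 2 \<alpha> (bracket X A \<omega> 1 1 \<beta> \<gamma>) c z vs = 0"
proof -
  note v = to_vform_1[OF \<alpha>] to_vform_1[OF \<beta>] to_vform_1[OF \<gamma>]
  have br: "bracket X A \<omega> 1 2 \<alpha>' (bracket X A \<omega> 1 1 \<beta>' \<gamma>') =
      vinterior 3 (vbracket X A \<omega> 1 2 (to_vform X A \<omega> 1 \<alpha>')
        (vbracket X A \<omega> 1 1 (to_vform X A \<omega> 1 \<beta>') (to_vform X A \<omega> 1 \<gamma>'))) \<omega>"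
    if "\<beta>' \<in> forms X A 1 1" "\<gamma>' \<in> forms X A 1 1" for \<alpha>' \<beta>' \<gamma>'
    unfolding bracket_def add_small
    by (simp only: to_vform_2[OF vbracket_vforms[OF to_vform_1[OF that(1)] to_vform_1[OF that(2)]]])
  show ?thesis
  proof (cases "c \<in> charts X A \<and> z \<in> cdom c")
    case True
    then have t: "type11 (\<omega> c z)" using omega_type11 by blast
    show ?thesis
      unfolding br[OF \<alpha> \<beta>] br[OF \<gamma> \<alpha>] br[OF \<beta> \<gamma>] vinterior_def interior_prod_sum3[OF t]
        vbracket_jacobi[OF v(1,2,3)]
      by (rule interior_prod_zero[OF t])
  next
    case False
    then have "\<omega> c z = (\<lambda>vs. 0)" using form11_zero[OF omega_forms] by blast
    then show ?thesis
      unfolding br[OF \<alpha> \<beta>] br[OF \<gamma> \<alpha>] br[OF \<beta> \<gamma>] vinterior_def by (simp add: interior_prod_zero_form)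
  qed
qed

end

theorem theorem2p4:
  fixes X :: "'a topology" and A :: "('a, 'n::{finite,linorder}) chart set"
    and \<omega> \<alpha> \<beta> \<gamma> :: "('a, 'n) form"
  assumes "compact_space X" and "Hausdorff_space X" and "complex_atlas X A"
    and "kaehler_form X A \<omega>" and "real_analytic_metric X A \<omega>"
    and "\<alpha> \<in> forms X A 1 1" and "\<beta> \<in> forms X A 1 1" and "\<gamma> \<in> forms X A 1 1"
  shows "\<forall>c z vs.
      bracket X A \<omega> 1 2 \<gamma> (bracket X A \<omega> 1 1 \<alpha> \<beta>) c z vs
    + bracket X A \<omega> 1 2 \<beta> (bracket X A \<omega> 1 1 \<gamma> \<alpha>) c z vs
    + bracket X A \<omega> 1 2 \<alpha> (bracket X A \<omega> 1 1 \<beta> \<gamma>) c z vs = 0"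
proof -
  interpret kaehler X A \<omega>
    using assms by unfold_locales
  show ?thesis using bracket_jacobi[OF assms(6-8)] by blast
qed

end
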